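(* There is a polynomial-time algorithm that, given any metric instance $(G,w,\mathcal{T})$ of the Steiner Multicycle problem, outputs a set of vertex-disjoint cycles of $G$ that respects $\mathcal{T}$ and whose cost is at most $3\,\mathrm{opt}(G,w,\mathcal{T})$. That is, there is a 3-approximation algorithm for the Metric Steiner Multicycle problem.
   Context: Steiner Multicycle problem: the input is a complete graph $G$, a weight function $w\colon E(G)\to\mathbb{Q}_{\ge 0}$, and a collection $\mathcal{T}$ of pairwise disjoint subsets of $V(G)$, each of size at least 2 (terminal sets). A cycle is a nonempty connected subgraph all of whose vertices have degree 2; in addition, for each $T\in\mathcal{T}$ with $|T|=2$, the edge joining the two vertices of $T$ is duplicated, so a cycle of length 2 consisting of these two parallel edges (of cost twice the weight of that edge) is allowed. A cycle $C$ respects $\mathcal{T}$ if for every $T\in\mathcal{T}$ either $T\subseteq V(C)$ or $T\cap V(C)=\emptyset$. A set $\mathcal{C}$ of vertex-disjoint cycles respects $\mathcal{T}$ if every cycle in it respects $\mathcal{T}$ and every vertex of every terminal set lies in some cycle of $\mathcal{C}$. The cost $w(\mathcal{C})$ is the total weight of edges over all cycles of $\mathcal{C}$. The goal is to find such a set of minimum cost; $\mathrm{opt}(G,w,\mathcal{T})$ denotes this minimum. An instance is metric if $w$ satisfies the triangle inequality $w(ac)\le w(ab)+w(bc)$ for all distinct vertices $a,b,c$. *)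

theory Defs
  imports
    "HOL-Library.Log_Nat"
    "HOL-Computational_Algebra.Polynomial"
begin

section \<open>The Steiner Multicycle problem\<close>

text \<open>
  The complete graph is given by its finite vertex set; its edges are the two-element sets of
  vertices. Parallel edges are told apart by a copy number: every edge has copy 0, and the edge
  joining the two vertices of a terminal set of size 2 also has copy 1. Both copies have the
  same weight.
\<close>

type_synonym 'a medge = "'a set \<times> nat"
type_synonym 'a subgraph = "'a set \<times> 'a medge set"

abbreviation verts :: "'a subgraph \<Rightarrow> 'a set" where "verts C \<equiv> fst C"
abbreviation edges :: "'a subgraph \<Rightarrow> 'a medge set" where "edges C \<equiv> snd C"
abbreviation ends :: "'a medge \<Rightarrow> 'a set" where "ends e \<equiv> fst e"

definition steiner_instance :: "'a set \<Rightarrow> ('a set \<Rightarrow> rat) \<Rightarrow> 'a set set \<Rightarrow> bool" where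
  "steiner_instance V w \<T> \<longleftrightarrow>
     finite V \<and>
     (\<forall>e. e \<subseteq> V \<and> card e = 2 \<longrightarrow> 0 \<le> w e) \<and>
     (\<forall>T\<in>\<T>. T \<subseteq> V \<and> 2 \<le> card T) \<and>
     pairwise disjnt \<T>"

definition metric_instance :: "'a set \<Rightarrow> ('a set \<Rightarrow> rat) \<Rightarrow> 'a set set \<Rightarrow> bool" where
  "metric_instance V w \<T> \<longleftrightarrow>
     steiner_instance V w \<T> \<and>
     (\<forall>a\<in>V. \<forall>b\<in>V. \<forall>c\<in>V. a \<noteq> b \<and> b \<noteq> c \<and> a \<noteq> c \<longrightarrow> w {a, c} \<le> w {a, b} + w {b, c})"

definition medges :: "'a set \<Rightarrow> 'a set set \<Rightarrow> 'a medge set" where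
  "medges V \<T> = {(e, 0) | e. e \<subseteq> V \<and> card e = 2} \<union> {(T, 1) | T. T \<in> \<T> \<and> card T = 2}"

definition subgraph :: "'a set \<Rightarrow> 'a set set \<Rightarrow> 'a subgraph \<Rightarrow> bool" where
  "subgraph V \<T> C \<longleftrightarrow>
     verts C \<subseteq> V \<and> edges C \<subseteq> medges V \<T> \<and> (\<forall>e\<in>edges C. ends e \<subseteq> verts C)"

definition degree_in :: "'a subgraph \<Rightarrow> 'a \<Rightarrow> nat" where
  "degree_in C v = card {e \<in> edges C. v \<in> ends e}"

definition connected_subgraph :: "'a subgraph \<Rightarrow> bool" where
  "connected_subgraph C \<longleftrightarrow>
     (\<forall>u\<in>verts C. \<forall>v\<in>verts C. (u, v) \<in> {(x, y). \<exists>e\<in>edges C. ends e = {x, y}}\<^sup>*)"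

definition cycle :: "'a set \<Rightarrow> 'a set set \<Rightarrow> 'a subgraph \<Rightarrow> bool" where
  "cycle V \<T> C \<longleftrightarrow>
     subgraph V \<T> C \<and> verts C \<noteq> {} \<and> connected_subgraph C \<and> (\<forall>v\<in>verts C. degree_in C v = 2)"

definition cycle_respects :: "'a set set \<Rightarrow> 'a subgraph \<Rightarrow> bool" where
  "cycle_respects \<T> C \<longleftrightarrow> (\<forall>T\<in>\<T>. T \<subseteq> verts C \<or> T \<inter> verts C = {})"

definition disjoint_cycles :: "'a set \<Rightarrow> 'a set set \<Rightarrow> 'a subgraph set \<Rightarrow> bool" where
  "disjoint_cycles V \<T> \<C> \<longleftrightarrow>
     (\<forall>C\<in>\<C>. cycle V \<T> C) \<and> pairwise (\<lambda>C D. disjnt (verts C) (verts D)) \<C>"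

definition cycles_respect :: "'a set set \<Rightarrow> 'a subgraph set \<Rightarrow> bool" where
  "cycles_respect \<T> \<C> \<longleftrightarrow> (\<forall>C\<in>\<C>. cycle_respects \<T> C) \<and> (\<forall>T\<in>\<T>. \<forall>v\<in>T. \<exists>C\<in>\<C>. v \<in> verts C)"

definition weight :: "('a set \<Rightarrow> rat) \<Rightarrow> 'a subgraph set \<Rightarrow> rat" where
  "weight w \<C> = (\<Sum>C\<in>\<C>. \<Sum>e\<in>edges C. w (ends e))"

definition opt :: "'a set \<Rightarrow> ('a set \<Rightarrow> rat) \<Rightarrow> 'a set set \<Rightarrow> rat" where
  "opt V w \<T> = Min (weight w ` {\<C>. disjoint_cycles V \<T> \<C> \<and> cycles_respect \<T> \<C>})"

text \<open>The minimum ranges over a finite, nonempty set, so it is attained.\<close>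

lemma finite_disjoint_cycles:
  assumes "steiner_instance V w \<T>"
  shows "finite {\<C>. disjoint_cycles V \<T> \<C>}"
proof -
  have V: "finite V" and "\<T> \<subseteq> Pow V"
    using assms by (auto simp: steiner_instance_def)
  then have "medges V \<T> \<subseteq> Pow V \<times> {0, 1}"
    by (auto simp: medges_def)
  then have "finite (medges V \<T>)"
    using V by (meson finite.emptyI finite.insertI finite_Pow_iff finite_SigmaI finite_subset)
  then have "finite (Pow (Pow V \<times> Pow (medges V \<T>)))"
    using V by simp
  moreover have "{\<C>. disjoint_cycles V \<T> \<C>} \<subseteq> Pow (Pow V \<times> Pow (medges V \<T>))"
    by (force simp: disjoint_cycles_def cycle_def subgraph_def)
  ultimately show ?thesis
    by (rule rev_finite_subset)
qed

lemma cycle_through: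
  assumes inst: "steiner_instance V w \<T>" and T: "T \<in> \<T>"
  shows "\<exists>C. cycle V \<T> C \<and> verts C = T"
proof -
  have TV: "T \<subseteq> V" and c2: "2 \<le> card T" and finT: "finite T"
    using inst T by (auto simp: steiner_instance_def intro: finite_subset)
  show ?thesis
  proof (cases "card T = 2")
    case True
    then obtain a b where ab: "T = {a, b}" "a \<noteq> b"
      by (meson card_2_iff)
    define C :: "'a subgraph" where "C = (T, {(T, 0), (T, 1)})"
    have deg: "degree_in C v = 2" if "v \<in> T" for v
    proof -
      have "{e \<in> edges C. v \<in> ends e} = {(T, 0), (T, 1)}"
        using that by (auto simp: C_def)
      then show ?thesis by (simp add: degree_in_def)
    qed
    have "connected_subgraph C"
      by (auto simp: connected_subgraph_def C_def ab insert_commute intro!: r_into_rtrancl)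
    then have "cycle V \<T> C"
      using deg True T TV ab by (auto simp: cycle_def subgraph_def C_def medges_def)
    then show ?thesis by (auto simp: C_def)
  next
    case False
    define n where "n = card T"
    have n: "3 \<le> n" using False c2 by (simp add: n_def)
    obtain h where h: "bij_betw h {0..<n} T"
      using ex_bij_betw_nat_finite[OF finT] by (auto simp: n_def)
    have inj: "h i = h j \<longleftrightarrow> i = j" if "i < n" "j < n" for i j
      using h that by (auto simp: bij_betw_def inj_on_def)
    have hT: "T = h ` {..<n}"
      using h by (auto simp: bij_betw_def)
    define s where "s i = (if Suc i = n then 0 else Suc i)" for i
    have s: "s i < n" "s i \<noteq> i" if "i < n" for i
      using that n by (auto simp: s_def)
    define E where "E i = {h i, h (s i)}" for i
    define C :: "'a subgraph" where "C = (T, (\<lambda>i. (E i, 0)) ` {..<n})"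
    have E_in: "E i \<subseteq> T \<and> card (E i) = 2" if "i < n" for i
      using that s[OF that] inj[of i "s i"] by (auto simp: E_def hT)
    have sub: "subgraph V \<T> C"
      using TV E_in by (fastforce simp: subgraph_def C_def medges_def)
    have deg: "degree_in C v = 2" if "v \<in> T" for v
    proof -
      obtain i where i: "i < n" "v = h i" using \<open>v \<in> T\<close> by (auto simp: hT)
      define p where "p = (if i = 0 then n - 1 else i - 1)"
      have p: "p < n" "p \<noteq> i" and sp: "\<And>j. j < n \<Longrightarrow> s j = i \<longleftrightarrow> j = p"
        using i n by (auto simp: p_def s_def)
      have "v \<in> E j \<longleftrightarrow> j = i \<or> j = p" if "j < n" for j
        using i sp[OF that] s(1)[OF that] inj[of i j] inj[of i "s j"] that by (auto simp: E_def)
      then have "{e \<in> edges C. v \<in> ends e} = {(E i, 0), (E p, 0)}"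
        using i p by (auto simp: C_def)
      moreover have "E i \<noteq> E p"
      proof
        assume "E i = E p"
        moreover have "E p = {h p, h i}" "h i \<noteq> h p"
          using sp[OF p(1)] inj[OF i(1) p(1)] p(2) by (simp_all add: E_def)
        ultimately have "h (s i) = h p"
          by (metis E_def doubleton_eq_iff)
        then have "s i = p"
          using inj[OF s(1)[OF i(1)] p(1)] by simp
        then show False
          using i n by (auto simp: s_def p_def split: if_splits)
      qed
      ultimately show ?thesis by (simp add: degree_in_def)
    qed
    define R where "R = {(x, y). \<exists>e\<in>edges C. ends e = {x, y}}"
    have symR: "sym R" by (auto simp: R_def sym_def insert_commute)
    have step: "(h i, h (Suc i)) \<in> R" if "Suc i < n" for i
      using that by (auto simp: R_def C_def E_def s_def intro!: bexI[of _ i])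
    have from0: "i < n \<Longrightarrow> (h 0, h i) \<in> R\<^sup>*" for i
    proof (induction i)
      case (Suc i)
      then show ?case using step[of i] by (meson Suc_lessD rtrancl.rtrancl_into_rtrancl)
    qed simp
    have "(h i, h j) \<in> R\<^sup>*" if "i < n" "j < n" for i j
      using from0[OF that(1)] from0[OF that(2)] sym_rtrancl[OF symR]
      by (meson rtrancl_trans symD)
    then have "connected_subgraph C"
      unfolding connected_subgraph_def R_def[symmetric] by (auto simp: C_def hT)
    then have "cycle V \<T> C"
      using sub deg c2 by (auto simp: cycle_def C_def)
    then show ?thesis by (auto simp: C_def)
  qed
qed

lemma ex_disjoint_cycles:
  assumes inst: "steiner_instance V w \<T>"
  shows "\<exists>\<C>. disjoint_cycles V \<T> \<C> \<and> cycles_respect \<T> \<C>"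
proof -
  obtain f where f: "\<And>T. T \<in> \<T> \<Longrightarrow> cycle V \<T> (f T) \<and> verts (f T) = T"
    using cycle_through[OF inst] by metis
  have disj: "pairwise disjnt \<T>"
    using inst by (simp add: steiner_instance_def)
  have "disjoint_cycles V \<T> (f ` \<T>)"
    using f disj by (auto simp: disjoint_cycles_def pairwise_def)
  moreover have "cycles_respect \<T> (f ` \<T>)"
    using f disj by (fastforce simp: cycles_respect_def cycle_respects_def pairwise_def disjnt_def)
  ultimately show ?thesis by blast
qed

lemma opt_attained:
  assumes "steiner_instance V w \<T>"
  shows "\<exists>\<C>. disjoint_cycles V \<T> \<C> \<and> cycles_respect \<T> \<C> \<and> weight w \<C> = opt V w \<T>"
    and "\<And>\<C>. disjoint_cycles V \<T> \<C> \<Longrightarrow> cycles_respect \<T> \<C> \<Longrightarrow> opt V w \<T> \<le> weight w \<C>"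
proof -
  let ?S = "{\<C>. disjoint_cycles V \<T> \<C> \<and> cycles_respect \<T> \<C>}"
  have fin: "finite (weight w ` ?S)"
    using finite_disjoint_cycles[OF assms] by (intro finite_imageI) (auto elim: rev_finite_subset)
  have "weight w ` ?S \<noteq> {}"
    using ex_disjoint_cycles[OF assms] by auto
  from Min_in[OF fin this]
  show "\<exists>\<C>. disjoint_cycles V \<T> \<C> \<and> cycles_respect \<T> \<C> \<and> weight w \<C> = opt V w \<T>"
    by (auto simp: opt_def)
  show "\<And>\<C>. disjoint_cycles V \<T> \<C> \<Longrightarrow> cycles_respect \<T> \<C> \<Longrightarrow> opt V w \<T> \<le> weight w \<C>"
    using fin by (auto simp: opt_def intro!: Min_le)
qed


section \<open>Random access machines with logarithmic cost\<close>

text \<open>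
  A random access machine with finitely many registers per program, an indirectly addressed
  memory, a sequential input tape and a sequential output tape, all holding natural numbers of
  arbitrary size. Control flow is structured. Every operand, address and intermediate result is
  charged its binary length, so that a computation of cost \<open>t\<close> only handles numbers of at most
  \<open>t\<close> bits; this is the logarithmic cost criterion, under which polynomial time
  coincides with polynomial time on Turing machines.
\<close>

datatype arith_op = Plus | Minus | Times | Div

datatype expr =
    Const nat
  | Reg nat
  | Mem expr
  | Bin arith_op expr expr

datatype prog =
    Skip
  | Assign nat expr
  | Store expr expr
  | Read nat
  | Write expr
  | Seq prog prog
  | Cond expr prog prog
  | While expr prog

record ram_state =
  reg :: "nat \<Rightarrow> nat"
  mem :: "nat \<Rightarrow> nat"
  inp :: "nat list"
  outp :: "nat list"

definition len :: "nat \<Rightarrow> nat" where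
  "len x = Suc (floorlog 2 x)"

definition input_size :: "nat list \<Rightarrow> nat" where
  "input_size xs = (\<Sum>x\<leftarrow>xs. len x)"

text \<open>Subtraction is truncated at 0, and division by 0 yields 0.\<close>

fun apply_op :: "arith_op \<Rightarrow> nat \<Rightarrow> nat \<Rightarrow> nat" where
  "apply_op Plus x y = x + y"
| "apply_op Minus x y = x - y"
| "apply_op Times x y = x * y"
| "apply_op Div x y = x div y"

primrec val :: "ram_state \<Rightarrow> expr \<Rightarrow> nat" where
  "val s (Const c) = c"
| "val s (Reg r) = reg s r"
| "val s (Mem a) = mem s (val s a)"
| "val s (Bin f a b) = apply_op f (val s a) (val s b)"

primrec cost :: "ram_state \<Rightarrow> expr \<Rightarrow> nat" where
  "cost s (Const c) = len c"
| "cost s (Reg r) = len (reg s r)"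
| "cost s (Mem a) = cost s a + len (mem s (val s a))"
| "cost s (Bin f a b) = cost s a + cost s b + len (apply_op f (val s a) (val s b))"

text \<open>
  \<open>exec c s t s'\<close>: started in state \<open>s\<close>, the program \<open>c\<close> terminates in state \<open>s'\<close> at cost \<open>t\<close>.
  A condition holds iff its value is nonzero. Reading beyond the end of the input yields 0.
\<close>

inductive exec :: "prog \<Rightarrow> ram_state \<Rightarrow> nat \<Rightarrow> ram_state \<Rightarrow> bool" where
  Skip: "exec Skip s 1 s"
| Assign: "exec (Assign r a) s (1 + cost s a) (s\<lparr>reg := (reg s)(r := val s a)\<rparr>)"
| Store: "exec (Store a b) s (1 + cost s a + cost s b) (s\<lparr>mem := (mem s)(val s a := val s b)\<rparr>)"
| Read: "inp s = x # xs \<Longrightarrow>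
    exec (Read r) s (1 + len x) (s\<lparr>reg := (reg s)(r := x), inp := xs\<rparr>)"
| ReadEnd: "inp s = [] \<Longrightarrow> exec (Read r) s 1 (s\<lparr>reg := (reg s)(r := 0)\<rparr>)"
| Write: "exec (Write a) s (1 + cost s a) (s\<lparr>outp := outp s @ [val s a]\<rparr>)"
| Seq: "exec c s t s' \<Longrightarrow> exec d s' t' s'' \<Longrightarrow> exec (Seq c d) s (t + t') s''"
| CondTrue: "val s a \<noteq> 0 \<Longrightarrow> exec c s t s' \<Longrightarrow> exec (Cond a c d) s (1 + cost s a + t) s'"
| CondFalse: "val s a = 0 \<Longrightarrow> exec d s t s' \<Longrightarrow> exec (Cond a c d) s (1 + cost s a + t) s'"
| WhileFalse: "val s a = 0 \<Longrightarrow> exec (While a c) s (1 + cost s a) s"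
| WhileTrue: "val s a \<noteq> 0 \<Longrightarrow> exec c s t s' \<Longrightarrow> exec (While a c) s' t' s'' \<Longrightarrow>
    exec (While a c) s (1 + cost s a + t + t') s''"

inductive_cases SkipE: "exec Skip s t s'"
inductive_cases AssignE: "exec (Assign r a) s t s'"
inductive_cases StoreE: "exec (Store a b) s t s'"
inductive_cases ReadE: "exec (Read r) s t s'"
inductive_cases WriteE: "exec (Write a) s t s'"
inductive_cases SeqE: "exec (Seq c d) s t s'"
inductive_cases CondE: "exec (Cond a c d) s t s'"
inductive_cases WhileE: "exec (While a c) s t s'"

lemma exec_deterministic:
  "exec c s t s' \<Longrightarrow> exec c s u s'' \<Longrightarrow> u = t \<and> s'' = s'"
proof (induction arbitrary: u s'' rule: exec.induct)
  case Skip
  then show ?case by (auto elim: SkipE)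
next
  case Assign
  then show ?case by (auto elim: AssignE)
next
  case Store
  then show ?case by (auto elim: StoreE)
next
  case Read
  from Read.prems Read.hyps show ?case by (auto elim: ReadE)
next
  case ReadEnd
  from ReadEnd.prems ReadEnd.hyps show ?case by (auto elim: ReadE)
next
  case Write
  then show ?case by (auto elim: WriteE)
next
  case Seq
  from Seq.prems show ?case by (rule SeqE) (auto dest!: Seq.IH)
next
  case CondTrue
  from CondTrue.prems show ?case
    by (rule CondE) (use CondTrue.hyps in \<open>auto dest!: CondTrue.IH\<close>)
next
  case CondFalse
  from CondFalse.prems show ?case
    by (rule CondE) (use CondFalse.hyps in \<open>auto dest!: CondFalse.IH\<close>)
next
  case WhileFalse
  from WhileFalse.prems WhileFalse.hyps show ?case by (auto elim: WhileE)
next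
  case WhileTrue
  from WhileTrue.prems show ?case
    by (rule WhileE) (use WhileTrue.hyps in \<open>auto dest!: WhileTrue.IH\<close>)
qed

definition init_state :: "nat list \<Rightarrow> ram_state" where
  "init_state xs = \<lparr>reg = (\<lambda>_. 0), mem = (\<lambda>_. 0), inp = xs, outp = []\<rparr>"

definition runs :: "prog \<Rightarrow> nat list \<Rightarrow> nat \<Rightarrow> nat list \<Rightarrow> bool" where
  "runs c xs t ys \<longleftrightarrow> (\<exists>s. exec c (init_state xs) t s \<and> outp s = ys)"


section \<open>Encodings of instances and of sets of cycles\<close>

definition encode_lists :: "('b \<Rightarrow> nat list) \<Rightarrow> 'b list list \<Rightarrow> nat list" where
  "encode_lists f xss = length xss # concat (map (\<lambda>xs. length xs # concat (map f xs)) xss)"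

text \<open>
  Weights are given as reduced fractions, in binary. The terminal sets, and the vertices within
  each of them, are listed in an arbitrary order without repetition.
\<close>

definition encode_weight :: "rat \<Rightarrow> nat list" where
  "encode_weight q = (case quotient_of q of (a, b) \<Rightarrow> [nat a, nat b])"

definition encodes_instance ::
    "nat \<Rightarrow> (nat set \<Rightarrow> rat) \<Rightarrow> nat set set \<Rightarrow> nat list \<Rightarrow> bool" where
  "encodes_instance n w \<T> xs \<longleftrightarrow>
     (\<exists>ts. \<T> = set (map set ts) \<and> distinct (map set ts) \<and> (\<forall>t\<in>set ts. distinct t) \<and>
        xs = n # concat (map (\<lambda>j. concat (map (\<lambda>i. encode_weight (w {i, j})) [0..<j])) [0..<n])
             @ encode_lists (\<lambda>v. [v]) ts)"

text \<open>A cycle is given by the list of its edges, each as its two ends and its copy number.\<close>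

definition edge_of :: "nat \<times> nat \<times> nat \<Rightarrow> nat medge" where
  "edge_of = (\<lambda>(u, v, k). ({u, v}, k))"

definition subgraph_of :: "(nat \<times> nat \<times> nat) list \<Rightarrow> nat subgraph" where
  "subgraph_of es = (\<Union>e\<in>set es. ends (edge_of e), edge_of ` set es)"

definition encodes_cycles :: "nat subgraph set \<Rightarrow> nat list \<Rightarrow> bool" where
  "encodes_cycles \<C> ys \<longleftrightarrow>
     (\<exists>ess. \<C> = set (map subgraph_of ess) \<and> distinct (map subgraph_of ess) \<and>
        (\<forall>es\<in>set ess. distinct (map edge_of es)) \<and>
        ys = encode_lists (\<lambda>(u, v, k). [u, v, k]) ess)"

end

theory Submission
  imports Defs
begin

text \<open>
  The algorithm is the primal-dual method of Goemans and Williamson for Steiner forest. A class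
  of vertices is active if it separates some terminal set. All active classes are charged at the
  same rate \<open>\<epsilon>\<close> for the edges leaving them until an edge between two classes is fully
  paid for; this edge joins its classes. In the end the edges are pruned to a minimal set \<open>F\<close>
  that still connects every terminal set.

  At any moment, contracting the classes turns \<open>F\<close> into a forest in which every inactive class has degree 0
  or at least 2, so the active classes have average degree at most 2 in \<open>F\<close>. On the other
  hand, the cycle through a separated terminal set crosses the boundary of an active class at least
  twice. Summing the charges gives \<open>w(F) \<le> opt\<close>.

  Finally, let \<open>\<pi>\<close> be the identity on the vertices, and for every edge \<open>uv\<close> of \<open>F\<close> exchange
  \<open>\<pi>(u)\<close> and \<open>\<pi>(v)\<close>. This joins the cycles of \<open>u\<close> and \<open>v\<close> and, by the triangle
  inequality, costs at most \<open>2 w(uv)\<close>. The cycles of \<open>\<pi>\<close> therefore cost at most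
  \<open>2 w(F) \<le> 2 opt\<close>, which is even better than the factor 3.
\<close>

section \<open>Labellings and cuts\<close>

text \<open>Two obstacles shape the proof. A class of two vertices yields a closed walk that uses
  one edge twice, and this is a cycle only if the class is a terminal set, since only there the edge
  is duplicated. Minimality of \<open>F\<close> settles this: a class with at least two vertices
  contains an edge of \<open>F\<close>, hence a terminal, hence a whole terminal set, which fills a
  class of size 2. The other obstacle is polynomial time with exact fractions under logarithmic
  cost. All weights get one common denominator; since a charge may be half an integer, all numbers
  are doubled in each round, at the price of one bit. Products of two computed numbers could instead
  double the length in every round, so the loop language admits only additive growth of stored
  lengths. Exchanging successors, rather than doubling \<open>F\<close> and shortcutting Euler
  tours, keeps all cycles in a single array and reduces the cost bound to two triangle inequalities
  per edge.\<close>

text \<open>A partition of the vertices is given by a labelling: a class consists of the vertices with the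
  same label. \<open>labelling L E K m\<close> arises from \<open>L\<close> by joining along the edges \<open>E i\<close> with
  \<open>i \<in> K\<close> and \<open>i < m\<close>.\<close>

definition merge_label :: "('a \<Rightarrow> 'b) \<Rightarrow> 'a \<times> 'a \<Rightarrow> 'a \<Rightarrow> 'b" where
  "merge_label L e x = (if L x = L (fst e) then L (snd e) else L x)"

primrec labelling :: "('a \<Rightarrow> 'b) \<Rightarrow> (nat \<Rightarrow> 'a \<times> 'a) \<Rightarrow> nat set \<Rightarrow> nat \<Rightarrow> 'a \<Rightarrow> 'b" where
  "labelling L E K 0 = L"
| "labelling L E K (Suc m) = (if m \<in> K then merge_label (labelling L E K m) (E m) else labelling L E K m)"

lemma labelling_coarser: "L u = L v \<Longrightarrow> labelling L E K m u = labelling L E K m v"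
  by (induction m) (auto simp: merge_label_def)

lemma labelling_edge: "i < m \<Longrightarrow> i \<in> K \<Longrightarrow> labelling L E K m (fst (E i)) = labelling L E K m (snd (E i))"
  by (induction m) (auto simp: merge_label_def less_Suc_eq)

text \<open>Universal property: this is the finest partition coarser than \<open>L\<close> that
  joins the chosen edges. It stands in for path arguments: to compare two partitions, only the
  generating edges have to be inspected.\<close>

lemma labelling_least:
  assumes "\<And>u v. L u = L v \<Longrightarrow> M u = M v"
    and "\<And>i. i < m \<Longrightarrow> i \<in> K \<Longrightarrow> M (fst (E i)) = M (snd (E i))"
    and "labelling L E K m u = labelling L E K m v"
  shows "M u = M v"
  using assms(3,2)
proof (induction m arbitrary: u v)
  case 0
  have "L u = L v" using 0(1) by simp
  from assms(1)[OF this] show ?case .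
next
  case (Suc m u v)
  let ?L = "labelling L E K m"
  have IH: "M x = M y" if "?L x = ?L y" for x y
    by (rule Suc.IH[OF that]) (rule Suc.prems(2)[OF less_SucI])
  show ?case
  proof (cases "m \<in> K")
    case True
    have e: "M (fst (E m)) = M (snd (E m))" by (rule Suc.prems(2)[OF lessI True])
    have "merge_label ?L (E m) u = merge_label ?L (E m) v" using Suc.prems(1) True by simp
    then consider "?L u = ?L v" | "?L u = ?L (fst (E m))" "?L (snd (E m)) = ?L v"
      | "?L v = ?L (fst (E m))" "?L u = ?L (snd (E m))"
      by (auto simp: merge_label_def split: if_splits)
    then show ?thesis
    proof cases
      case 1
      then show ?thesis by (rule IH)
    next
      case 2
      then show ?thesis using IH e by metis
    next
      case 3
      then show ?thesis using IH e by metis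
    qed
  next
    case False
    have "?L u = ?L v" using Suc.prems(1) False by simp
    then show ?thesis by (rule IH)
  qed
qed

lemma labelling_cong:
  "(\<And>i. i < m \<Longrightarrow> i \<in> K \<Longrightarrow> E i = E' i) \<Longrightarrow> (\<And>i. i < m \<Longrightarrow> i \<in> K \<longleftrightarrow> i \<in> K') \<Longrightarrow>
   labelling L E K m = labelling L E' K' m"
  by (induction m) auto

lemma labelling_mono:
  assumes "\<And>i. i < m \<Longrightarrow> i \<in> K \<Longrightarrow> i < m' \<and> i \<in> K'"
  shows "labelling L E K m u = labelling L E K m v \<Longrightarrow> labelling L E K' m' u = labelling L E K' m' v"
  by (rule labelling_least[of L "labelling L E K' m'" m K E]) (auto intro: labelling_coarser labelling_edge dest: assms)

text \<open>Started from \<open>id\<close>, a class is labelled by one of its own vertices. This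
  canonical representative is the vertex under which the cycle of the class is written at the
  end.\<close>

lemma labelling_rep: "labelling id E K m (labelling id E K m x) = labelling id E K m x"
  by (induction m arbitrary: x) (simp_all add: merge_label_def)

lemma labelling_less:
  "(\<And>i. i < m \<Longrightarrow> i \<in> K \<Longrightarrow> snd (E i) < n) \<Longrightarrow> x < n \<Longrightarrow> labelling id E K m x < n"
  by (induction m arbitrary: x) (auto simp: merge_label_def)

text \<open>Exactly the label \<open>L a\<close> disappears: the bearers of all other labels are
  untouched, and \<open>b\<close> still bears \<open>L b\<close>.\<close>

lemma card_merge_label_image:
  assumes "finite N" "a \<in> N" "b \<in> N" "L a \<noteq> L b"
  shows "card (merge_label L (a, b) ` N) + 1 = card (L ` N)"
proof -
  have "insert (L a) (merge_label L (a, b) ` N) = L ` N" "L a \<notin> merge_label L (a, b) ` N"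
    using assms by (auto simp: merge_label_def image_iff)
  then show ?thesis using assms by (metis Suc_eq_plus1 card_insert_disjoint finite_imageI)
qed

text \<open>Edge count of a forest: an edge between two different current classes lowers the number
  of classes by exactly one.\<close>

lemma card_labelling_image:
  assumes "finite N"
    and "\<And>i. i < m \<Longrightarrow> i \<in> D \<Longrightarrow> fst (E i) \<in> N \<and> snd (E i) \<in> N \<and>
           labelling L E D i (fst (E i)) \<noteq> labelling L E D i (snd (E i))"
  shows "card (labelling L E D m ` N) + card (D \<inter> {..<m}) = card (L ` N)"
  using assms(2)
proof (induction m)
  case (Suc m)
  have IH: "card (labelling L E D m ` N) + card (D \<inter> {..<m}) = card (L ` N)"
    using Suc by simp
  show ?case
  proof (cases "m \<in> D")
    case True
    then have "card (merge_label (labelling L E D m) (E m) ` N) + 1 = card (labelling L E D m ` N)"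
      using Suc.prems[of m] assms(1) card_merge_label_image[of N "fst (E m)" "snd (E m)" "labelling L E D m"] True by simp
    moreover have "D \<inter> {..<Suc m} = insert m (D \<inter> {..<m})" using True by auto
    ultimately show ?thesis using IH True by simp
  next
    case False
    then have "D \<inter> {..<Suc m} = D \<inter> {..<m}" by (auto simp: less_Suc_eq)
    then show ?thesis using IH False by simp
  qed
qed simp

definition active :: "'a set set \<Rightarrow> ('a \<Rightarrow> 'b) \<Rightarrow> 'b \<Rightarrow> bool" where
  "active \<T> L c \<longleftrightarrow> (\<exists>T\<in>\<T>. \<exists>u\<in>T. \<exists>v\<in>T. L u = c \<and> L v \<noteq> c)"

text \<open>The rate, 0, 1 or 2, at which the edge \<open>uv\<close> is paid for while the classes
  are those of \<open>L\<close>.\<close>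

definition active_ends :: "'a set set \<Rightarrow> ('a \<Rightarrow> 'b) \<Rightarrow> 'a \<Rightarrow> 'a \<Rightarrow> nat" where
  "active_ends \<T> L u v = (if L u = L v then 0 else of_bool (active \<T> L (L u)) + of_bool (active \<T> L (L v)))"

definition feasible :: "'a set set \<Rightarrow> ('a \<Rightarrow> 'b) \<Rightarrow> bool" where
  "feasible \<T> L \<longleftrightarrow> (\<forall>T\<in>\<T>. \<forall>u\<in>T. \<forall>v\<in>T. L u = L v)"

lemma feasible_iff_not_active: "feasible \<T> L \<longleftrightarrow> (\<forall>c. \<not> active \<T> L c)"
  unfolding feasible_def active_def by metis

section \<open>Cycles and the cuts they cross\<close>

lemma medges_subset: "(\<And>T. T \<in> \<T> \<Longrightarrow> T \<subseteq> V) \<Longrightarrow> medges V \<T> \<subseteq> Pow V \<times> {0, 1}"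
  by (auto simp: medges_def)

text \<open>Parity and connectivity: the degrees in \<open>S\<close> add up to the number of
  crossing edges plus twice the number of inner edges, so the former is even, and a walk from
  \<open>x\<close> to \<open>y\<close> makes it nonzero. Edges are counted with their copies, which
  covers cycles of length 2.\<close>

lemma cycle_crosses_cut_twice:
  assumes V: "finite V" and C: "cycle V \<T> C" and T: "\<And>T. T \<in> \<T> \<Longrightarrow> T \<subseteq> V"
    and x: "x \<in> verts C" "x \<in> S" and y: "y \<in> verts C" "y \<notin> S"
  shows "2 \<le> card {e \<in> edges C. card (ends e \<inter> S) = 1}"
proof -
  have sub: "edges C \<subseteq> medges V \<T>" and vV: "verts C \<subseteq> V"
    and ev: "\<And>e. e \<in> edges C \<Longrightarrow> ends e \<subseteq> verts C"
    and deg: "\<And>v. v \<in> verts C \<Longrightarrow> card {e \<in> edges C. v \<in> ends e} = 2"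
    and conn: "(x, y) \<in> {(x, y). \<exists>e\<in>edges C. ends e = {x, y}}\<^sup>*"
    using C x y by (auto simp: cycle_def subgraph_def degree_in_def connected_subgraph_def)
  have c2: "card (ends e) = 2" if "e \<in> edges C" for e
    using that sub by (auto simp: medges_def)
  have "edges C \<subseteq> Pow V \<times> {0, 1}"
    using sub medges_subset[OF T] by blast
  then have fE: "finite (edges C)" by (rule finite_subset) (use V in simp)
  have fv: "finite (verts C)" using V vV finite_subset by blast
  let ?X = "{e \<in> edges C. card (ends e \<inter> S) = 1}"
  let ?D = "{e \<in> edges C. card (ends e \<inter> S) = 2}"
  have "2 * card (verts C \<inter> S) = (\<Sum>v\<in>verts C \<inter> S. card {e \<in> edges C. v \<in> ends e})"
    using deg by simp
  also have "\<dots> = (\<Sum>v\<in>verts C \<inter> S. \<Sum>e\<in>edges C. of_bool (v \<in> ends e))"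
    using fE by (simp add: Int_def)
  also have "\<dots> = (\<Sum>e\<in>edges C. \<Sum>v\<in>verts C \<inter> S. of_bool (v \<in> ends e))"
    by (rule sum.swap)
  also have "\<dots> = (\<Sum>e\<in>edges C. card (ends e \<inter> S))"
  proof (intro sum.cong refl)
    fix e assume "e \<in> edges C"
    then have "verts C \<inter> S \<inter> ends e = ends e \<inter> S" using ev by blast
    then show "(\<Sum>v\<in>verts C \<inter> S. of_bool (v \<in> ends e)) = card (ends e \<inter> S)"
      using fv by simp
  qed
  also have "\<dots> = (\<Sum>e\<in>edges C. of_bool (card (ends e \<inter> S) = 1) + 2 * of_bool (card (ends e \<inter> S) = 2))"
  proof (intro sum.cong refl)
    fix e assume "e \<in> edges C"
    then have "card (ends e \<inter> S) \<le> 2" using c2[of e]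
      by (metis Int_lower1 card.infinite card_mono le_zero_eq zero_neq_numeral)
    then show "card (ends e \<inter> S) =
        of_bool (card (ends e \<inter> S) = 1) + 2 * of_bool (card (ends e \<inter> S) = 2)"
      by (auto simp: of_bool_def)
  qed
  also have "\<dots> = card ?X + 2 * card ?D"
    using fE by (simp add: sum.distrib sum_distrib_left[symmetric] Int_def del: sum_distrib_left)
  finally have "even (card ?X)" by presburger
  moreover have "?X \<noteq> {}"
  proof -
    have "\<exists>e\<in>edges C. \<exists>a b. ends e = {a, b} \<and> a \<in> S \<and> b \<notin> S"
      using conn x(2) y(2)
    proof (induction rule: converse_rtrancl_induct)
      case (step p q)
      then show ?case by (cases "q \<in> S") auto
    qed simp
    then obtain e a b where "e \<in> edges C" "ends e = {a, b}" "a \<in> S" "b \<notin> S" by blast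
    then have "e \<in> ?X" by simp
    then show ?thesis by blast
  qed
  then have "card ?X \<noteq> 0" using fE by simp
  ultimately show ?thesis by (auto elim!: evenE)
qed

text \<open>The counterpart of \<open>active_ends\<close> for an edge given as a set. Counting
  labels makes it possible to exchange the sum over edges with the sum over classes.\<close>

definition active_crossings :: "'a set set \<Rightarrow> ('a \<Rightarrow> 'b) \<Rightarrow> 'a set \<Rightarrow> nat" where
  "active_crossings \<T> L e = card {c. active \<T> L c \<and> card (e \<inter> {x. L x = c}) = 1}"

lemma active_crossings_doubleton:
  assumes "u \<noteq> v" shows "active_crossings \<T> L {u, v} = active_ends \<T> L u v"
proof -
  have *: "card ({u, v} \<inter> {x. L x = c}) = 1 \<longleftrightarrow> (L u = c) \<noteq> (L v = c)" for c
  proof -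
    have "{u, v} \<inter> {x. L x = c} = (if L u = c then {u} else {}) \<union> (if L v = c then {v} else {})"
      by auto
    then show ?thesis using assms by auto
  qed
  show ?thesis
  proof (cases "L u = L v")
    case True
    then show ?thesis unfolding active_crossings_def * active_ends_def by simp
  next
    case False
    have "{c. active \<T> L c \<and> (L u = c) \<noteq> (L v = c)} =
       (if active \<T> L (L u) then {L u} else {}) \<union> (if active \<T> L (L v) then {L v} else {})"
      using False by auto
    then show ?thesis unfolding active_crossings_def * active_ends_def using False by auto
  qed
qed

lemma finite_active:
  assumes "finite V" "\<And>T. T \<in> \<T> \<Longrightarrow> T \<subseteq> V"
  shows "finite {c. active \<T> L c}"
proof (rule finite_subset)
  show "{c. active \<T> L c} \<subseteq> L ` V" using assms by (auto simp: active_def)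
qed (use assms in simp)

text \<open>An active class contains one vertex \<open>u\<close> of a terminal set and misses
  another one \<open>v\<close>. The cycle through \<open>u\<close> contains the whole terminal set,
  so it has vertices on both sides. The rest counts pairs of an active class and a crossing edge in
  two ways.\<close>

lemma cycles_cross_active:
  fixes L :: "'a \<Rightarrow> 'b"
  assumes inst: "steiner_instance V w \<T>"
    and dc: "disjoint_cycles V \<T> \<C>" and cr: "cycles_respect \<T> \<C>"
  shows "2 * card {c. active \<T> L c} \<le> (\<Sum>C\<in>\<C>. \<Sum>e\<in>edges C. active_crossings \<T> L (ends e))"
proof -
  have V: "finite V" and T: "\<And>T. T \<in> \<T> \<Longrightarrow> T \<subseteq> V"
    using inst by (auto simp: steiner_instance_def)
  let ?A = "{c. active \<T> L c}"
  have fA: "finite ?A" using finite_active V T by blast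
  have cyc: "cycle V \<T> C" if "C \<in> \<C>" for C using dc that by (simp add: disjoint_cycles_def)
  have fE: "finite (edges C)" if "C \<in> \<C>" for C
  proof (rule finite_subset)
    show "edges C \<subseteq> Pow V \<times> {0, 1}"
      using cyc[OF that] medges_subset[OF T] unfolding cycle_def subgraph_def by blast
  qed (use V in simp)
  have fC: "finite \<C>"
  proof (rule finite_subset)
    show "\<C> \<subseteq> Pow V \<times> Pow (Pow V \<times> {0, 1})"
    proof
      fix C assume C: "C \<in> \<C>"
      have "verts C \<subseteq> V" "edges C \<subseteq> Pow V \<times> {0, 1}"
        using cyc[OF C] medges_subset[OF T] unfolding cycle_def subgraph_def by blast+
      then show "C \<in> Pow V \<times> Pow (Pow V \<times> {0, 1})" by (simp add: mem_Times_iff)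
    qed
  qed (use V in simp)
  let ?x = "\<lambda>C c. card {e \<in> edges C. card (ends e \<inter> {x. L x = c}) = 1}"
  have "2 * card ?A = (\<Sum>c\<in>?A. 2)" by simp
  also have "\<dots> \<le> (\<Sum>c\<in>?A. \<Sum>C\<in>\<C>. ?x C c)"
  proof (intro sum_mono)
    fix c assume "c \<in> ?A"
    then obtain T u v where tuv: "T \<in> \<T>" "u \<in> T" "v \<in> T" "L u = c" "L v \<noteq> c"
      by (auto simp: active_def)
    then obtain C where C: "C \<in> \<C>" "u \<in> verts C"
      using cr unfolding cycles_respect_def by blast
    then have C': "T \<subseteq> verts C"
      using cr tuv unfolding cycles_respect_def cycle_respects_def by blast
    have "2 \<le> ?x C c"
      using cycle_crosses_cut_twice[OF V cyc[OF C(1)] T, of u "{x. L x = c}" v] C C' tuv by blast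
    also have "\<dots> \<le> (\<Sum>C\<in>\<C>. ?x C c)"
      using fC C(1) by (intro member_le_sum) auto
    finally show "2 \<le> (\<Sum>C\<in>\<C>. ?x C c)" .
  qed
  also have "\<dots> = (\<Sum>C\<in>\<C>. \<Sum>c\<in>?A. ?x C c)" by (rule sum.swap)
  also have "\<dots> = (\<Sum>C\<in>\<C>. \<Sum>e\<in>edges C. active_crossings \<T> L (ends e))"
  proof (intro sum.cong refl)
    fix C assume C: "C \<in> \<C>"
    have "(\<Sum>c\<in>?A. ?x C c) = (\<Sum>c\<in>?A. \<Sum>e\<in>edges C. of_bool (card (ends e \<inter> {x. L x = c}) = 1))"
      using fE[OF C] by (simp add: Int_def)
    also have "\<dots> = (\<Sum>e\<in>edges C. \<Sum>c\<in>?A. of_bool (card (ends e \<inter> {x. L x = c}) = 1))"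
      by (rule sum.swap)
    also have "\<dots> = (\<Sum>e\<in>edges C. active_crossings \<T> L (ends e))"
      using fA by (simp add: Int_def active_crossings_def)
    finally show "(\<Sum>c\<in>?A. ?x C c) = (\<Sum>e\<in>edges C. active_crossings \<T> L (ends e))" .
  qed
  finally show ?thesis .
qed

text \<open>Without edge \<open>i\<close> some terminals \<open>t\<close> and \<open>t'\<close> are
  apart, while adding the edge as the last one gives a partition at least as coarse as that of
  \<open>K\<close>, which joins them. So they lie in the classes of the two ends of
  \<open>i\<close>, in this order after renaming.\<close>

lemma minimal_edge_separates:
  assumes feas: "feasible \<T> (labelling id E K m)"
    and min: "\<not> feasible \<T> (labelling id E (K - {i}) m)"
  obtains T t t' where "T \<in> \<T>" "t \<in> T" "t' \<in> T"
    "labelling id E (K - {i}) m t = labelling id E (K - {i}) m (fst (E i))"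
    "labelling id E (K - {i}) m t' = labelling id E (K - {i}) m (snd (E i))"
proof -
  define M where "M = labelling id E (K - {i}) m"
  obtain T t t' where T: "T \<in> \<T>" "t \<in> T" "t' \<in> T" and M: "M t \<noteq> M t'"
    using min unfolding feasible_def M_def by blast
  have "labelling id E K m t = labelling id E K m t'" using feas T unfolding feasible_def by blast
  then have "merge_label M (E i) t = merge_label M (E i) t'"
  proof (rule labelling_least[where M = "merge_label M (E i)", rotated 2])
    fix k assume "k < m" "k \<in> K"
    then have "k = i \<or> M (fst (E k)) = M (snd (E k))"
      by (auto simp: M_def intro: labelling_edge)
    then show "merge_label M (E i) (fst (E k)) = merge_label M (E i) (snd (E k))"
      by (auto simp: merge_label_def)
  qed simp
  then have "M t = M (fst (E i)) \<and> M t' = M (snd (E i)) \<or> M t' = M (fst (E i)) \<and> M t = M (snd (E i))"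
    using M by (auto simp: merge_label_def split: if_splits)
  then show ?thesis using that T unfolding M_def by metis
qed

text \<open>If \<open>i\<close> is the only kept edge across the border of \<open>c\<close>, the
  partition without \<open>i\<close> respects that border, so the terminals separated by removing
  \<open>i\<close> lie on its two sides. An inactive class is therefore never a leaf of the
  contracted forest.\<close>

lemma active_if_single_crossing:
  assumes feas: "feasible \<T> (labelling id E K m)"
    and min: "\<not> feasible \<T> (labelling id E (K - {i}) m)"
    and cross: "(L (fst (E i)) = c) \<noteq> (L (snd (E i)) = c)"
    and only: "\<And>k. k \<in> K \<Longrightarrow> k < m \<Longrightarrow> (L (fst (E k)) = c) \<noteq> (L (snd (E k)) = c) \<Longrightarrow> k = i"
  shows "active \<T> L c"
proof -
  let ?M = "labelling id E (K - {i}) m"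
  obtain T t t' where T: "T \<in> \<T>" "t \<in> T" "t' \<in> T"
    and M: "?M t = ?M (fst (E i))" "?M t' = ?M (snd (E i))"
    using minimal_edge_separates[OF feas min] by blast
  have "(L x = c) = (L y = c)" if "?M x = ?M y" for x y
    using that
  proof (rule labelling_least[where M = "\<lambda>x. L x = c", rotated 2])
    fix k assume "k < m" "k \<in> K - {i}"
    then show "(L (fst (E k)) = c) = (L (snd (E k)) = c)" using only[of k] by blast
  qed simp
  from this[OF M(1)] this[OF M(2)] have "(L t = c) \<noteq> (L t' = c)" using cross by simp
  then show ?thesis using T by (auto simp: active_def)
qed

text \<open>\<open>E\<close> lists the edges in the order of their insertion, and the classes before the insertion
  of edge \<open>j\<close> are those of \<open>labelling id E UNIV j\<close>. An entry with equal ends stands for no edge.\<close>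

lemma forest_degree_bound:
  fixes E :: "nat \<Rightarrow> nat \<times> nat"
  assumes V: "finite V" and TV: "\<And>T. T \<in> \<T> \<Longrightarrow> T \<subseteq> V"
    and EV: "\<And>i. i < m \<Longrightarrow> fst (E i) \<in> V \<and> snd (E i) \<in> V"
    and forest: "\<And>i. i < m \<Longrightarrow> fst (E i) = snd (E i) \<or>
        labelling id E UNIV i (fst (E i)) \<noteq> labelling id E UNIV i (snd (E i))"
    and K: "K \<subseteq> {..<m}" and feas: "feasible \<T> (labelling id E K m)"
    and min: "\<And>i. i \<in> K \<Longrightarrow> \<not> feasible \<T> (labelling id E (K - {i}) m)"
    and j: "j \<le> m"
  shows "(\<Sum>i\<in>K. active_ends \<T> (labelling id E UNIV j) (fst (E i)) (snd (E i)))
         \<le> 2 * card {c. active \<T> (labelling id E UNIV j) c}"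
proof -
  define L where "L = labelling id E UNIV j"
  define D where "D = {i \<in> K. L (fst (E i)) \<noteq> L (snd (E i))}"
  define N where "N = (\<Union>i\<in>D. {fst (E i), snd (E i)})"
  let ?act = "active \<T> L"
  define deg where "deg c = card {i \<in> D. L (fst (E i)) = c \<or> L (snd (E i)) = c}" for c
  have fK: "finite K" using K finite_subset by blast
  then have fD: "finite D" by (simp add: D_def)
  then have fN: "finite N" by (simp add: N_def)
  have Dm: "D \<subseteq> {..<m}" using K by (auto simp: D_def)
  \<comment> \<open>Edges inserted before step \<open>j\<close> lie inside the classes of that step;
    only later ones survive the contraction.\<close>
  have Dj: "j \<le> i" if "i \<in> D" for i
    using that labelling_edge[of i j UNIV id E] by (cases "i < j") (auto simp: D_def L_def)
  have "card (labelling L E D m ` N) + card (D \<inter> {..<m}) = card (L ` N)"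
  proof (rule card_labelling_image[OF fN])
    fix i assume i: "i < m" "i \<in> D"
    then have ne: "labelling id E UNIV i (fst (E i)) \<noteq> labelling id E UNIV i (snd (E i))"
      using forest[of i] by (auto simp: D_def)
    \<comment> \<open>Joining the contracted classes along edges of \<open>D\<close> before
      \<open>i\<close> gives a finer partition than all insertions before \<open>i\<close>, so
      \<open>D\<close> inherits acyclicity from the order of insertion.\<close>
    have finer: "labelling id E UNIV i x = labelling id E UNIV i y" if "labelling L E D i x = labelling L E D i y" for x y
    proof (rule labelling_least[where M = "labelling id E UNIV i", OF _ _ that])
      fix u v assume "L u = L v"
      then show "labelling id E UNIV i u = labelling id E UNIV i v"
        unfolding L_def by (rule labelling_mono[rotated]) (use Dj[OF i(2)] in auto)
    qed (auto intro: labelling_edge)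
    show "fst (E i) \<in> N \<and> snd (E i) \<in> N \<and> labelling L E D i (fst (E i)) \<noteq> labelling L E D i (snd (E i))"
      using finer[of "fst (E i)" "snd (E i)"] ne i by (auto simp: N_def)
  qed
  \<comment> \<open>A forest has at most as many edges as vertices; the number of its components is
    dropped.\<close>
  then have cD: "card D \<le> card (L ` N)" using Dm by (simp add: Int_absorb2)
  \<comment> \<open>Handshake lemma in the contracted graph, restricted to the classes with property
    \<open>P\<close>.\<close>
  have swap: "(\<Sum>c\<in>L ` N \<inter> {c. P c}. deg c) =
      (\<Sum>i\<in>D. of_bool (P (L (fst (E i)))) + of_bool (P (L (snd (E i)))))" for P
  proof -
    have "(\<Sum>c\<in>L ` N \<inter> {c. P c}. deg c)
        = (\<Sum>c\<in>L ` N. \<Sum>i\<in>D. of_bool (P c \<and> (L (fst (E i)) = c \<or> L (snd (E i)) = c)))"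
      using fN fD by (subst sum.inter_restrict) (auto simp: Int_def deg_def intro!: sum.cong)
    also have "\<dots> = (\<Sum>i\<in>D. \<Sum>c\<in>L ` N. of_bool (P c \<and> (L (fst (E i)) = c \<or> L (snd (E i)) = c)))"
      by (rule sum.swap)
    also have "\<dots> = (\<Sum>i\<in>D. of_bool (P (L (fst (E i)))) + of_bool (P (L (snd (E i)))))"
    proof (intro sum.cong refl)
      fix i assume i: "i \<in> D"
      let ?a = "L (fst (E i))" and ?b = "L (snd (E i))"
      have ab: "?a \<noteq> ?b" "?a \<in> L ` N" "?b \<in> L ` N" using i by (auto simp: D_def N_def)
      have "(\<Sum>c\<in>L ` N. of_bool (P c \<and> (?a = c \<or> ?b = c)))
          = (\<Sum>c\<in>L ` N. (if ?a = c then of_bool (P c) else 0) + (if ?b = c then of_bool (P c) else 0) :: nat)"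
        using ab by (intro sum.cong refl) auto
      also have "\<dots> = of_bool (P ?a) + of_bool (P ?b)"
        using ab fN by (simp add: sum.distrib)
      finally show "(\<Sum>c\<in>L ` N. of_bool (P c \<and> (?a = c \<or> ?b = c)) :: nat) = of_bool (P ?a) + of_bool (P ?b)" .
    qed
    finally show ?thesis .
  qed
  have deg2: "2 \<le> deg c" if c: "c \<in> L ` N" "\<not> ?act c" for c
  proof -
    let ?I = "{i \<in> D. L (fst (E i)) = c \<or> L (snd (E i)) = c}"
    obtain i where i: "i \<in> ?I" using c(1) by (auto simp: N_def)
    have "\<not> ?I \<subseteq> {i}"
    proof
      assume sub: "?I \<subseteq> {i}"
      have "?act c"
      proof (rule active_if_single_crossing[OF feas])
        show "\<not> feasible \<T> (labelling id E (K - {i}) m)" using min i by (simp add: D_def)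
        show "(L (fst (E i)) = c) \<noteq> (L (snd (E i)) = c)" using i by (auto simp: D_def)
        fix k assume "k \<in> K" "(L (fst (E k)) = c) \<noteq> (L (snd (E k)) = c)"
        then have "k \<in> ?I" by (auto simp: D_def)
        then show "k = i" using sub by auto
      qed
      then show False using c by simp
    qed
    then obtain k where "k \<in> ?I" "k \<noteq> i" by auto
    then have "card {i, k} \<le> deg c" unfolding deg_def using i fD by (intro card_mono) auto
    then show ?thesis using \<open>k \<noteq> i\<close> by simp
  qed
  have "2 * card (L ` N \<inter> {c. \<not> ?act c}) \<le> (\<Sum>c\<in>L ` N \<inter> {c. \<not> ?act c}. deg c)"
    using sum_mono[of "L ` N \<inter> {c. \<not> ?act c}" "\<lambda>_. 2" deg] deg2 by simp
  moreover have "(\<Sum>c\<in>L ` N \<inter> {c. ?act c}. deg c) + (\<Sum>c\<in>L ` N \<inter> {c. \<not> ?act c}. deg c) = 2 * card D"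
  proof -
    have "(\<Sum>i\<in>D. of_bool (?act (L (fst (E i)))) + of_bool (?act (L (snd (E i))))) +
        (\<Sum>i\<in>D. of_bool (\<not> ?act (L (fst (E i)))) + of_bool (\<not> ?act (L (snd (E i))))) =
        (\<Sum>i\<in>D. 2 :: nat)"
      unfolding sum.distrib[symmetric] by (rule sum.cong) auto
    then show ?thesis unfolding swap by simp
  qed
  moreover have "card (L ` N) = card (L ` N \<inter> {c. ?act c}) + card (L ` N \<inter> {c. \<not> ?act c})"
    using fN by (subst card_Un_disjoint[symmetric]) (auto intro: arg_cong[where f = card])
  moreover have "card (L ` N \<inter> {c. ?act c}) \<le> card {c. ?act c}"
    using finite_active[OF V TV] by (intro card_mono) auto
  \<comment> \<open>The degrees add up to \<open>2 * card D\<close>, at most twice the number of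
    touched classes. Inactive classes use up at least 2 each, which leaves at most 2 per active
    class.\<close>
  ultimately have "(\<Sum>c\<in>L ` N \<inter> {c. ?act c}. deg c) \<le> 2 * card {c. ?act c}"
    using cD by linarith
  moreover have "(\<Sum>i\<in>K. active_ends \<T> L (fst (E i)) (snd (E i))) = (\<Sum>c\<in>L ` N \<inter> {c. ?act c}. deg c)"
    unfolding swap using fK
    by (intro sum.mono_neutral_cong_right) (auto simp: D_def active_ends_def)
  ultimately show ?thesis by (simp add: L_def)
qed

text \<open>An entry with equal ends joins nothing, so deleting it keeps feasibility. The dummy
  entries of idle rounds therefore never survive the pruning.\<close>

lemma minimal_edge_neq:
  assumes feas: "feasible \<T> (labelling id E K m)" and min: "\<not> feasible \<T> (labelling id E (K - {i}) m)"
  shows "fst (E i) \<noteq> snd (E i)"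
proof
  assume eq: "fst (E i) = snd (E i)"
  have "labelling id E (K - {i}) m u = labelling id E (K - {i}) m v" if "labelling id E K m u = labelling id E K m v" for u v
  proof (rule labelling_least[where M = "labelling id E (K - {i}) m", OF _ _ that])
    fix k assume "k < m" "k \<in> K"
    then show "labelling id E (K - {i}) m (fst (E k)) = labelling id E (K - {i}) m (snd (E k))"
      using eq by (cases "k = i") (auto intro: labelling_edge)
  qed simp
  then have "feasible \<T> (labelling id E (K - {i}) m)" using feas unfolding feasible_def by blast
  then show False using min by blast
qed

text \<open>Weak duality, compared step by step instead of class by class, since all active classes
  of step \<open>j\<close> share the charge \<open>eps j\<close>. Twice their number is an upper
  bound for the active ends of \<open>K\<close> and a lower bound for the crossings of the cycles;
  \<open>tight\<close> and \<open>dual\<close> turn the weighted sums into weights.\<close>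

theorem forest_weight_le:
  fixes E :: "nat \<Rightarrow> nat \<times> nat" and w :: "nat set \<Rightarrow> rat"
  assumes inst: "steiner_instance V w \<T>"
    and EV: "\<And>i. i < m \<Longrightarrow> fst (E i) \<in> V \<and> snd (E i) \<in> V"
    and forest: "\<And>i. i < m \<Longrightarrow> fst (E i) = snd (E i) \<or>
        labelling id E UNIV i (fst (E i)) \<noteq> labelling id E UNIV i (snd (E i))"
    and K: "K \<subseteq> {..<m}" and feas: "feasible \<T> (labelling id E K m)"
    and min: "\<And>i. i \<in> K \<Longrightarrow> \<not> feasible \<T> (labelling id E (K - {i}) m)"
    and eps: "\<And>j. j < m \<Longrightarrow> 0 \<le> eps j"
    and dual: "\<And>u v. u \<in> V \<Longrightarrow> v \<in> V \<Longrightarrow> u \<noteq> v \<Longrightarrow>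
        (\<Sum>j<m. eps j * of_nat (active_ends \<T> (labelling id E UNIV j) u v)) \<le> w {u, v}"
    and tight: "\<And>i. i < m \<Longrightarrow> fst (E i) \<noteq> snd (E i) \<Longrightarrow>
        w {fst (E i), snd (E i)} =
          (\<Sum>j<m. eps j * of_nat (active_ends \<T> (labelling id E UNIV j) (fst (E i)) (snd (E i))))"
    and dc: "disjoint_cycles V \<T> \<C>" and cr: "cycles_respect \<T> \<C>"
  shows "(\<Sum>i\<in>K. w {fst (E i), snd (E i)}) \<le> weight w \<C>"
proof -
  have V: "finite V" and T: "\<And>T. T \<in> \<T> \<Longrightarrow> T \<subseteq> V"
    using inst by (auto simp: steiner_instance_def)
  let ?L = "\<lambda>j. labelling id E UNIV j"
  have neq: "fst (E i) \<noteq> snd (E i)" if "i \<in> K" for i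
    using minimal_edge_neq[OF feas min[OF that]] .
  have "(\<Sum>i\<in>K. w {fst (E i), snd (E i)}) =
      (\<Sum>i\<in>K. \<Sum>j<m. eps j * of_nat (active_ends \<T> (?L j) (fst (E i)) (snd (E i))))"
    using neq K tight by (intro sum.cong) auto
  also have "\<dots> = (\<Sum>j<m. eps j * of_nat (\<Sum>i\<in>K. active_ends \<T> (?L j) (fst (E i)) (snd (E i))))"
    by (subst sum.swap) (simp add: sum_distrib_left)
  also have "\<dots> \<le> (\<Sum>j<m. eps j * of_nat (\<Sum>C\<in>\<C>. \<Sum>e\<in>edges C. active_crossings \<T> (?L j) (ends e)))"
  proof (intro sum_mono mult_left_mono eps)
    fix j assume "j \<in> {..<m}"
    then have "(\<Sum>i\<in>K. active_ends \<T> (?L j) (fst (E i)) (snd (E i))) \<le> 2 * card {c. active \<T> (?L j) c}"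
      by (intro forest_degree_bound[OF V T EV forest K feas min]) auto
    also have "\<dots> \<le> (\<Sum>C\<in>\<C>. \<Sum>e\<in>edges C. active_crossings \<T> (?L j) (ends e))"
      by (rule cycles_cross_active[OF inst dc cr])
    finally show "rat_of_nat (\<Sum>i\<in>K. active_ends \<T> (?L j) (fst (E i)) (snd (E i)))
       \<le> of_nat (\<Sum>C\<in>\<C>. \<Sum>e\<in>edges C. active_crossings \<T> (?L j) (ends e))"
      using of_nat_le_iff by blast
  qed auto
  also have "\<dots> = (\<Sum>C\<in>\<C>. \<Sum>e\<in>edges C. \<Sum>j<m. eps j * of_nat (active_crossings \<T> (?L j) (ends e)))"
    unfolding of_nat_sum sum_distrib_left
    by (subst sum.swap, intro sum.cong refl, subst sum.swap, rule refl)
  also have "\<dots> \<le> (\<Sum>C\<in>\<C>. \<Sum>e\<in>edges C. w (ends e))"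
  proof (intro sum_mono)
    fix C e assume "C \<in> \<C>" "e \<in> edges C"
    then have "e \<in> medges V \<T>" using dc unfolding disjoint_cycles_def cycle_def subgraph_def by blast
    then have "e \<in> Pow V \<times> {0, 1}" "card (ends e) = 2"
      using medges_subset[OF T, of \<T>] by (blast, auto simp: medges_def)
    then have "ends e \<subseteq> V" "card (ends e) = 2" by auto
    then obtain u v where uv: "ends e = {u, v}" "u \<noteq> v" "u \<in> V" "v \<in> V"
      by (auto simp: card_2_iff)
    then show "(\<Sum>j<m. eps j * of_nat (active_crossings \<T> (?L j) (ends e))) \<le> w (ends e)"
      using dual by (simp add: active_crossings_doubleton)
  qed
  finally show ?thesis by (simp add: weight_def)
qed

section \<open>Loop programs\<close>

text \<open>All loops run over \<open>{0..<n}\<close> with \<open>n\<close> in register 2. Loop programs therefore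
  denote total functions, and a polynomial bound on their number of steps can be read off the
  syntax.\<close>

datatype hexp =
    Num nat
  | Var nat
  | Arr nat hexp hexp
  | Op arith_op hexp hexp

datatype cmd =
    Set nat hexp
  | Put nat hexp hexp hexp
  | In nat
  | Out hexp
  | Then cmd cmd (infixr ";;" 60)
  | If hexp cmd cmd
  | Nop
  | For nat cmd

record st =
  rg :: "nat \<Rightarrow> nat"
  ar :: "nat \<Rightarrow> nat \<Rightarrow> nat \<Rightarrow> nat"
  ip :: "nat list"
  ot :: "nat list"

primrec ev :: "st \<Rightarrow> hexp \<Rightarrow> nat" where
  "ev s (Num c) = c"
| "ev s (Var r) = rg s r"
| "ev s (Arr k a b) = ar s k (ev s a) (ev s b)"
| "ev s (Op f a b) = apply_op f (ev s a) (ev s b)"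

text \<open>The number of rounds of a loop is fixed on entry, and its counter ends with the bound
  itself, because the compiled while loop leaves it there when its test fails.\<close>

primrec den :: "cmd \<Rightarrow> st \<Rightarrow> st" where
  "den (Set r e) s = s\<lparr>rg := (rg s)(r := ev s e)\<rparr>"
| "den (Put k a b e) s =
     s\<lparr>ar := (ar s)(k := (ar s k)(ev s a := (ar s k (ev s a))(ev s b := ev s e)))\<rparr>"
| "den (In r) s = (case ip s of [] \<Rightarrow> s\<lparr>rg := (rg s)(r := 0)\<rparr>
     | x # xs \<Rightarrow> s\<lparr>rg := (rg s)(r := x), ip := xs\<rparr>)"
| "den (Out e) s = s\<lparr>ot := ot s @ [ev s e]\<rparr>"
| "den (c ;; d) s = den d (den c s)"
| "den (If e c d) s = (if ev s e \<noteq> 0 then den c s else den d s)"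
| "den Nop s = s"
| "den (For r c) s =
     (fold (\<lambda>i t. den c (t\<lparr>rg := (rg t)(r := i)\<rparr>)) [0..<rg s 2] s)\<lparr>rg :=
       (rg (fold (\<lambda>i t. den c (t\<lparr>rg := (rg t)(r := i)\<rparr>)) [0..<rg s 2] s))(r := rg s 2)\<rparr>"

primrec wr_reg :: "cmd \<Rightarrow> nat set" where
  "wr_reg (Set r e) = {r}"
| "wr_reg (Put k a b e) = {}"
| "wr_reg (In r) = {r}"
| "wr_reg (Out e) = {}"
| "wr_reg (c ;; d) = wr_reg c \<union> wr_reg d"
| "wr_reg (If e c d) = wr_reg c \<union> wr_reg d"
| "wr_reg Nop = {}"
| "wr_reg (For r c) = insert r (wr_reg c)"

primrec wr_arr :: "cmd \<Rightarrow> nat set" where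
  "wr_arr (Set r e) = {}"
| "wr_arr (Put k a b e) = {k}"
| "wr_arr (In r) = {}"
| "wr_arr (Out e) = {}"
| "wr_arr (c ;; d) = wr_arr c \<union> wr_arr d"
| "wr_arr (If e c d) = wr_arr c \<union> wr_arr d"
| "wr_arr Nop = {}"
| "wr_arr (For r c) = wr_arr c"

primrec reads :: "cmd \<Rightarrow> bool" where
  "reads (Set r e) = False"
| "reads (Put k a b e) = False"
| "reads (In r) = True"
| "reads (Out e) = False"
| "reads (c ;; d) = (reads c \<or> reads d)"
| "reads (If e c d) = (reads c \<or> reads d)"
| "reads Nop = False"
| "reads (For r c) = reads c"

primrec writes :: "cmd \<Rightarrow> bool" where
  "writes (Set r e) = False"
| "writes (Put k a b e) = False"
| "writes (In r) = False"
| "writes (Out e) = True"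
| "writes (c ;; d) = (writes c \<or> writes d)"
| "writes (If e c d) = (writes c \<or> writes d)"
| "writes Nop = False"
| "writes (For r c) = writes c"

text \<open>Frame property read off the syntax. The correctness proofs of the program obtain from it
  what a command leaves untouched.\<close>

definition same :: "cmd \<Rightarrow> st \<Rightarrow> st \<Rightarrow> bool" where
  "same c s t \<longleftrightarrow> (\<forall>r. r \<notin> wr_reg c \<longrightarrow> rg t r = rg s r) \<and> (\<forall>k. k \<notin> wr_arr c \<longrightarrow> ar t k = ar s k) \<and>
     (\<not> reads c \<longrightarrow> ip t = ip s) \<and> (\<not> writes c \<longrightarrow> ot t = ot s)"

lemma fold_upt_invariant:
  assumes "P 0 s" "\<And>i t. i < n \<Longrightarrow> P i t \<Longrightarrow> P (Suc i) (f i t)"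
  shows "P n (fold f [0..<n] s)"
  using assms by (induction n) auto

lemma same_den: "same c s (den c s)"
proof (induction c arbitrary: s)
  case (For r c)
  let ?f = "\<lambda>i t. den c (t\<lparr>rg := (rg t)(r := i)\<rparr>)"
  have "same (For r c) s (fold ?f [0..<rg s 2] s)"
  proof (rule fold_upt_invariant)
    fix i t assume "same (For r c) s t"
    then show "same (For r c) s (den c (t\<lparr>rg := (rg t)(r := i)\<rparr>))"
      using For[of "t\<lparr>rg := (rg t)(r := i)\<rparr>"] by (auto simp: same_def)
  qed (simp add: same_def)
  then show ?case by (auto simp: same_def)
next
  case (Then c1 c2)
  show ?case using Then(1)[of s] Then(2)[of "den c1 s"] by (auto simp: same_def)
next
  case (If e c1 c2)
  show ?case using If(1)[of s] If(2)[of s] by (auto simp: same_def)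
qed (auto simp: same_def split: list.split)

text \<open>The counter is overwritten before each round and after the last one, so the invariant
  must tolerate any value of it (\<open>indep\<close>). In exchange, a round may use that everything
  outside the write sets is as on entry.\<close>

lemma For_rule:
  assumes n: "2 \<notin> wr_reg c" "r \<noteq> 2" and I0: "I 0 s"
    and indep: "\<And>i t x. I i t \<Longrightarrow> I i (t\<lparr>rg := (rg t)(r := x)\<rparr>)"
    and step: "\<And>i t. i < rg s 2 \<Longrightarrow> I i t \<Longrightarrow> same (For r c) s t \<Longrightarrow> rg t r = i \<Longrightarrow> I (Suc i) (den c t)"
  shows "I (rg s 2) (den (For r c) s)"
proof -
  let ?f = "\<lambda>i t. den c (t\<lparr>rg := (rg t)(r := i)\<rparr>)"
  have "I (rg s 2) (fold ?f [0..<rg s 2] s) \<and> same (For r c) s (fold ?f [0..<rg s 2] s)"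
  proof (rule fold_upt_invariant)
    fix i t assume i: "i < rg s 2" and t: "I i t \<and> same (For r c) s t"
    have "same (For r c) s (t\<lparr>rg := (rg t)(r := i)\<rparr>)" using t by (simp add: same_def)
    moreover from this have "same (For r c) s (den c (t\<lparr>rg := (rg t)(r := i)\<rparr>))"
      using same_den[of c "t\<lparr>rg := (rg t)(r := i)\<rparr>"] by (auto simp: same_def)
    ultimately show "I (Suc i) (?f i t) \<and> same (For r c) s (?f i t)"
      using step[OF i indep] t by simp
  qed (use I0 in \<open>simp add: same_def\<close>)
  then show ?thesis by (auto intro: indep)
qed

text \<open>Indexing the invariant by the set of pairs already treated avoids describing partially
  finished rows.\<close>

lemma For2_rule:
  assumes n: "2 \<notin> wr_reg c" "r \<noteq> 2" "q \<noteq> 2" "q \<noteq> r" "r \<notin> wr_reg c" and I0: "I {} s"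
    and indep: "\<And>P t x. I P t \<Longrightarrow> I P (t\<lparr>rg := (rg t)(r := x)\<rparr>)"
    and indep': "\<And>P t x. I P t \<Longrightarrow> I P (t\<lparr>rg := (rg t)(q := x)\<rparr>)"
    and step: "\<And>i j P t. i < rg s 2 \<Longrightarrow> j < rg s 2 \<Longrightarrow> (i, j) \<notin> P \<Longrightarrow> I P t \<Longrightarrow>
        same (For r (For q c)) s t \<Longrightarrow> rg t r = i \<Longrightarrow> rg t q = j \<Longrightarrow> I (insert (i, j) P) (den c t)"
  shows "I ({..<rg s 2} \<times> {..<rg s 2}) (den (For r (For q c)) s)"
proof (rule For_rule[where I = "\<lambda>i. I ({..<i} \<times> {..<rg s 2})"])
  fix i t assume i: "i < rg s 2" "I ({..<i} \<times> {..<rg s 2}) t" and t: "same (For r (For q c)) s t" "rg t r = i"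
  have n2: "rg t 2 = rg s 2" using t n by (simp add: same_def)
  have "I ({..<i} \<times> {..<rg s 2} \<union> {i} \<times> {..<rg t 2}) (den (For q c) t)"
  proof (rule For_rule[where I = "\<lambda>j. I ({..<i} \<times> {..<rg s 2} \<union> {i} \<times> {..<j})"])
    fix j u assume j: "j < rg t 2" "I ({..<i} \<times> {..<rg s 2} \<union> {i} \<times> {..<j}) u"
      and u: "same (For q c) t u" "rg u q = j"
    have "I (insert (i, j) ({..<i} \<times> {..<rg s 2} \<union> {i} \<times> {..<j})) (den c u)"
    proof (rule step)
      show "same (For r (For q c)) s u" using t u by (auto simp: same_def)
      show "rg u r = i" using t u n by (simp add: same_def)
    qed (use i j u n2 in auto)
    moreover have "insert (i, j) ({..<i} \<times> {..<rg s 2} \<union> {i} \<times> {..<j}) =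
        {..<i} \<times> {..<rg s 2} \<union> {i} \<times> {..<Suc j}" by auto
    ultimately show "I ({..<i} \<times> {..<rg s 2} \<union> {i} \<times> {..<Suc j}) (den c u)" by simp
  qed (use n i indep' in auto)
  moreover have "{..<i} \<times> {..<rg s 2} \<union> {i} \<times> {..<rg t 2} = {..<Suc i} \<times> {..<rg s 2}"
    using n2 by auto
  ultimately show "I ({..<Suc i} \<times> {..<rg s 2}) (den (For q c) t)" by simp
qed (use n indep I0 in auto)


subsection \<open>Compilation with a polynomial time bound\<close>

text \<open>A Cantor-style pairing with a square in place of the triangular number: one expression
  of sums and products computes it, and as it lies between consecutive squares, its value determines
  first \<open>a + b\<close> and then \<open>a\<close>.\<close>

definition pair :: "nat \<Rightarrow> nat \<Rightarrow> nat" where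
  "pair a b = (a + b) * (a + b) + a"

lemma pair_inject: "pair a b = pair c d \<longleftrightarrow> a = c \<and> b = d"
proof
  assume eq: "pair a b = pair c d"
  have lt: "pair a b < pair c d" if "a + b < c + d" for a b c d
  proof -
    have "pair a b < (a + b + 1) * (a + b + 1)" by (simp add: pair_def algebra_simps)
    also have "\<dots> \<le> (c + d) * (c + d)" using that by (intro mult_le_mono) auto
    also have "\<dots> \<le> pair c d" by (simp add: pair_def)
    finally show ?thesis .
  qed
  have "a + b = c + d" using lt[of a b c d] lt[of c d a b] eq by (metis less_irrefl nat_neq_iff)
  then show "a = c \<and> b = d" using eq by (simp add: pair_def)
qed simp

definition pairE :: "expr \<Rightarrow> expr \<Rightarrow> expr" where
  "pairE a b = Bin Plus (Bin Times (Bin Plus a b) (Bin Plus a b)) a"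

primrec cexp :: "hexp \<Rightarrow> expr" where
  "cexp (Num c) = Const c"
| "cexp (Var r) = Reg r"
| "cexp (Arr k a b) = Mem (pairE (Const k) (pairE (cexp a) (cexp b)))"
| "cexp (Op f a b) = Bin f (cexp a) (cexp b)"

primrec compile :: "cmd \<Rightarrow> prog" where
  "compile (Set r e) = Assign r (cexp e)"
| "compile (Put k a b e) = Store (pairE (Const k) (pairE (cexp a) (cexp b))) (cexp e)"
| "compile (In r) = Read r"
| "compile (Out e) = Write (cexp e)"
| "compile (c ;; d) = Seq (compile c) (compile d)"
| "compile (If e c d) = Cond (cexp e) (compile c) (compile d)"
| "compile Nop = Skip"
| "compile (For r c) = Seq (Assign r (Const 0))
     (While (Bin Minus (Reg 2) (Reg r)) (Seq (compile c) (Assign r (Bin Plus (Reg r) (Const 1)))))"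

text \<open>Arrays live at the addresses \<open>pair k (pair x y)\<close>; injectivity of
  \<open>pair\<close> keeps different arrays and entries apart.\<close>

definition simulates :: "ram_state \<Rightarrow> st \<Rightarrow> bool" where
  "simulates s h \<longleftrightarrow> reg s = rg h \<and> (\<forall>k x y. mem s (pair k (pair x y)) = ar h k x y) \<and> inp s = ip h \<and> outp s = ot h"

lemma val_pairE [simp]: "val s (pairE a b) = pair (val s a) (val s b)"
  by (simp add: pairE_def pair_def)

lemma val_cexp: "simulates s h \<Longrightarrow> val s (cexp e) = ev h e"
  by (induction e) (auto simp: simulates_def)

text \<open>Values that are stored grow by a bounded number of bits: the only products allowed are
  with the registers 0 and 1, which only ever hold numbers read from the input.\<close>

fun storable :: "hexp \<Rightarrow> bool" where
  "storable (Num c) = True"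
| "storable (Var r) = True"
| "storable (Arr k a b) = True"
| "storable (Op Plus a b) = (storable a \<and> storable b)"
| "storable (Op Minus a b) = storable a"
| "storable (Op Div a b) = storable a"
| "storable (Op Times a b) = (storable a \<and> (b = Var 0 \<or> b = Var 1))"

text \<open>Only \<open>In\<close> fills registers 0 and 1, so they stay as short as input numbers.
  A loop body changes neither the bound nor its counter, so the compiled loop makes exactly
  \<open>n\<close> rounds.\<close>

primrec wf :: "cmd \<Rightarrow> bool" where
  "wf (Set r e) = (2 \<le> r \<and> storable e)"
| "wf (Put k a b e) = storable e"
| "wf (In r) = (r < 2)"
| "wf (Out e) = True"
| "wf (c ;; d) = (wf c \<and> wf d)"
| "wf (If e c d) = (wf c \<and> wf d)"
| "wf Nop = True"
| "wf (For r c) = (2 < r \<and> 2 \<notin> wr_reg c \<and> r \<notin> wr_reg c \<and> wf c)"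

section \<open>Binary lengths of values and costs of expressions\<close>

lemma len_pos: "1 \<le> len x" by (simp add: len_def)

lemma len_le_iff: "len x \<le> Suc k \<longleftrightarrow> x < 2 ^ k"
  by (simp add: len_def floorlog_le_iff)

lemma len_less: "x < 2 ^ (len x - 1)"
  using len_le_iff[of x "len x - 1"] len_pos[of x] by simp

lemma len_mono: "x \<le> y \<Longrightarrow> len x \<le> len y"
  by (simp add: len_def floorlog_mono)

lemma len_add: "len (x + y) \<le> max (len x) (len y) + 1"
proof -
  define k where "k = max (len x) (len y) - 1"
  have "x < 2 ^ k" "y < 2 ^ k"
    using len_le_iff[of x k] len_le_iff[of y k] len_pos[of x] len_pos[of y] by (auto simp: k_def)
  then have "len (x + y) \<le> Suc (Suc k)" by (subst len_le_iff) simp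
  then show ?thesis using len_pos[of x] by (simp add: k_def)
qed

lemma len_Suc: "len (Suc x) \<le> len x + 1"
proof -
  have "Suc x \<le> 2 ^ (len x - 1)" using len_less[of x] by simp
  also have "\<dots> < 2 ^ len x" using len_pos[of x] by (intro power_strict_increasing) auto
  finally show ?thesis using len_le_iff[of "Suc x" "len x"] by simp
qed

lemma len_mult: "len (x * y) \<le> len x + len y"
proof -
  have "x * y < 2 ^ (len x - 1) * 2 ^ (len y - 1)"
    by (rule mult_strict_mono) (use len_less in auto)
  also have "\<dots> = 2 ^ (len x + len y - 2)"
    using len_pos[of x] len_pos[of y] by (simp add: power_add[symmetric])
  finally have "len (x * y) \<le> Suc (len x + len y - 2)" by (simp add: len_le_iff)
  then show ?thesis using len_pos[of x] len_pos[of y] by linarith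
qed

lemma len_apply_op: "len (apply_op f x y) \<le> len x + len y"
proof (cases f)
  case Plus
  then show ?thesis using len_add[of x y] len_pos[of x] len_pos[of y] by simp
next
  case Minus
  then show ?thesis using len_mono[of "x - y" x] by simp
next
  case Times
  then show ?thesis using len_mult by simp
next
  case Div
  then show ?thesis using len_mono[of "x div y" x] by simp
qed

text \<open>\<open>g\<close> bounds the lengths of input numbers and stays fixed during a run, while
  \<open>B\<close> bounds everything stored and may grow. Through the clause for registers 0 and 1,
  a product with them is at most \<open>g\<close> bits longer than the other factor.\<close>

definition bounded :: "nat \<Rightarrow> nat \<Rightarrow> ram_state \<Rightarrow> bool" where
  "bounded g B s \<longleftrightarrow> (\<forall>r. len (reg s r) \<le> B) \<and> (\<forall>a. len (mem s a) \<le> B) \<and>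
     (\<forall>x\<in>set (inp s). len x \<le> g) \<and> len (reg s 0) \<le> g \<and> len (reg s 1) \<le> g \<and> 1 \<le> g \<and> g \<le> B"

lemma bounded_mono: "bounded g B s \<Longrightarrow> B \<le> B' \<Longrightarrow> bounded g B' s"
  unfolding bounded_def by (meson le_trans)

text \<open>\<open>vsize\<close> and \<open>csize\<close> are the coefficients of \<open>B\<close>
  in the bounds on the length of a value and on the cost of computing it.\<close>

primrec vsize :: "expr \<Rightarrow> nat" where
  "vsize (Const c) = len c"
| "vsize (Reg r) = 1"
| "vsize (Mem a) = 1"
| "vsize (Bin f a b) = vsize a + vsize b"

primrec csize :: "expr \<Rightarrow> nat" where
  "csize (Const c) = len c"
| "csize (Reg r) = 1"
| "csize (Mem a) = csize a + 1"
| "csize (Bin f a b) = csize a + csize b + (vsize a + vsize b)"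

lemma len_val: "bounded g B s \<Longrightarrow> len (val s e) \<le> vsize e * B"
proof (induction e)
  case (Bin f a b)
  then show ?case using len_apply_op[of f "val s a" "val s b"] by (simp add: algebra_simps)
qed (auto simp: bounded_def)

lemma cost_le: "bounded g B s \<Longrightarrow> cost s e \<le> csize e * B"
proof (induction e)
  case (Bin f a b)
  then have "len (val s (Bin f a b)) \<le> vsize (Bin f a b) * B" by (intro len_val)
  then show ?case using Bin by (simp add: algebra_simps)
next
  case (Mem e)
  then show ?case using add_mono[of "cost s e" "csize e * B" "len (mem s (val s e))" B]
    by (auto simp: bounded_def)
qed (auto simp: bounded_def)

primrec growth :: "hexp \<Rightarrow> nat" where
  "growth (Num c) = len c"
| "growth (Var r) = 0"
| "growth (Arr k a b) = 0"
| "growth (Op f a b) = growth a + growth b + 1"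

text \<open>It matters that \<open>B\<close> has coefficient 1; with a larger factor a loop could
  multiply the lengths in every round. A sum is one bit longer than its longer operand, a difference
  or quotient no longer than its first operand, and a factor from registers 0 and 1 adds at most
  \<open>g\<close> bits.\<close>

lemma len_storable:
  assumes "bounded g B s" "storable e"
  shows "len (val s (cexp e)) \<le> B + growth e * g"
  using assms(2)
proof (induction e rule: storable.induct)
  case (1 c)
  have "len c * 1 \<le> len c * g" using assms(1) by (intro mult_le_mono) (auto simp: bounded_def)
  then show ?case by (simp only: cexp.simps val.simps growth.simps mult_1_right trans_le_add2)
next
  case (4 a b)
  then have "len (val s (cexp a)) \<le> B + growth a * g" "len (val s (cexp b)) \<le> B + growth b * g" by auto
  moreover have "1 \<le> g" using assms(1) by (simp add: bounded_def)
  ultimately show ?case using len_add[of "val s (cexp a)" "val s (cexp b)"]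
    by (simp add: algebra_simps)
next
  case (5 a b)
  then have "len (val s (cexp a)) \<le> B + growth a * g" by simp
  then show ?case using len_mono[of "val s (cexp a) - val s (cexp b)" "val s (cexp a)"]
    by (simp add: algebra_simps)
next
  case (6 a b)
  then have "len (val s (cexp a)) \<le> B + growth a * g" by simp
  then show ?case using len_mono[of "val s (cexp a) div val s (cexp b)" "val s (cexp a)"]
    by (simp add: algebra_simps)
next
  case (7 a b)
  then have "len (val s (cexp a)) \<le> B + growth a * g" "len (val s (cexp b)) \<le> g"
    using assms(1) by (auto simp: bounded_def)
  then show ?case using len_mult[of "val s (cexp a)" "val s (cexp b)"]
    by (simp add: algebra_simps)
qed (use assms(1) in \<open>auto simp: bounded_def\<close>)

section \<open>Growth and cost of compiled commands\<close>

primrec cgrowth :: "nat \<Rightarrow> nat \<Rightarrow> cmd \<Rightarrow> nat" where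
  "cgrowth N g (Set r e) = growth e * g"
| "cgrowth N g (Put k a b e) = growth e * g"
| "cgrowth N g (In r) = 0"
| "cgrowth N g (Out e) = 0"
| "cgrowth N g (c ;; d) = cgrowth N g c + cgrowth N g d"
| "cgrowth N g (If e c d) = cgrowth N g c + cgrowth N g d"
| "cgrowth N g Nop = 0"
| "cgrowth N g (For r c) = N * (cgrowth N g c + 1)"

text \<open>In units of a bound on all lengths. For a loop, 7 pays for setting the counter to 0 (2)
  and for the failing test (5), and 12 pays in each round for the test (5) and the increment
  (7).\<close>

primrec csteps :: "nat \<Rightarrow> cmd \<Rightarrow> nat" where
  "csteps N (Set r e) = 1 + csize (cexp e)"
| "csteps N (Put k a b e) = 1 + csize (pairE (Const k) (pairE (cexp a) (cexp b))) + csize (cexp e)"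
| "csteps N (In r) = 2"
| "csteps N (Out e) = 1 + csize (cexp e)"
| "csteps N (c ;; d) = csteps N c + csteps N d"
| "csteps N (If e c d) = 1 + csize (cexp e) + csteps N c + csteps N d"
| "csteps N Nop = 1"
| "csteps N (For r c) = 7 + N * (csteps N c + 12)"

text \<open>\<open>M\<close> is chosen in advance as a bound on all lengths up to the end of the
  surrounding program. Each elementary cost is then a constant times \<open>M\<close>, and the costs
  of consecutive commands simply add up.\<close>

definition runs_ok :: "nat \<Rightarrow> nat \<Rightarrow> cmd \<Rightarrow> bool" where
  "runs_ok N g c \<longleftrightarrow> (\<forall>s h B M. simulates s h \<and> rg h 2 \<le> N \<and> bounded g B s \<and> B + cgrowth N g c \<le> M \<longrightarrow>
     (\<exists>t s'. exec (compile c) s t s' \<and> simulates s' (den c h) \<and> bounded g (B + cgrowth N g c) s' \<and>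
        t \<le> csteps N c * M))"

text \<open>Induction on the number \<open>k\<close> of remaining rounds. A round lengthens numbers
  by \<open>cgrowth N g c\<close> bits, and the increment of the counter accounts for one
  more.\<close>

lemma While_correct:
  fixes c r
  defines "loop \<equiv> While (Bin Minus (Reg 2) (Reg r)) (Seq (compile c) (Assign r (Bin Plus (Reg r) (Const 1))))"
  defines "F \<equiv> \<lambda>i n h. (fold (\<lambda>i t. den c (t\<lparr>rg := (rg t)(r := i)\<rparr>)) [i..<n] h)\<lparr>rg :=
      (rg (fold (\<lambda>i t. den c (t\<lparr>rg := (rg t)(r := i)\<rparr>)) [i..<n] h))(r := n)\<rparr>"
  assumes r: "2 < r" "2 \<notin> wr_reg c" "r \<notin> wr_reg c" and c: "runs_ok N g c" and n: "n \<le> N"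
  shows "simulates s h \<Longrightarrow> rg h 2 = n \<Longrightarrow> rg h r = i \<Longrightarrow> i + k = n \<Longrightarrow> bounded g B s \<Longrightarrow>
     B + k * (cgrowth N g c + 1) \<le> M \<Longrightarrow>
     \<exists>t s'. exec loop s t s' \<and> simulates s' (F i n h) \<and> bounded g (B + k * (cgrowth N g c + 1)) s' \<and>
        t \<le> (5 + k * (csteps N c + 12)) * M"
proof (induction k arbitrary: s h i B)
  case 0
  have rn: "reg s 2 = n" "reg s r = n" using 0 by (auto simp: simulates_def)
  have "exec loop s (1 + cost s (Bin Minus (Reg 2) (Reg r))) s"
    unfolding loop_def by (rule exec.WhileFalse) (simp add: rn)
  moreover have "cost s (Bin Minus (Reg 2) (Reg r)) \<le> 4 * B"
    using cost_le[OF 0(5), of "Bin Minus (Reg 2) (Reg r)"] by simp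
  moreover have "1 \<le> M" "4 * B \<le> 4 * M" using 0 by (auto simp: bounded_def)
  moreover have "F i n h = h" using 0 by (auto simp: F_def fun_upd_idem)
  ultimately have "exec loop s (1 + cost s (Bin Minus (Reg 2) (Reg r))) s \<and>
      simulates s (F i n h) \<and> bounded g B s \<and>
      1 + cost s (Bin Minus (Reg 2) (Reg r)) \<le> 5 * M"
    using 0 by simp
  then show ?case unfolding mult_0 add_0_right by blast
next
  case (Suc k)
  let ?G = "cgrowth N g c"
  have rn: "reg s 2 = n" "reg s r = i" using Suc by (auto simp: simulates_def)
  have i: "i < n" using Suc by simp
  have h: "h\<lparr>rg := (rg h)(r := i)\<rparr> = h" using Suc by (auto simp: fun_upd_idem)
  have "B + ?G \<le> M" using Suc.prems by simp
  then obtain t1 s1 where 1: "exec (compile c) s t1 s1" "simulates s1 (den c h)" "bounded g (B + ?G) s1"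
    "t1 \<le> csteps N c * M"
    using c Suc.prems n unfolding runs_ok_def by blast
  have r1: "rg (den c h) r = i" "rg (den c h) 2 = n"
    using same_den[of c h] r Suc.prems by (auto simp: same_def)
  define s2 where "s2 = s1\<lparr>reg := (reg s1)(r := Suc i)\<rparr>"
  define h2 where "h2 = (den c h)\<lparr>rg := (rg (den c h))(r := Suc i)\<rparr>"
  have rs1: "reg s1 r = i" using 1 r1 by (simp add: simulates_def)
  have ex2: "exec (Assign r (Bin Plus (Reg r) (Const 1))) s1 (1 + cost s1 (Bin Plus (Reg r) (Const 1))) s2"
    using exec.Assign[of r "Bin Plus (Reg r) (Const 1)" s1] rs1 by (simp add: s2_def)
  have sim2: "simulates s2 h2" using 1(2) by (simp add: simulates_def s2_def h2_def)
  have l1: "len i \<le> B + ?G" using 1(3) rs1 by (auto simp: bounded_def)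
  have "len (Suc i) \<le> B + ?G + 1"
    using len_Suc[of i] l1 by simp
  then have b2: "bounded g (B + (?G + 1)) s2"
    using 1(3) r unfolding bounded_def s2_def by (auto simp: le_SucI)
  have "B + (?G + 1) + k * (?G + 1) \<le> M" using Suc.prems by simp
  from Suc.IH[OF sim2 _ _ _ b2 this, of "Suc i"]
  obtain t3 s3 where 3: "exec loop s2 t3 s3" "bounded g (B + (?G + 1) + k * (?G + 1)) s3"
     "t3 \<le> (5 + k * (csteps N c + 12)) * M"
     "simulates s3 (F (Suc i) n h2)"
    using r r1 Suc.prems by (auto simp: h2_def)
  have ex: "exec loop s (1 + cost s (Bin Minus (Reg 2) (Reg r)) +
      (t1 + (1 + cost s1 (Bin Plus (Reg r) (Const 1)))) + t3) s3"
    using exec.WhileTrue[OF _ exec.Seq[OF 1(1) ex2] 3(1)[unfolded loop_def]] rn i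
    unfolding loop_def by simp
  have "cost s (Bin Minus (Reg 2) (Reg r)) \<le> 4 * B"
    using cost_le[OF Suc.prems(5), of "Bin Minus (Reg 2) (Reg r)"] by simp
  moreover have "cost s1 (Bin Plus (Reg r) (Const 1)) \<le> 6 * (B + ?G)"
    using cost_le[OF 1(3), of "Bin Plus (Reg r) (Const 1)"] by (simp add: len_def floorlog_def)
  moreover have "B + ?G \<le> M" "1 \<le> M" using Suc.prems by (auto simp: bounded_def)
  ultimately have "1 + cost s (Bin Minus (Reg 2) (Reg r)) +
      (t1 + (1 + cost s1 (Bin Plus (Reg r) (Const 1)))) + t3 \<le> (5 + Suc k * (csteps N c + 12)) * M"
    using 1(4) 3(3) by (simp add: algebra_simps)
  \<comment> \<open>The next round of the fold writes the incremented counter once more; after the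
    last round \<open>Suc i\<close> is the final value \<open>n\<close>.\<close>
  moreover have "F i n h = F (Suc i) n h2"
  proof (cases "Suc i < n")
    case True
    then show ?thesis using i by (simp add: F_def upt_conv_Cons h h2_def)
  next
    case False
    then have "Suc i = n" using i by simp
    then show ?thesis using i r1 h by (simp add: F_def upt_conv_Cons h2_def)
  qed
  moreover have "B + (?G + 1) + k * (?G + 1) = B + Suc k * (?G + 1)" by simp
  ultimately show ?case using ex 3(2,4) by metis
qed

lemma bounded_reg:
  "bounded g B s \<Longrightarrow> 2 \<le> r \<Longrightarrow> B \<le> B' \<Longrightarrow> len x \<le> B' \<Longrightarrow> bounded g B' (s\<lparr>reg := (reg s)(r := x)\<rparr>)"
  unfolding bounded_def by (auto intro: le_trans)

lemma runs_ok_Set: "wf (Set r e) \<Longrightarrow> runs_ok N g (Set r e)"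
  unfolding runs_ok_def
proof (intro allI impI, elim conjE)
  fix s h B M assume w: "wf (Set r e)" and s: "simulates s h" "bounded g B s" "B + cgrowth N g (Set r e) \<le> M"
  let ?s = "s\<lparr>reg := (reg s)(r := val s (cexp e))\<rparr>"
  have "exec (compile (Set r e)) s (1 + cost s (cexp e)) ?s" unfolding compile.simps by (rule exec.Assign)
  moreover have "simulates ?s (den (Set r e) h)" using s(1) val_cexp[OF s(1)] by (simp add: simulates_def)
  moreover have "bounded g (B + cgrowth N g (Set r e)) ?s"
    using len_storable[OF s(2), of e] w by (intro bounded_reg[OF s(2)]) auto
  moreover have "1 + cost s (cexp e) \<le> csteps N (Set r e) * M"
  proof -
    have "csize (cexp e) * B \<le> csize (cexp e) * M" using s by (intro mult_le_mono2) simp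
    moreover have "1 \<le> M" using s by (auto simp: bounded_def)
    ultimately show ?thesis using cost_le[OF s(2), of "cexp e"]
      unfolding csteps.simps add_mult_distrib by linarith
  qed
  ultimately show "\<exists>t s'. exec (compile (Set r e)) s t s' \<and> simulates s' (den (Set r e) h) \<and>
     bounded g (B + cgrowth N g (Set r e)) s' \<and> t \<le> csteps N (Set r e) * M" by blast
qed

lemma runs_ok_In: "wf (In r) \<Longrightarrow> runs_ok N g (In r)"
  unfolding runs_ok_def
proof (intro allI impI, elim conjE)
  fix s h B M assume w: "wf (In r)" and s: "simulates s h" "bounded g B s" "B + cgrowth N g (In r) \<le> M"
  have M: "1 \<le> M" "g \<le> M" using s by (auto simp: bounded_def)
  show "\<exists>t s'. exec (compile (In r)) s t s' \<and> simulates s' (den (In r) h) \<and>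
     bounded g (B + cgrowth N g (In r)) s' \<and> t \<le> csteps N (In r) * M"
  proof (cases "inp s")
    case Nil
    have "len 0 \<le> g" "len 0 \<le> B" using s(2) by (auto simp: bounded_def len_def floorlog_def)
    then have "bounded g B (s\<lparr>reg := (reg s)(r := 0)\<rparr>)" using s(2) by (auto simp: bounded_def)
    moreover have "exec (Read r) s 1 (s\<lparr>reg := (reg s)(r := 0)\<rparr>)" using Nil by (rule exec.ReadEnd)
    moreover have "simulates (s\<lparr>reg := (reg s)(r := 0)\<rparr>) (den (In r) h)" using s(1) Nil by (simp add: simulates_def)
    moreover have "1 \<le> 2 * M" using M by simp
    ultimately show ?thesis unfolding compile.simps csteps.simps cgrowth.simps add_0_right by blast
  next
    case (Cons x xs)
    let ?s = "s\<lparr>reg := (reg s)(r := x), inp := xs\<rparr>"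
    have x: "len x \<le> g" "g \<le> B" using s(2) Cons by (auto simp: bounded_def)
    have "bounded g B ?s" using s(2) Cons x by (auto simp: bounded_def)
    moreover have "exec (Read r) s (1 + len x) ?s" using Cons by (rule exec.Read)
    moreover have "simulates ?s (den (In r) h)" using s(1) Cons by (auto simp: simulates_def split: list.split)
    moreover have "1 + len x \<le> 2 * M" using M x by simp
    ultimately show ?thesis unfolding compile.simps csteps.simps cgrowth.simps add_0_right by blast
  qed
qed

theorem compile_runs_ok: "wf c \<Longrightarrow> 2 \<notin> wr_reg c \<Longrightarrow> runs_ok N g c"
proof (induction c)
  case (Set r e)
  then show ?case by (intro runs_ok_Set)
next
  case (In r)
  then show ?case by (intro runs_ok_In)
next
  case (Put k a b e)
  let ?c = "Put k a b e" and ?a = "pairE (Const k) (pairE (cexp a) (cexp b))"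
  show ?case unfolding runs_ok_def
  proof (intro allI impI, elim conjE)
    fix s h B M assume s: "simulates s h" "bounded g B s" "B + cgrowth N g ?c \<le> M"
    let ?s = "s\<lparr>mem := (mem s)(val s ?a := val s (cexp e))\<rparr>"
    have "exec (compile ?c) s (1 + cost s ?a + cost s (cexp e)) ?s"
      using exec.Store[of ?a "cexp e" s] by (simp del: val_pairE)
    moreover have "simulates ?s (den ?c h)" using s(1) val_cexp[OF s(1)]
      by (auto simp: simulates_def pair_inject)
    moreover have "bounded g (B + cgrowth N g ?c) ?s"
      using len_storable[OF s(2), of e] Put s(2)
      by (auto simp del: val_pairE simp: bounded_def intro: le_trans[OF _ le_add1])
    moreover have "1 + cost s ?a + cost s (cexp e) \<le> csteps N ?c * M"
    proof -
      have "csize ?a * B \<le> csize ?a * M" "csize (cexp e) * B \<le> csize (cexp e) * M"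
        using s by (intro mult_le_mono2; simp)+
      moreover have "1 \<le> M" using s by (auto simp: bounded_def)
      ultimately show ?thesis using cost_le[OF s(2), of "cexp e"] cost_le[OF s(2), of ?a]
        unfolding csteps.simps add_mult_distrib by linarith
    qed
    ultimately show "\<exists>t s'. exec (compile ?c) s t s' \<and> simulates s' (den ?c h) \<and>
       bounded g (B + cgrowth N g ?c) s' \<and> t \<le> csteps N ?c * M" by blast
  qed
next
  case (Out e)
  let ?c = "Out e"
  show ?case unfolding runs_ok_def
  proof (intro allI impI, elim conjE)
    fix s h B M assume s: "simulates s h" "bounded g B s" "B + cgrowth N g ?c \<le> M"
    let ?s = "s\<lparr>outp := outp s @ [val s (cexp e)]\<rparr>"
    have "exec (compile ?c) s (1 + cost s (cexp e)) ?s" unfolding compile.simps by (rule exec.Write)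
    moreover have "simulates ?s (den ?c h)" using s(1) val_cexp[OF s(1)] by (simp add: simulates_def)
    moreover have "bounded g (B + cgrowth N g ?c) ?s" using s(2) by (simp add: bounded_def)
    moreover have "1 + cost s (cexp e) \<le> csteps N ?c * M"
    proof -
      have "csize (cexp e) * B \<le> csize (cexp e) * M" using s by (intro mult_le_mono2) simp
      moreover have "1 \<le> M" using s by (auto simp: bounded_def)
      ultimately show ?thesis using cost_le[OF s(2), of "cexp e"]
        unfolding csteps.simps add_mult_distrib by linarith
    qed
    ultimately show "\<exists>t s'. exec (compile ?c) s t s' \<and> simulates s' (den ?c h) \<and>
       bounded g (B + cgrowth N g ?c) s' \<and> t \<le> csteps N ?c * M" by blast
  qed
next
  case (Then c d)
  have c: "runs_ok N g c" and d: "runs_ok N g d" using Then by auto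
  show ?case unfolding runs_ok_def
  proof (intro allI impI, elim conjE)
    fix s h B M assume s: "simulates s h" "rg h 2 \<le> N" "bounded g B s" "B + cgrowth N g (c ;; d) \<le> M"
    obtain t s' where 1: "exec (compile c) s t s'" "simulates s' (den c h)" "bounded g (B + cgrowth N g c) s'"
      "t \<le> csteps N c * M"
      using c[unfolded runs_ok_def, rule_format, of s h B M] s by auto
    have "rg (den c h) 2 \<le> N" using same_den[of c h] Then s by (simp add: same_def)
    then obtain t' s'' where 2: "exec (compile d) s' t' s''" "simulates s'' (den d (den c h))"
      "bounded g (B + cgrowth N g c + cgrowth N g d) s''" "t' \<le> csteps N d * M"
      using d[unfolded runs_ok_def, rule_format, of s' "den c h" "B + cgrowth N g c" M] 1 s by auto
    show "\<exists>t s'. exec (compile (c ;; d)) s t s' \<and> simulates s' (den (c ;; d) h) \<and>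
       bounded g (B + cgrowth N g (c ;; d)) s' \<and> t \<le> csteps N (c ;; d) * M"
    proof -
      have "t + t' \<le> csteps N (c ;; d) * M" using 1(4) 2(4) by (simp add: algebra_simps)
      moreover have "B + cgrowth N g (c ;; d) = B + cgrowth N g c + cgrowth N g d" by simp
      ultimately show ?thesis using exec.Seq[OF 1(1) 2(1)] 2(2,3) by (metis compile.simps(5) den.simps(5))
    qed
  qed
next
  case (If e c d)
  have c: "runs_ok N g c" and d: "runs_ok N g d" using If by auto
  show ?case unfolding runs_ok_def
  proof (intro allI impI, elim conjE)
    fix s h B M assume s: "simulates s h" "rg h 2 \<le> N" "bounded g B s" "B + cgrowth N g (If e c d) \<le> M"
    have v: "val s (cexp e) = ev h e" by (rule val_cexp[OF s(1)])
    have "csize (cexp e) * B \<le> csize (cexp e) * M" using s by (intro mult_le_mono2) simp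
    moreover have "1 \<le> M" using s by (auto simp: bounded_def)
    ultimately have k: "1 + cost s (cexp e) \<le> (1 + csize (cexp e)) * M"
      using cost_le[OF s(3), of "cexp e"] unfolding add_mult_distrib by linarith
    show "\<exists>t s'. exec (compile (If e c d)) s t s' \<and> simulates s' (den (If e c d) h) \<and>
       bounded g (B + cgrowth N g (If e c d)) s' \<and> t \<le> csteps N (If e c d) * M"
    proof (cases "ev h e = 0")
      case False
      obtain t s' where 1: "exec (compile c) s t s'" "simulates s' (den c h)" "bounded g (B + cgrowth N g c) s'"
        "t \<le> csteps N c * M"
        using c[unfolded runs_ok_def, rule_format, of s h B M] s by auto
      have "exec (compile (If e c d)) s (1 + cost s (cexp e) + t) s'"
        using exec.CondTrue[OF _ 1(1), of "cexp e"] v False by simp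
      moreover have "bounded g (B + cgrowth N g (If e c d)) s'" using 1(3) by (rule bounded_mono) simp
      moreover have "1 + cost s (cexp e) + t \<le> csteps N (If e c d) * M"
        using k 1(4) by (simp add: algebra_simps)
      ultimately show ?thesis using 1 False by auto
    next
      case True
      obtain t s' where 1: "exec (compile d) s t s'" "simulates s' (den d h)" "bounded g (B + cgrowth N g d) s'"
        "t \<le> csteps N d * M"
        using d[unfolded runs_ok_def, rule_format, of s h B M] s by auto
      have "exec (compile (If e c d)) s (1 + cost s (cexp e) + t) s'"
        using exec.CondFalse[OF _ 1(1), of "cexp e"] v True by simp
      moreover have "bounded g (B + cgrowth N g (If e c d)) s'" using 1(3) by (rule bounded_mono) simp
      moreover have "1 + cost s (cexp e) + t \<le> csteps N (If e c d) * M"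
        using k 1(4) by (simp add: algebra_simps)
      ultimately show ?thesis using 1 True by auto
    qed
  qed
next
  case Nop
  have "1 \<le> M" if "bounded g B s" "B \<le> M" for B M s using that by (auto simp: bounded_def)
  then show ?case unfolding runs_ok_def using exec.Skip by fastforce
next
  case (For r c)
  have c: "runs_ok N g c" using For by auto
  let ?c = "For r c"
  show ?case unfolding runs_ok_def
  proof (intro allI impI, elim conjE)
    fix s h B M assume s: "simulates s h" "rg h 2 \<le> N" "bounded g B s" "B + cgrowth N g ?c \<le> M"
    define n where "n = rg h 2"
    let ?s = "s\<lparr>reg := (reg s)(r := 0)\<rparr>" and ?h = "h\<lparr>rg := (rg h)(r := 0)\<rparr>"
    have l0: "len 0 = 1" by (simp add: len_def floorlog_def)
    have B: "1 \<le> B" using s(3) by (auto simp: bounded_def)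
    have ex: "exec (Assign r (Const 0)) s 2 ?s"
      using exec.Assign[of r "Const 0" s] l0 by (simp add: numeral_2_eq_2)
    have G: "n * (cgrowth N g c + 1) \<le> N * (cgrowth N g c + 1)" using s by (intro mult_le_mono1) (simp add: n_def)
    have GT: "n * (csteps N c + 12) \<le> N * (csteps N c + 12)" using s by (intro mult_le_mono1) (simp add: n_def)
    have "bounded g B ?s" using For.prems by (intro bounded_reg[OF s(3)]) (use l0 B in auto)
    moreover have "simulates ?s ?h" using s(1) by (simp add: simulates_def)
    ultimately obtain t s' where 1: "exec (While (Bin Minus (Reg 2) (Reg r))
          (Seq (compile c) (Assign r (Bin Plus (Reg r) (Const 1))))) ?s t s'"
      "bounded g (B + n * (cgrowth N g c + 1)) s'" "t \<le> (5 + n * (csteps N c + 12)) * M"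
      "simulates s' ((fold (\<lambda>i t. den c (t\<lparr>rg := (rg t)(r := i)\<rparr>)) [0..<n] ?h)\<lparr>rg :=
          (rg (fold (\<lambda>i t. den c (t\<lparr>rg := (rg t)(r := i)\<rparr>)) [0..<n] ?h))(r := n)\<rparr>)"
      using While_correct[of r c N g n ?s ?h 0 n B M] For.prems c s G by (auto simp: n_def)
    \<comment> \<open>The initial assignment of 0 is invisible: the first round repeats it, and if
      there is no round, the final assignment of \<open>n = 0\<close> does.\<close>
    have "(fold (\<lambda>i t. den c (t\<lparr>rg := (rg t)(r := i)\<rparr>)) [0..<n] ?h)\<lparr>rg :=
          (rg (fold (\<lambda>i t. den c (t\<lparr>rg := (rg t)(r := i)\<rparr>)) [0..<n] ?h))(r := n)\<rparr> = den ?c h"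
      by (cases n) (simp_all add: n_def[symmetric] upt_conv_Cons del: upt_Suc)
    moreover have "bounded g (B + cgrowth N g ?c) s'"
      using 1(2) by (rule bounded_mono) (use G in simp)
    moreover have "2 + t \<le> csteps N ?c * M"
    proof -
      have "t \<le> (5 + N * (csteps N c + 12)) * M"
        using 1(3) GT by (meson add_left_mono le_trans mult_le_mono1)
      moreover have "1 \<le> M" using B s by simp
      ultimately show ?thesis by (simp add: algebra_simps)
    qed
    ultimately show "\<exists>t s'. exec (compile ?c) s t s' \<and> simulates s' (den ?c h) \<and>
       bounded g (B + cgrowth N g ?c) s' \<and> t \<le> csteps N ?c * M"
      using exec.Seq[OF ex 1(1)] 1(4) by auto
  qed
qed

section \<open>Polynomial dependence on the input size\<close>

definition is_polynomial :: "(nat \<Rightarrow> nat) \<Rightarrow> bool" where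
  "is_polynomial f \<longleftrightarrow> (\<exists>p. \<forall>x. f x = poly p x)"

lemma is_polynomial_const: "is_polynomial (\<lambda>x. c)"
  unfolding is_polynomial_def by (rule exI[of _ "[:c:]"]) simp

lemma is_polynomial_id: "is_polynomial (\<lambda>x. x)"
  unfolding is_polynomial_def by (rule exI[of _ "[:0, 1:]"]) simp

lemma is_polynomial_add: "is_polynomial f \<Longrightarrow> is_polynomial h \<Longrightarrow> is_polynomial (\<lambda>x. f x + h x)"
  unfolding is_polynomial_def by (metis poly_add)

lemma is_polynomial_mult: "is_polynomial f \<Longrightarrow> is_polynomial h \<Longrightarrow> is_polynomial (\<lambda>x. f x * h x)"
  unfolding is_polynomial_def by (metis poly_mult)

lemmas is_polynomial_intros =
  is_polynomial_const is_polynomial_id is_polynomial_add is_polynomial_mult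

lemma is_polynomial_cgrowth: "is_polynomial (\<lambda>x. cgrowth x x c)"
  by (induction c) (auto intro!: is_polynomial_intros simp del: One_nat_def add_Suc_right)

lemma is_polynomial_csteps: "is_polynomial (\<lambda>x. csteps x c)"
  by (induction c) (auto intro!: is_polynomial_intros simp del: One_nat_def add_Suc_right add_Suc plus_1_eq_Suc)

text \<open>The input size serves at once as a bound on \<open>n\<close>, on the lengths of input
  numbers and on the initial contents, so the time is a fixed polynomial in it. The prefix that
  stores \<open>n\<close> writes register 2 and is therefore treated apart from
  \<open>c\<close>.\<close>

theorem compile_poly_time:
  assumes "wf c" "2 \<notin> wr_reg c"
  shows "\<exists>p. \<forall>n xs. n \<le> input_size (n # xs) \<longrightarrow>
    (\<exists>t. runs (compile (In 0 ;; Set 2 (Var 0) ;; c)) (n # xs) t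
           (ot (den c \<lparr>rg = (\<lambda>_. 0)(0 := n, 2 := n), ar = (\<lambda>_ _ _. 0), ip = xs, ot = []\<rparr>)) \<and>
         t \<le> poly p (input_size (n # xs)))"
proof -
  let ?T = "\<lambda>x. (csteps x (In 0) + (csteps x (Set 2 (Var 0)) + csteps x c)) * (x + cgrowth x x c)"
  have "is_polynomial ?T"
    by (intro is_polynomial_intros is_polynomial_csteps is_polynomial_cgrowth)
  then obtain p where p: "\<And>x. ?T x = poly p x" by (auto simp: is_polynomial_def)
  show ?thesis
  proof (intro exI[of _ p] allI impI)
    fix n xs assume n: "n \<le> input_size (n # xs)"
    define g where "g = input_size (n # xs)"
    let ?h0 = "\<lparr>rg = (\<lambda>_. 0), ar = (\<lambda>_ _ _. 0), ip = n # xs, ot = []\<rparr>"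
    let ?h1 = "den (In 0) ?h0" let ?h2 = "den (Set 2 (Var 0)) ?h1"
    let ?M = "g + cgrowth g g c"
    have g1: "len y \<le> g" if "y \<in> set (n # xs)" for y
      unfolding g_def input_size_def using that by (intro member_le_sum_list) (auto simp: image_iff)
    have "1 \<le> g" using g1[of n] len_pos[of n] by simp
    then have b: "bounded g g (init_state (n # xs))"
      using g1 by (auto simp: bounded_def init_state_def len_def floorlog_def)
    have s0: "simulates (init_state (n # xs)) ?h0" by (auto simp: simulates_def init_state_def)
    obtain t1 s1 where 1: "exec (compile (In 0)) (init_state (n # xs)) t1 s1" "simulates s1 ?h1" "bounded g g s1"
      "t1 \<le> csteps g (In 0) * ?M"
      using runs_ok_In[of 0 g g, unfolded runs_ok_def, rule_format, of "init_state (n # xs)" ?h0 g ?M] b s0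
      by auto
    obtain t2 s2 where 2: "exec (compile (Set 2 (Var 0))) s1 t2 s2" "simulates s2 ?h2" "bounded g g s2"
      "t2 \<le> csteps g (Set 2 (Var 0)) * ?M"
      using runs_ok_Set[of 2 "Var 0" g g, unfolded runs_ok_def, rule_format, of s1 ?h1 g ?M] 1 by auto
    obtain t3 s3 where 3: "exec (compile c) s2 t3 s3" "simulates s3 (den c ?h2)" "t3 \<le> csteps g c * ?M"
      using compile_runs_ok[OF assms, of g g, unfolded runs_ok_def, rule_format, of s2 ?h2 g ?M] 2 n
      by (auto simp: g_def)
    have "exec (compile (In 0 ;; Set 2 (Var 0) ;; c)) (init_state (n # xs)) (t1 + (t2 + t3)) s3"
      using exec.Seq[OF 1(1) exec.Seq[OF 2(1) 3(1)]] by simp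
    moreover have "outp s3 = ot (den c ?h2)" using 3(2) by (simp add: simulates_def)
    moreover have "t1 + (t2 + t3) \<le> poly p g"
      using 1(4) 2(4) 3(3) unfolding p[symmetric] by (simp add: algebra_simps)
    moreover have "?h2 = \<lparr>rg = (\<lambda>_. 0)(0 := n, 2 := n), ar = (\<lambda>_ _ _. 0), ip = xs, ot = []\<rparr>" by simp
    ultimately show "\<exists>t. runs (compile (In 0 ;; Set 2 (Var 0) ;; c)) (n # xs) t
           (ot (den c \<lparr>rg = (\<lambda>_. 0)(0 := n, 2 := n), ar = (\<lambda>_ _ _. 0), ip = xs, ot = []\<rparr>)) \<and>
         t \<le> poly p (input_size (n # xs))"
      unfolding runs_def g_def[symmetric] by metis
  qed
qed

section \<open>From forests to cycles\<close>

primrec tour :: "(nat \<Rightarrow> 'a \<times> 'a) \<Rightarrow> nat set \<Rightarrow> nat \<Rightarrow> 'a \<Rightarrow> 'a" where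
  "tour E K 0 = id"
| "tour E K (Suc m) = (if m \<in> K
     then (tour E K m)(fst (E m) := tour E K m (snd (E m)), snd (E m) := tour E K m (fst (E m)))
     else tour E K m)"

lemma inj_tour: "inj (tour E K m)"
proof (induction m)
  case (Suc m)
  note eq = inj_eq[OF Suc]
  show ?case by (rule injI) (auto simp: eq split: if_splits)
qed simp

section \<open>Orbits under exchanges of successors\<close>

definition reach :: "('a \<Rightarrow> 'a) \<Rightarrow> ('a \<times> 'a) set" where
  "reach f = {(x, f x) | x. True}\<^sup>*"

lemma reach_refl: "(x, x) \<in> reach f" by (simp add: reach_def)
lemma reach_step: "(x, y) \<in> reach f \<Longrightarrow> (x, f y) \<in> reach f"
  unfolding reach_def by (rule rtrancl_into_rtrancl) auto
lemma reach_first: "(f x, y) \<in> reach f \<Longrightarrow> (x, y) \<in> reach f"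
  unfolding reach_def by (rule converse_rtrancl_into_rtrancl) auto
lemma reach_trans: "(x, y) \<in> reach f \<Longrightarrow> (y, z) \<in> reach f \<Longrightarrow> (x, z) \<in> reach f"
  unfolding reach_def by (rule rtrancl_trans)

lemma reach_induct [consumes 1, case_names refl step]:
  assumes "(x, y) \<in> reach f" "P x" "\<And>y. (x, y) \<in> reach f \<Longrightarrow> P y \<Longrightarrow> P (f y)"
  shows "P y"
  using assms(1) unfolding reach_def
proof (induction rule: rtrancl_induct)
  case (step y z)
  then show ?case using assms(3)[unfolded reach_def] by auto
qed (rule assms(2))

lemma reach_converse_induct [consumes 1, case_names refl step]:
  assumes "(x, y) \<in> reach f" "P y" "\<And>x. (f x, y) \<in> reach f \<Longrightarrow> P (f x) \<Longrightarrow> P x"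
  shows "P x"
  using assms(1) unfolding reach_def
proof (induction rule: converse_rtrancl_induct)
  case (step y z)
  then show ?case using assms(3)[unfolded reach_def] by auto
qed (rule assms(2))

text \<open>A walk under \<open>f\<close> towards \<open>u\<close> inside its class is unaffected by
  the swap until it arrives. From \<open>u\<close> the new function enters the class of
  \<open>v\<close> at \<open>f v\<close>, runs on to \<open>v\<close> and returns to
  \<open>f u\<close>, so the two orbits become one.\<close>

lemma reach_swap:
  assumes closed: "\<And>x. L (f x) = L x" and conn: "\<And>x y. L x = L y \<Longrightarrow> (x, y) \<in> reach f"
    and uv: "L u \<noteq> L v" and xy: "L x \<in> {L u, L v}" "L y \<in> {L u, L v}"
  shows "(x, y) \<in> reach (f(u := f v, v := f u))"
proof -
  define g where "g = f(u := f v, v := f u)"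
  have g: "g u = f v" "g v = f u" "\<And>x. x \<noteq> u \<Longrightarrow> x \<noteq> v \<Longrightarrow> g x = f x"
    using uv by (auto simp: g_def)
  have to_u: "(x, u) \<in> reach g" if "L x = L u" for x
    using conn[OF that] that
  proof (induction rule: reach_converse_induct)
    case (step x)
    show ?case
    proof (cases "x = u")
      case False
      then have "g x = f x" using step(3) uv g(3) by metis
      then show ?thesis using step closed by (metis reach_first)
    qed (simp add: reach_refl)
  qed (simp add: reach_refl)
  have to_v: "(x, v) \<in> reach g" if "L x = L v" for x
    using conn[OF that] that
  proof (induction rule: reach_converse_induct)
    case (step x)
    show ?case
    proof (cases "x = v")
      case False
      then have "g x = f x" using step(3) uv g(3) by metis
      then show ?thesis using step closed by (metis reach_first)
    qed (simp add: reach_refl)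
  qed (simp add: reach_refl)
  have u_v: "(u, v) \<in> reach g"
    by (rule reach_first) (use to_v[of "f v"] closed g in auto)
  have v_u: "(v, u) \<in> reach g"
    by (rule reach_first) (use to_u[of "f u"] closed g in auto)
  have from_u: "(u, y) \<in> reach g" if "L u = L y" for y
  proof -
    have "L y = L u \<and> (u, y) \<in> reach g" using conn[OF that]
    proof (induction rule: reach_induct)
      case (step y)
      then have y: "L y = L u" "(u, y) \<in> reach g" by auto
      have "(u, f y) \<in> reach g"
      proof (cases "y = u")
        case True
        then show ?thesis using reach_step[OF u_v] g by simp
      next
        case False
        then have "g y = f y" using y uv g(3) by metis
        then show ?thesis using reach_step[OF y(2)] by simp
      qed
      then show ?case using y closed by simp
    qed (simp add: reach_refl)
    then show ?thesis by simp
  qed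
  have from_v: "(v, y) \<in> reach g" if "L v = L y" for y
  proof -
    have "L y = L v \<and> (v, y) \<in> reach g" using conn[OF that]
    proof (induction rule: reach_induct)
      case (step y)
      then have y: "L y = L v" "(v, y) \<in> reach g" by auto
      have "(v, f y) \<in> reach g"
      proof (cases "y = v")
        case True
        then show ?thesis using reach_step[OF v_u] g by simp
      next
        case False
        then have "g y = f y" using y uv g(3) by metis
        then show ?thesis using reach_step[OF y(2)] by simp
      qed
      then show ?case using y closed by simp
    qed (simp add: reach_refl)
    then show ?thesis by simp
  qed
  show ?thesis using xy to_u[of x] to_v[of x] from_u[of y] from_v[of y] u_v v_u unfolding g_def[symmetric]
    by (metis insert_iff reach_trans singletonD)
qed

text \<open>The orbits of the tour are exactly the classes. It is essential that each kept edge
  joins two different classes, as a swap within one orbit would split it.\<close>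

lemma tour_classes:
  assumes "\<And>i. i < m \<Longrightarrow> i \<in> K \<Longrightarrow> labelling id E K i (fst (E i)) \<noteq> labelling id E K i (snd (E i))"
  shows "labelling id E K m (tour E K m x) = labelling id E K m x \<and>
    (labelling id E K m x = labelling id E K m y \<longrightarrow> (x, y) \<in> reach (tour E K m))"
  using assms
proof (induction m arbitrary: x y)
  case 0
  then show ?case by (simp add: reach_refl)
next
  case (Suc m)
  define L where "L = labelling id E K m"
  define f where "f = tour E K m"
  let ?u = "fst (E m)" and ?v = "snd (E m)"
  have labS: "labelling id E K (Suc m) = (if m \<in> K then merge_label L (E m) else L)"
    by (simp add: L_def)
  have tourS: "tour E K (Suc m) = (if m \<in> K then f(?u := f ?v, ?v := f ?u) else f)"
    by (simp add: f_def)
  have IH: "L (f x) = L x \<and> (L x = L y \<longrightarrow> (x, y) \<in> reach f)" for x y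
    unfolding L_def f_def by (rule Suc.IH) (use Suc.prems less_SucI in blast)
  have closed: "L (f x) = L x" for x using IH by blast
  have conn: "(x, y) \<in> reach f" if "L x = L y" for x y using IH that by blast
  show ?case
  proof (cases "m \<in> K")
    case False
    then show ?thesis using closed conn unfolding labS tourS by simp
  next
    case True
    have uv: "L ?u \<noteq> L ?v" unfolding L_def by (rule Suc.prems[OF lessI True])
    define g where "g = f(?u := f ?v, ?v := f ?u)"
    have "merge_label L (E m) (g x) = merge_label L (E m) x"
      using closed by (auto simp: merge_label_def g_def)
    moreover have "(x, y) \<in> reach g" if "merge_label L (E m) x = merge_label L (E m) y"
    proof (cases "L x \<in> {L ?u, L ?v}")
      case True
      then have "L y \<in> {L ?u, L ?v}" using that by (auto simp: merge_label_def split: if_splits)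
      then show ?thesis using reach_swap[of L f, OF closed conn uv True] unfolding g_def by blast
    next
      case False
      then have xy: "L x = L y" using that by (auto simp: merge_label_def split: if_splits)
      have "L y = L x \<and> (x, y) \<in> reach g" using conn[OF xy]
      proof (induction rule: reach_induct)
        case (step y)
        then have "g y = f y" using False by (auto simp: g_def)
        then show ?case using step closed reach_step[of x y g] by auto
      qed (simp add: reach_refl)
      then show ?thesis by simp
    qed
    ultimately show ?thesis using True unfolding labS tourS by (simp add: g_def[symmetric])
  qed
qed

lemma tour_in:
  "(\<And>i. i < m \<Longrightarrow> i \<in> K \<Longrightarrow> fst (E i) \<in> V \<and> snd (E i) \<in> V) \<Longrightarrow> x \<in> V \<Longrightarrow> tour E K m x \<in> V"
  by (induction m arbitrary: x) auto

text \<open>\<open>d\<close> is to be the weight extended by 0 on the diagonal, so that fixed points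
  are free and the initial identity costs nothing. If \<open>f\<close> is the tour before a swap,
  then \<open>d u (f v) \<le> d u v + d v (f v)\<close>, and likewise with \<open>u\<close> and
  \<open>v\<close> exchanged.\<close>

lemma tour_cost:
  fixes d :: "'a \<Rightarrow> 'a \<Rightarrow> rat"
  assumes V: "finite V" and refl: "\<And>x. d x x = 0" and sym: "\<And>x y. d x y = d y x"
    and tri: "\<And>x y z. x \<in> V \<Longrightarrow> y \<in> V \<Longrightarrow> z \<in> V \<Longrightarrow> d x z \<le> d x y + d y z"
    and E: "\<And>i. i < m \<Longrightarrow> i \<in> K \<Longrightarrow> fst (E i) \<in> V \<and> snd (E i) \<in> V \<and> fst (E i) \<noteq> snd (E i)"
  shows "(\<Sum>x\<in>V. d x (tour E K m x)) \<le> 2 * (\<Sum>i\<in>K \<inter> {..<m}. d (fst (E i)) (snd (E i)))"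
  using E
proof (induction m)
  case 0
  then show ?case by (simp add: refl)
next
  case (Suc m)
  let ?f = "tour E K m" and ?u = "fst (E m)" and ?v = "snd (E m)"
  have IH: "(\<Sum>x\<in>V. d x (?f x)) \<le> 2 * (\<Sum>i\<in>K \<inter> {..<m}. d (fst (E i)) (snd (E i)))"
    using Suc by simp
  show ?case
  proof (cases "m \<in> K")
    case False
    then have "K \<inter> {..<Suc m} = K \<inter> {..<m}" by (auto simp: less_Suc_eq)
    then show ?thesis using IH False by simp
  next
    case True
    then have uv: "?u \<in> V" "?v \<in> V" "?u \<noteq> ?v" using Suc.prems by auto
    let ?g = "?f(?u := ?f ?v, ?v := ?f ?u)"
    have fV: "?f x \<in> V" if "x \<in> V" for x using tour_in[of m K E V x] that Suc.prems by simp
    have split: "(\<Sum>x\<in>V. h x) = h ?u + h ?v + (\<Sum>x\<in>V - {?u, ?v}. h x)" for h :: "'a \<Rightarrow> rat"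
    proof -
      have "(\<Sum>x\<in>V. h x) = h ?u + (\<Sum>x\<in>V - {?u}. h x)" using V uv by (simp add: sum.remove)
      also have "(\<Sum>x\<in>V - {?u}. h x) = h ?v + (\<Sum>x\<in>V - {?u} - {?v}. h x)"
        using V uv by (intro sum.remove) auto
      also have "V - {?u} - {?v} = V - {?u, ?v}" by auto
      finally show ?thesis by simp
    qed
    have "(\<Sum>x\<in>V. d x (?g x)) = d ?u (?f ?v) + d ?v (?f ?u) + (\<Sum>x\<in>V - {?u, ?v}. d x (?f x))"
      using uv(3) by (subst split) simp
    also have "\<dots> \<le> d ?u (?f ?u) + d ?v (?f ?v) + 2 * d ?u ?v + (\<Sum>x\<in>V - {?u, ?v}. d x (?f x))"
      using tri[of ?u ?v "?f ?v"] tri[of ?v ?u "?f ?u"] uv fV[of ?u] fV[of ?v] sym[of ?u ?v] by simp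
    also have "\<dots> = (\<Sum>x\<in>V. d x (?f x)) + 2 * d ?u ?v"
      by (subst split) simp
    also have "\<dots> \<le> 2 * (\<Sum>i\<in>K \<inter> {..<Suc m}. d (fst (E i)) (snd (E i)))"
    proof -
      have "K \<inter> {..<Suc m} = insert m (K \<inter> {..<m})" using True by auto
      then show ?thesis using IH by simp
    qed
    finally show ?thesis using True by simp
  qed
qed

text \<open>The arcs from \<open>x\<close> to \<open>f x\<close> have different end sets unless
  \<open>S\<close> has two vertices. In that case the arc leaving \<open>r\<close> is given copy 1,
  which exists because \<open>S\<close> is then a terminal set.\<close>

lemma cycle_of_permutation:
  fixes f :: "'a \<Rightarrow> 'a"
  assumes S: "finite S" "S \<subseteq> V" "2 \<le> card S" and inj: "inj_on f S" and closed: "f ` S \<subseteq> S"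
    and reach: "\<And>x y. x \<in> S \<Longrightarrow> y \<in> S \<Longrightarrow> (x, y) \<in> reach f"
    and two: "card S = 2 \<Longrightarrow> S \<in> \<T>" and r: "r \<in> S"
  defines "edge \<equiv> \<lambda>x. ({x, f x}, of_bool (card S = 2 \<and> x = r) :: nat)"
  shows "cycle V \<T> (S, edge ` S)" and "inj_on edge S" and "\<And>x. x \<in> S \<Longrightarrow> f x \<noteq> x"
proof -
  have closed_sub: "S \<subseteq> A" if "f ` A \<subseteq> A" "x \<in> A" "x \<in> S" for A x
  proof
    fix y assume "y \<in> S"
    from reach[OF \<open>x \<in> S\<close> this] show "y \<in> A"
      by (induction rule: reach_induct) (use that in auto)
  qed
  show nofix: "f x \<noteq> x" if "x \<in> S" for x
  proof
    assume "f x = x"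
    then have "S \<subseteq> {x}" using closed_sub[of "{x}" x] that by simp
    then have "card S \<le> card {x}" by (intro card_mono) auto
    then show False using S by simp
  qed
  show inj_e: "inj_on edge S"
  proof (rule inj_onI, rule ccontr)
    fix x y assume xy: "x \<in> S" "y \<in> S" "edge x = edge y" "x \<noteq> y"
    then have f: "f x = y" "f y = x" by (auto simp: edge_def doubleton_eq_iff)
    have "S = {x, y}" using closed_sub[of "{x, y}" x] f xy by auto
    \<comment> \<open>\<open>S\<close> has two vertices, one of which is \<open>r\<close>, so the
      two copy numbers differ.\<close>
    then show False using xy r by (auto simp: edge_def split: if_splits)
  qed
  have "edge x \<in> medges V \<T> \<and> ends (edge x) \<subseteq> S" if x: "x \<in> S" for x
  proof -
    have fx: "f x \<in> S" "f x \<noteq> x" using closed nofix x by auto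
    then have e: "{x, f x} \<subseteq> S" "card {x, f x} = 2" using x by auto
    show ?thesis
    proof (cases "card S = 2 \<and> x = r")
      case True
      then have "{x, f x} = S" using e S(1) by (intro card_subset_eq) auto
      then show ?thesis using True two e by (auto simp: edge_def medges_def)
    next
      case False
      then show ?thesis using e S(2) by (auto simp: edge_def medges_def)
    qed
  qed
  then have sub: "subgraph V \<T> (S, edge ` S)" using S by (auto simp: subgraph_def)
  have deg: "degree_in (S, edge ` S) v = 2" if v: "v \<in> S" for v
  proof -
    have "f ` S = S" using S(1) inj closed by (simp add: endo_inj_surj)
    then obtain p where p: "p \<in> S" "f p = v" using v by (metis imageE)
    have "v \<in> ends (edge x) \<longleftrightarrow> x \<in> {v, p}" if "x \<in> S" for x
      using inj_onD[OF inj _ that p(1)] p by (auto simp: edge_def)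
    then have "{e \<in> edge ` S. v \<in> ends e} = edge ` {v, p}"
      using p v by blast
    moreover have "card (edge ` {v, p}) = 2"
    proof (subst card_image)
      show "inj_on edge {v, p}" by (rule inj_on_subset[OF inj_e]) (use p v in auto)
      show "card {v, p} = 2" using p nofix[OF p(1)] by simp
    qed
    ultimately show ?thesis by (simp add: degree_in_def)
  qed
  have "(x, y) \<in> {(x, y). \<exists>e\<in>edge ` S. ends e = {x, y}}\<^sup>*" if xy: "x \<in> S" "y \<in> S" for x y
  proof -
    let ?R = "{(x, y). \<exists>e\<in>edge ` S. ends e = {x, y}}"
    have "y \<in> S \<and> (x, y) \<in> ?R\<^sup>*" using reach[OF xy]
    proof (induction rule: reach_induct)
      case (step y)
      then have "(y, f y) \<in> ?R" by (auto simp: edge_def)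
      then show ?case using step closed by (meson image_subset_iff rtrancl.rtrancl_into_rtrancl)
    qed (simp add: xy)
    then show ?thesis by simp
  qed
  then have "connected_subgraph (S, edge ` S)" unfolding connected_subgraph_def by simp
  then show "cycle V \<T> (S, edge ` S)"
    using sub deg r by (auto simp: cycle_def)
qed

text \<open>Such a class contains a kept edge, and by minimality an end of this edge stays connected
  to a terminal even without the edge. Consequently a class of size 2 is a terminal set and its edge
  is duplicated.\<close>

lemma nontrivial_class_has_terminal:
  assumes feas: "feasible \<T> (labelling id E K m)"
    and min: "\<And>i. i \<in> K \<Longrightarrow> \<not> feasible \<T> (labelling id E (K - {i}) m)"
    and xy: "labelling id E K m x = c" "labelling id E K m y = c" "x \<noteq> y"
  shows "\<exists>T\<in>\<T>. \<exists>t\<in>T. labelling id E K m t = c"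
proof -
  let ?L = "labelling id E K m"
  have "\<exists>i\<in>K. ?L (fst (E i)) = c"
  proof (rule ccontr)
    assume no: "\<not> ?thesis"
    \<comment> \<open>This labelling keeps the vertices of class \<open>c\<close> apart and lumps
      all others together. If no kept edge lies in \<open>c\<close>, every kept edge has equal
      labels at its ends, so leastness applies.\<close>
    have "(if ?L x = c then Some x else None) = (if ?L y = c then Some y else None)"
    proof (rule labelling_least[where M = "\<lambda>x. if ?L x = c then Some x else None"])
      fix i assume i: "i < m" "i \<in> K"
      then have "?L (fst (E i)) \<noteq> c" using no by auto
      moreover have "?L (fst (E i)) = ?L (snd (E i))" using i by (rule labelling_edge)
      ultimately show "(if ?L (fst (E i)) = c then Some (fst (E i)) else None) =
         (if ?L (snd (E i)) = c then Some (snd (E i)) else None)" by simp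
    next
      show "?L x = ?L y" using xy by simp
    qed simp
    then show False using xy by simp
  qed
  then obtain i where i: "i \<in> K" "?L (fst (E i)) = c" by blast
  obtain T t where T: "T \<in> \<T>" "t \<in> T"
    and M: "labelling id E (K - {i}) m t = labelling id E (K - {i}) m (fst (E i))"
    using minimal_edge_separates[OF feas min[OF i(1)]] by metis
  have "?L t = ?L (fst (E i))" using M by (rule labelling_mono[rotated]) auto
  then show ?thesis using T i by auto
qed

text \<open>The edges are ordered by increasing first vertex, as the program writes them, and not
  along the cycle.\<close>

definition cycle_list :: "nat \<Rightarrow> (nat \<Rightarrow> nat) \<Rightarrow> (nat \<Rightarrow> nat) \<Rightarrow> nat \<Rightarrow> (nat \<times> nat \<times> nat) list" where
  "cycle_list n L f v = map (\<lambda>u. (u, f u, of_bool (length (filter (\<lambda>u. L u = v) [0..<n]) = 2 \<and> u = v)))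
     (filter (\<lambda>u. L u = v) [0..<n])"

definition cycle_lists :: "nat \<Rightarrow> (nat \<Rightarrow> nat) \<Rightarrow> (nat \<Rightarrow> nat) \<Rightarrow> (nat \<times> nat \<times> nat) list list" where
  "cycle_lists n L f = map (cycle_list n L f) (filter (\<lambda>v. L v = v \<and> f v \<noteq> v) [0..<n])"

theorem tour_solution:
  fixes w :: "nat set \<Rightarrow> rat" and E :: "nat \<Rightarrow> nat \<times> nat"
  assumes inst: "metric_instance {..<n} w \<T>"
    and E: "\<And>i. i < m \<Longrightarrow> fst (E i) < n \<and> snd (E i) < n"
    and forest: "\<And>i. i < m \<Longrightarrow> fst (E i) = snd (E i) \<or>
        labelling id E UNIV i (fst (E i)) \<noteq> labelling id E UNIV i (snd (E i))"
    and K: "K \<subseteq> {..<m}" and feas: "feasible \<T> (labelling id E K m)"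
    and min: "\<And>i. i \<in> K \<Longrightarrow> \<not> feasible \<T> (labelling id E (K - {i}) m)"
  defines "ess \<equiv> cycle_lists n (labelling id E K m) (tour E K m)"
  defines "\<C> \<equiv> set (map subgraph_of ess)"
  shows "encodes_cycles \<C> (encode_lists (\<lambda>(u, v, k). [u, v, k]) ess)"
    and "disjoint_cycles {..<n} \<T> \<C>" and "cycles_respect \<T> \<C>"
    and "weight w \<C> \<le> 2 * (\<Sum>i\<in>K. w {fst (E i), snd (E i)})"
proof -
  let ?V = "{..<n}"
  define L where "L = labelling id E K m"
  define f where "f = tour E K m"
  have st: "steiner_instance ?V w \<T>" using inst by (simp add: metric_instance_def)
  have TV: "T \<subseteq> ?V" "2 \<le> card T" if "T \<in> \<T>" for T using st that by (auto simp: steiner_instance_def)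
  have neq: "fst (E i) \<noteq> snd (E i)" if "i \<in> K" for i
    using minimal_edge_neq[OF feas min[OF that]] .
  have EK: "i \<in> K \<Longrightarrow> fst (E i) \<in> ?V \<and> snd (E i) \<in> ?V" for i using E K by auto
  \<comment> \<open>The partition by kept edges is finer than the one by all edges, so acyclicity is
    inherited.\<close>
  have forestK: "labelling id E K i (fst (E i)) \<noteq> labelling id E K i (snd (E i))" if "i < m" "i \<in> K" for i
  proof
    assume "labelling id E K i (fst (E i)) = labelling id E K i (snd (E i))"
    then have "labelling id E UNIV i (fst (E i)) = labelling id E UNIV i (snd (E i))"
      by (rule labelling_mono[rotated]) auto
    then show False using forest[OF that(1)] neq[OF that(2)] by simp
  qed
  have closed: "L (f x) = L x" and reach: "L x = L y \<Longrightarrow> (x, y) \<in> reach f" for x y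
    using tour_classes[of m K E x y, OF forestK] by (auto simp: L_def f_def)
  have fV: "f x < n" if "x < n" for x
    using tour_in[of m K E ?V x] EK that by (auto simp: f_def)
  have LV: "L x < n" if "x < n" for x
    unfolding L_def by (rule labelling_less) (use EK that in auto)
  have LL: "L (L x) = L x" for x unfolding L_def by (rule labelling_rep)
  define S where "S v = {u. u < n \<and> L u = v}" for v
  have fS: "finite (S v)" for v by (simp add: S_def)
  \<comment> \<open>\<open>L v = v\<close> selects one representative per class, and a
    representative fixed by \<open>f\<close> belongs to a singleton class, which gets no
    cycle.\<close>
  define R where "R = {v. v < n \<and> L v = v \<and> f v \<noteq> v}"
  have len_S: "length (filter (\<lambda>u. L u = v) [0..<n]) = card (S v)" for v
    by (subst distinct_card[symmetric]) (auto simp: S_def intro: arg_cong[where f = card])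
  define edge where "edge v x = ({x, f x}, of_bool (card (S v) = 2 \<and> x = v) :: nat)" for v x
  define G where "G v = (S v, edge v ` S v)" for v
  have big: "2 \<le> card (S v)" if "v \<in> R" for v
  proof -
    have "{v, f v} \<subseteq> S v" "f v \<noteq> v" using that closed fV by (auto simp: S_def R_def)
    then show ?thesis using card_mono[OF fS, of "{v, f v}" v] by simp
  qed
  have T_class: "T \<subseteq> S v" if "T \<in> \<T>" "t \<in> T" "L t = v" for T t v
    using feas that TV unfolding feasible_def S_def L_def by blast
  have two: "S v \<in> \<T>" if v: "v \<in> R" "card (S v) = 2" for v
  proof -
    have "L v = v" "L (f v) = v" "v \<noteq> f v" using v closed by (auto simp: R_def)
    then obtain T t where T: "T \<in> \<T>" "t \<in> T" "L t = v"
      using nontrivial_class_has_terminal[OF feas min, of v v "f v"] unfolding L_def by blast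
    have "T \<subseteq> S v" using T_class T by blast
    moreover have "2 \<le> card T" using TV T by simp
    ultimately have "T = S v" using v fS card_subset_eq[of "S v" T] card_mono[OF fS, of T v] by simp
    then show ?thesis using T by simp
  qed
  have cyc: "cycle ?V \<T> (G v) \<and> inj_on (edge v) (S v) \<and> (\<forall>x\<in>S v. f x \<noteq> x)" if v: "v \<in> R" for v
  proof -
    have "inj_on f (S v)" using inj_tour[of E K m] unfolding f_def by (rule inj_on_subset) simp
    then show ?thesis
      using cycle_of_permutation[of "S v" ?V f \<T> v] big[OF v] fS[of v] reach two[OF v] v closed fV
      unfolding G_def edge_def[abs_def] by (auto simp: S_def R_def image_subset_iff)
  qed
  have sg: "subgraph_of (cycle_list n L f v) = G v \<and> distinct (map edge_of (cycle_list n L f v))"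
    if v: "v \<in> R" for v
  proof -
    let ?us = "filter (\<lambda>u. L u = v) [0..<n]"
    have us: "set ?us = S v" by (auto simp: S_def)
    have m: "map edge_of (cycle_list n L f v) = map (edge v) ?us"
      by (simp add: cycle_list_def len_S edge_of_def edge_def)
    then have e: "edge_of ` set (cycle_list n L f v) = edge v ` S v"
      by (metis list.set_map us)
    have "(\<Union>e\<in>set (cycle_list n L f v). ends (edge_of e)) = (\<Union>e\<in>edge v ` S v. ends e)"
      unfolding e[symmetric] by simp
    also have "\<dots> = S v" using closed fV by (auto simp: edge_def S_def)
    finally have "subgraph_of (cycle_list n L f v) = G v"
      by (simp add: subgraph_of_def G_def e)
    moreover have "distinct (map (edge v) ?us)"
      using cyc[OF v] us by (simp add: distinct_map)
    ultimately show ?thesis by (simp add: m)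
  qed
  have setR: "set (filter (\<lambda>v. L v = v \<and> f v \<noteq> v) [0..<n]) = R" by (auto simp: R_def)
  have mess: "map subgraph_of ess = map G (filter (\<lambda>v. L v = v \<and> f v \<noteq> v) [0..<n])"
    unfolding ess_def cycle_lists_def L_def[symmetric] f_def[symmetric]
    using sg setR by (auto simp: R_def)
  have CG: "\<C> = G ` R" unfolding \<C>_def mess using setR by (metis list.set_map)
  have injG: "inj_on G R"
  proof (rule inj_onI)
    fix v v' assume v: "v \<in> R" "v' \<in> R" "G v = G v'"
    then have "v \<in> S v'" by (auto simp: G_def S_def R_def)
    then show "v = v'" using v by (simp add: S_def R_def)
  qed
  show "encodes_cycles \<C> (encode_lists (\<lambda>(u, v, k). [u, v, k]) ess)"
    unfolding encodes_cycles_def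
  proof (intro exI[of _ ess] conjI refl)
    show "\<C> = set (map subgraph_of ess)" by (simp add: \<C>_def)
    show "distinct (map subgraph_of ess)"
      unfolding mess distinct_map using injG by (simp only: setR) simp
    show "\<forall>es\<in>set ess. distinct (map edge_of es)"
      unfolding ess_def cycle_lists_def L_def[symmetric] f_def[symmetric] using sg
      by (auto simp: R_def)
  qed
  show "disjoint_cycles ?V \<T> \<C>"
    unfolding disjoint_cycles_def CG using cyc
    by (auto simp: pairwise_def disjnt_def G_def S_def)
  show "cycles_respect \<T> \<C>"
    unfolding cycles_respect_def
  proof (intro conjI ballI)
    fix C assume "C \<in> \<C>"
    then obtain v where v: "C = G v" by (auto simp: CG)
    show "cycle_respects \<T> C"
      unfolding cycle_respects_def v G_def fst_conv
    proof
      fix T assume T: "T \<in> \<T>"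
      show "T \<subseteq> S v \<or> T \<inter> S v = {}"
      proof (cases "T \<inter> S v = {}")
        case False
        then obtain t where "t \<in> T" "L t = v" by (auto simp: S_def)
        then show ?thesis using T_class[OF T] by blast
      qed simp
    qed
  next
    fix T t assume T: "T \<in> \<T>" "t \<in> T"
    have tn: "t < n" using T TV by auto
    have "T \<subseteq> S (L t)" using T_class T by blast
    then have c2: "2 \<le> card (S (L t))" using TV(2)[OF T(1)] card_mono[OF fS, of T "L t"] by simp
    \<comment> \<open>A fixed representative is an orbit of its own, but this class contains a whole
      terminal set.\<close>
    have "f (L t) \<noteq> L t"
    proof
      assume fx: "f (L t) = L t"
      have "S (L t) \<subseteq> {L t}"
      proof
        fix y assume "y \<in> S (L t)"
        then have "(L t, y) \<in> reach f" using LL reach by (simp add: S_def)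
        then show "y \<in> {L t}" by (induction rule: reach_induct) (use fx in auto)
      qed
      then have "card (S (L t)) \<le> card {L t}" by (intro card_mono) auto
      then show False using c2 by simp
    qed
    then have "L t \<in> R" using LL LV tn by (simp add: R_def)
    then show "\<exists>C\<in>\<C>. t \<in> verts C" using tn by (auto simp: CG G_def S_def)
  qed
  define d where "d x y = (if x = y then 0 else w {x, y})" for x y
  have w0: "0 \<le> w {x, y}" if "x < n" "y < n" "x \<noteq> y" for x y
    using st that by (simp add: steiner_instance_def)
  have tri: "d x z \<le> d x y + d y z" if "x \<in> ?V" "y \<in> ?V" "z \<in> ?V" for x y z
    using that inst w0[of x y] w0[of y x] w0[of y z] by (auto simp: d_def metric_instance_def insert_commute)
  have "weight w \<C> = (\<Sum>v\<in>R. \<Sum>e\<in>edge v ` S v. w (ends e))"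
    unfolding weight_def CG by (subst sum.reindex[OF injG]) (simp add: G_def)
  also have "\<dots> = (\<Sum>v\<in>R. \<Sum>x\<in>S v. d x (f x))"
  proof (intro sum.cong refl)
    fix v assume v: "v \<in> R"
    show "(\<Sum>e\<in>edge v ` S v. w (ends e)) = (\<Sum>x\<in>S v. d x (f x))"
      using cyc[OF v] by (subst sum.reindex) (auto simp: edge_def d_def intro!: sum.cong)
  qed
  also have "\<dots> = (\<Sum>x\<in>(\<Union>v\<in>R. S v). d x (f x))"
    by (rule sum.UNION_disjoint[symmetric]) (auto simp: S_def R_def)
  also have "\<dots> \<le> (\<Sum>x\<in>?V. d x (f x))"
    using w0 fV by (intro sum_mono2) (auto simp: S_def d_def)
  also have "\<dots> \<le> 2 * (\<Sum>i\<in>K \<inter> {..<m}. d (fst (E i)) (snd (E i)))"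
    unfolding f_def
  proof (rule tour_cost)
    show "d x y = d y x" for x y by (simp add: d_def insert_commute)
  qed (use tri EK neq in \<open>auto simp: d_def\<close>)
  also have "\<dots> = 2 * (\<Sum>i\<in>K. w {fst (E i), snd (E i)})"
    using K neq by (auto simp: d_def Int_absorb2 intro!: sum.cong)
  finally show "weight w \<C> \<le> 2 * (\<Sum>i\<in>K. w {fst (E i), snd (E i)})" .
qed

section \<open>The invariant of the primal-dual phase\<close>

text \<open>\<open>W\<close> holds the unpaid part of each edge weight, multiplied by \<open>\<sigma>\<close>. As each of the first
  \<open>m\<close> steps joins two classes unless there is no active class, \<open>n\<close> steps suffice.\<close>

definition dual_inv :: "nat \<Rightarrow> (nat set \<Rightarrow> rat) \<Rightarrow> nat set set \<Rightarrow> nat \<Rightarrow> (nat \<Rightarrow> nat \<times> nat) \<Rightarrow> (nat \<Rightarrow> nat \<Rightarrow> nat) \<Rightarrow> bool" where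
  "dual_inv n w \<T> m E W \<longleftrightarrow> (\<exists>eps \<sigma>. 0 < \<sigma> \<and> (\<forall>j<m. 0 \<le> eps j) \<and>
     (\<forall>u<n. \<forall>v<n. u \<noteq> v \<longrightarrow> of_nat (W u v) =
        \<sigma> * (w {u, v} - (\<Sum>j<m. eps j * of_nat (active_ends \<T> (labelling id E UNIV j) u v)))) \<and>
     (\<forall>i<m. fst (E i) < n \<and> snd (E i) < n \<and> (fst (E i) = snd (E i) \<or>
        labelling id E UNIV i (fst (E i)) \<noteq> labelling id E UNIV i (snd (E i)) \<and>
        w {fst (E i), snd (E i)} =
          (\<Sum>j<m. eps j * of_nat (active_ends \<T> (labelling id E UNIV j) (fst (E i)) (snd (E i)))))) \<and>
     (feasible \<T> (labelling id E UNIV m) \<or> card (labelling id E UNIV m ` {..<n}) + m = n))"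

lemma dual_inv_0:
  assumes "\<And>u v. u < n \<Longrightarrow> v < n \<Longrightarrow> u \<noteq> v \<Longrightarrow> of_nat (W u v) = \<sigma> * w {u, v}" "0 < \<sigma>"
  shows "dual_inv n w \<T> 0 E W"
  unfolding dual_inv_def
  by (rule exI[of _ "\<lambda>_. 0"], rule exI[of _ \<sigma>]) (use assms in auto)

lemma merge_label_same: "merge_label L (a, a) = L"
  by (auto simp: merge_label_def)

lemma feasible_if_active_ends_zero:
  assumes "\<And>T. T \<in> \<T> \<Longrightarrow> T \<subseteq> {..<n}" "\<And>u v. u < n \<Longrightarrow> v < n \<Longrightarrow> active_ends \<T> L u v = 0"
  shows "feasible \<T> L"
  unfolding feasible_iff_not_active
proof (intro allI notI)
  fix c assume "active \<T> L c"
  then obtain T u v where T: "T \<in> \<T>" "u \<in> T" "v \<in> T" "L u = c" "L v \<noteq> c"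
    by (auto simp: active_def)
  then have "active_ends \<T> L u v = 0" using assms by blast
  then show False using T \<open>active \<T> L c\<close> by (auto simp: active_ends_def split: if_splits)
qed

text \<open>A zero charge and the dummy entry \<open>(0, 0)\<close> fill a round in which nothing is
  active; \<open>0 < n\<close> ensures that 0 is a vertex.\<close>

lemma dual_inv_skip:
  assumes inv: "dual_inv n w \<T> m E W" and T: "\<And>T. T \<in> \<T> \<Longrightarrow> T \<subseteq> {..<n}"
    and none: "\<And>u v. u < n \<Longrightarrow> v < n \<Longrightarrow> active_ends \<T> (labelling id E UNIV m) u v = 0"
    and E: "E m = (0, 0)" "0 < n"
  shows "dual_inv n w \<T> (Suc m) E W"
proof -
  obtain eps \<sigma> where *: "0 < \<sigma>" "\<And>j. j < m \<Longrightarrow> 0 \<le> eps j"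
     "\<And>u v. u < n \<Longrightarrow> v < n \<Longrightarrow> u \<noteq> v \<Longrightarrow> of_nat (W u v) =
        \<sigma> * (w {u, v} - (\<Sum>j<m. eps j * of_nat (active_ends \<T> (labelling id E UNIV j) u v)))"
     "\<And>i. i < m \<Longrightarrow> fst (E i) < n \<and> snd (E i) < n \<and> (fst (E i) = snd (E i) \<or>
        labelling id E UNIV i (fst (E i)) \<noteq> labelling id E UNIV i (snd (E i)) \<and>
        w {fst (E i), snd (E i)} =
          (\<Sum>j<m. eps j * of_nat (active_ends \<T> (labelling id E UNIV j) (fst (E i)) (snd (E i)))))"
    using inv unfolding dual_inv_def by blast
  define eps' where "eps' = eps(m := 0)"
  have S: "(\<Sum>j<Suc m. eps' j * of_nat (active_ends \<T> (labelling id E UNIV j) u v)) =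
      (\<Sum>j<m. eps j * of_nat (active_ends \<T> (labelling id E UNIV j) u v))" for u v
    by (simp add: eps'_def)
  have "labelling id E UNIV (Suc m) = labelling id E UNIV m" using E by (simp add: merge_label_same)
  moreover have "feasible \<T> (labelling id E UNIV m)" by (rule feasible_if_active_ends_zero[OF T none])
  ultimately have "feasible \<T> (labelling id E UNIV (Suc m))" by simp
  moreover have "\<forall>j<Suc m. 0 \<le> eps' j" using * by (auto simp: eps'_def less_Suc_eq)
  moreover have "\<forall>i<Suc m. fst (E i) < n \<and> snd (E i) < n \<and> (fst (E i) = snd (E i) \<or>
        labelling id E UNIV i (fst (E i)) \<noteq> labelling id E UNIV i (snd (E i)) \<and>
        w {fst (E i), snd (E i)} =
          (\<Sum>j<m. eps j * of_nat (active_ends \<T> (labelling id E UNIV j) (fst (E i)) (snd (E i)))))"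
    using *(4) E by (auto simp: less_Suc_eq)
  ultimately show ?thesis unfolding dual_inv_def
    by (intro exI[of _ eps'] exI[of _ \<sigma>] conjI disjI1) (use *(1,3) in \<open>simp_all add: S del: sum.lessThan_Suc\<close>)
qed

lemma active_ends_le_2: "active_ends \<T> L u v \<le> 2"
  by (auto simp: active_ends_def)

text \<open>The edge between two active classes is paid from both sides. Doubling all entries of \<open>W\<close> in
  each step keeps them integral.\<close>

lemma dual_inv_step:
  assumes inv: "dual_inv n w \<T> m E W"
    and ab: "a < n" "b < n" "active_ends \<T> (labelling id E UNIV m) a b \<noteq> 0"
    and best: "best = (W a b + W a b) div active_ends \<T> (labelling id E UNIV m) a b"
      "\<And>u v. u < n \<Longrightarrow> v < n \<Longrightarrow> active_ends \<T> (labelling id E UNIV m) u v \<noteq> 0 \<Longrightarrow>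
         best \<le> (W u v + W u v) div active_ends \<T> (labelling id E UNIV m) u v"
    and W': "\<And>u v. u < n \<Longrightarrow> v < n \<Longrightarrow>
         W' u v = W u v + W u v - best * active_ends \<T> (labelling id E UNIV m) u v"
    and E': "\<And>i. i < m \<Longrightarrow> E' i = E i" "E' m = (a, b)"
  shows "dual_inv n w \<T> (Suc m) E' W'"
proof -
  define c where "c u v = active_ends \<T> (labelling id E UNIV m) u v" for u v
  have labelling': "labelling id E' UNIV j = labelling id E UNIV j" if "j \<le> m" for j
    by (rule labelling_cong) (use E' that in auto)
  have labS: "labelling id E' UNIV (Suc m) = merge_label (labelling id E UNIV m) (a, b)"
    using E' labelling'[of m] by simp
  \<comment> \<open>The divisor is 1 or 2 and the dividend is even, so the division leaves no
    remainder and comparing integer quotients compares the true charges.\<close>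
  have exact: "(x + x) div c u v * c u v = x + x" if "c u v \<noteq> 0" for x u v
  proof -
    have "c u v = 1 \<or> c u v = 2" using active_ends_le_2[of \<T> "labelling id E UNIV m" u v] that unfolding c_def by linarith
    then show ?thesis by auto
  qed
  have le: "best * c u v \<le> W u v + W u v" if "u < n" "v < n" for u v
  proof (cases "c u v = 0")
    case False
    then have "best * c u v \<le> (W u v + W u v) div c u v * c u v"
      using best(2)[OF that] unfolding c_def by (intro mult_le_mono1) auto
    then show ?thesis using exact[OF False] by simp
  qed simp
  have ab0: "W' a b = 0" using W' ab exact[of a b "W a b"] best(1) by (simp add: c_def)
  have Lab: "labelling id E UNIV m a \<noteq> labelling id E UNIV m b" using ab by (auto simp: active_ends_def split: if_splits)
  then have neq: "a \<noteq> b" by auto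
  obtain eps \<sigma> where *: "0 < \<sigma>" "\<And>j. j < m \<Longrightarrow> 0 \<le> eps j"
     "\<And>u v. u < n \<Longrightarrow> v < n \<Longrightarrow> u \<noteq> v \<Longrightarrow> of_nat (W u v) =
        \<sigma> * (w {u, v} - (\<Sum>j<m. eps j * of_nat (active_ends \<T> (labelling id E UNIV j) u v)))"
     "\<And>i. i < m \<Longrightarrow> fst (E i) < n \<and> snd (E i) < n \<and> (fst (E i) = snd (E i) \<or>
        labelling id E UNIV i (fst (E i)) \<noteq> labelling id E UNIV i (snd (E i)) \<and>
        w {fst (E i), snd (E i)} =
          (\<Sum>j<m. eps j * of_nat (active_ends \<T> (labelling id E UNIV j) (fst (E i)) (snd (E i)))))"
     "feasible \<T> (labelling id E UNIV m) \<or> card (labelling id E UNIV m ` {..<n}) + m = n"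
    using inv unfolding dual_inv_def by blast
  \<comment> \<open>After the doubling one unit of weight corresponds to
    \<open>2 * \<sigma>\<close>, so the integer \<open>best\<close> stands for this charge.\<close>
  define eps' where "eps' = eps(m := of_nat best / (2 * \<sigma>))"
  have S: "(\<Sum>j<Suc m. eps' j * of_nat (active_ends \<T> (labelling id E' UNIV j) u v)) =
      (\<Sum>j<m. eps j * of_nat (active_ends \<T> (labelling id E UNIV j) u v)) + of_nat best / (2 * \<sigma>) * of_nat (c u v)" for u v
    by (simp add: eps'_def labelling' c_def)
  have W2: "of_nat (W' u v) = 2 * \<sigma> * (w {u, v} - (\<Sum>j<Suc m. eps' j * of_nat (active_ends \<T> (labelling id E' UNIV j) u v)))"
    if "u < n" "v < n" "u \<noteq> v" for u v
  proof -
    have "rat_of_nat (W' u v) = 2 * of_nat (W u v) - of_nat best * of_nat (c u v)"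
      using W'[OF that(1,2)] le[OF that(1,2)] by (simp add: c_def of_nat_diff)
    also have "\<dots> = 2 * \<sigma> * (w {u, v} - (\<Sum>j<m. eps j * of_nat (active_ends \<T> (labelling id E UNIV j) u v)))
        - of_nat best * of_nat (c u v)"
      using *(3)[OF that] by simp
    also have "\<dots> = 2 * \<sigma> * (w {u, v} - (\<Sum>j<Suc m. eps' j * of_nat (active_ends \<T> (labelling id E' UNIV j) u v)))"
      unfolding S using *(1) by (simp add: field_simps)
    finally show ?thesis .
  qed
  have tight: "fst (E' i) < n \<and> snd (E' i) < n \<and> (fst (E' i) = snd (E' i) \<or>
        labelling id E' UNIV i (fst (E' i)) \<noteq> labelling id E' UNIV i (snd (E' i)) \<and>
        w {fst (E' i), snd (E' i)} =
          (\<Sum>j<Suc m. eps' j * of_nat (active_ends \<T> (labelling id E' UNIV j) (fst (E' i)) (snd (E' i)))))"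
    if "i < Suc m" for i
  proof (cases "i = m")
    case True
    have "w {a, b} = (\<Sum>j<Suc m. eps' j * of_nat (active_ends \<T> (labelling id E' UNIV j) a b))"
      using W2[OF ab(1,2) neq] ab0 *(1) by simp
    then show ?thesis using True E' ab Lab labelling'[of m] by simp
  next
    case False
    then have i: "i < m" using that by simp
    \<comment> \<open>The ends of an earlier edge share a class by now, so it is not charged any
      more and stays tight.\<close>
    have "labelling id E UNIV m (fst (E i)) = labelling id E UNIV m (snd (E i))" using i by (rule labelling_edge) simp
    then have "c (fst (E i)) (snd (E i)) = 0" by (simp add: c_def active_ends_def)
    then show ?thesis unfolding S E'(1)[OF i] using *(4)[OF i] labelling'[of i] i by simp
  qed
  have "\<not> feasible \<T> (labelling id E UNIV m)"
    using ab(3) unfolding feasible_iff_not_active by (auto simp: active_ends_def split: if_splits)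
  then have "card (labelling id E' UNIV (Suc m) ` {..<n}) + Suc m = n"
    using *(5) card_merge_label_image[of "{..<n}" a b "labelling id E UNIV m"] ab Lab unfolding labS by simp
  moreover have "\<forall>j<Suc m. 0 \<le> eps' j" using *(1,2) by (auto simp: eps'_def less_Suc_eq)
  moreover have "0 < 2 * \<sigma>" using *(1) by simp
  ultimately show ?thesis unfolding dual_inv_def using W2 tight by blast
qed

lemma dual_inv_final:
  assumes inv: "dual_inv n w \<T> m E W" and inst: "steiner_instance {..<n} w \<T>"
    and K: "K \<subseteq> {..<m}" and feas: "feasible \<T> (labelling id E K m)"
    and min: "\<And>i. i \<in> K \<Longrightarrow> \<not> feasible \<T> (labelling id E (K - {i}) m)"
  shows "(\<Sum>i\<in>K. w {fst (E i), snd (E i)}) \<le> opt {..<n} w \<T>"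
proof -
  obtain eps \<sigma> where *: "0 < \<sigma>" "\<And>j. j < m \<Longrightarrow> 0 \<le> eps j"
     "\<And>u v. u < n \<Longrightarrow> v < n \<Longrightarrow> u \<noteq> v \<Longrightarrow> of_nat (W u v) =
        \<sigma> * (w {u, v} - (\<Sum>j<m. eps j * of_nat (active_ends \<T> (labelling id E UNIV j) u v)))"
     "\<And>i. i < m \<Longrightarrow> fst (E i) < n \<and> snd (E i) < n \<and> (fst (E i) = snd (E i) \<or>
        labelling id E UNIV i (fst (E i)) \<noteq> labelling id E UNIV i (snd (E i)) \<and>
        w {fst (E i), snd (E i)} =
          (\<Sum>j<m. eps j * of_nat (active_ends \<T> (labelling id E UNIV j) (fst (E i)) (snd (E i)))))"
    using inv unfolding dual_inv_def by blast
  obtain \<C> where C: "disjoint_cycles {..<n} \<T> \<C>" "cycles_respect \<T> \<C>" "weight w \<C> = opt {..<n} w \<T>"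
    using opt_attained(1)[OF inst] by blast
  have "(\<Sum>i\<in>K. w {fst (E i), snd (E i)}) \<le> weight w \<C>"
  proof (rule forest_weight_le[OF inst _ _ K feas min, where eps = eps])
    fix i assume "i < m"
    then show "fst (E i) \<in> {..<n} \<and> snd (E i) \<in> {..<n}" "fst (E i) = snd (E i) \<or>
        labelling id E UNIV i (fst (E i)) \<noteq> labelling id E UNIV i (snd (E i))"
      using *(4)[of i] by auto
  next
    fix u v assume uv: "u \<in> {..<n}" "v \<in> {..<n}" "u \<noteq> v"
    \<comment> \<open>No edge is overpaid, because \<open>W u v\<close> is a natural number.\<close>
    have "0 \<le> \<sigma> * (w {u, v} - (\<Sum>j<m. eps j * of_nat (active_ends \<T> (labelling id E UNIV j) u v)))"
      using *(3)[of u v] uv by (metis lessThan_iff of_nat_0_le_iff)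
    then show "(\<Sum>j<m. eps j * of_nat (active_ends \<T> (labelling id E UNIV j) u v)) \<le> w {u, v}"
      using *(1) by (simp add: zero_le_mult_iff)
  next
    fix i assume "i < m" "fst (E i) \<noteq> snd (E i)"
    then show "w {fst (E i), snd (E i)} =
          (\<Sum>j<m. eps j * of_nat (active_ends \<T> (labelling id E UNIV j) (fst (E i)) (snd (E i))))"
      using *(4)[OF \<open>i < m\<close>] by blast
  qed (assumption | rule *(2) C)+
  then show ?thesis using C by simp
qed

text \<open>Otherwise \<open>n > 0\<close> initial classes would have undergone \<open>n\<close>
  mergers, leaving no class at all.\<close>

lemma dual_inv_feasible:
  assumes inv: "dual_inv n w \<T> n E W" and inst: "steiner_instance {..<n} w \<T>"
  shows "feasible \<T> (labelling id E UNIV n)"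
proof (cases "n = 0")
  case True
  then have "\<T> = {}" using inst by (fastforce simp: steiner_instance_def)
  then show ?thesis by (simp add: feasible_def)
next
  case False
  have "feasible \<T> (labelling id E UNIV n) \<or> card (labelling id E UNIV n ` {..<n}) + n = n"
    using inv unfolding dual_inv_def by blast
  moreover have "0 < card (labelling id E UNIV n ` {..<n})" using False by (auto simp: card_gt_0_iff)
  ultimately show ?thesis by linarith
qed

section \<open>The program\<close>

text \<open>Register 2 holds \<open>n\<close> and register 3 the common denominator of the weights read so far.
  Arrays: 0 weights, later unpaid parts; 1 index of the terminal set of a vertex, from 1, or 0 if
  there is none; 2 labels; 3 activity of labels; 4 and 5 the ends of the edges; 6 flags of
  the edges kept; 7 successors on the cycles.\<close>

abbreviation A1 :: "nat \<Rightarrow> hexp \<Rightarrow> hexp" where "A1 k a \<equiv> Arr k a (Num 0)"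
abbreviation P1 :: "nat \<Rightarrow> hexp \<Rightarrow> hexp \<Rightarrow> cmd" where "P1 k a e \<equiv> Put k a (Num 0) e"
abbreviation rd :: "st \<Rightarrow> nat \<Rightarrow> nat \<Rightarrow> nat" where "rd s k x \<equiv> ar s k x 0"

text \<open>The absolute difference, since at least one of the truncated differences
  vanishes.\<close>

definition diffE :: "hexp \<Rightarrow> hexp \<Rightarrow> hexp" where
  "diffE a b = Op Plus (Op Minus a b) (Op Minus b a)"
definition eqE :: "hexp \<Rightarrow> hexp \<Rightarrow> hexp" where
  "eqE a b = Op Minus (Num 1) (diffE a b)"
definition neE :: "hexp \<Rightarrow> hexp \<Rightarrow> hexp" where
  "neE a b = Op Minus (Num 1) (eqE a b)"
text \<open>A truth value only in the sense of being nonzero, not one of 0 and 1.\<close>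

definition ltE :: "hexp \<Rightarrow> hexp \<Rightarrow> hexp" where
  "ltE a b = Op Minus b a"

lemma ev_eqE [simp]: "ev s (eqE a b) = of_bool (ev s a = ev s b)"
  by (simp add: eqE_def diffE_def)
lemma ev_neE [simp]: "ev s (neE a b) = of_bool (ev s a \<noteq> ev s b)"
  by (simp add: neE_def)
lemma ev_ltE [simp]: "ev s (ltE a b) = ev s b - ev s a"
  by (simp add: ltE_def)

lemma same_rg: "same c s t \<Longrightarrow> r \<notin> wr_reg c \<Longrightarrow> rg t r = rg s r"
  and same_ar: "same c s t \<Longrightarrow> k \<notin> wr_arr c \<Longrightarrow> ar t k = ar s k"
  and same_ip: "same c s t \<Longrightarrow> \<not> reads c \<Longrightarrow> ip t = ip s"
  and same_ot: "same c s t \<Longrightarrow> \<not> writes c \<Longrightarrow> ot t = ot s"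
  by (auto simp: same_def)

lemmas rg_den = same_rg[OF same_den] and ar_den = same_ar[OF same_den]
  and ip_den = same_ip[OF same_den] and ot_den = same_ot[OF same_den]

subsection \<open>Reading the instance\<close>

definition scaleC :: cmd where
  "scaleC = For 6 (For 7 (Put 0 (Var 6) (Var 7) (Op Times (Arr 0 (Var 6) (Var 7)) (Var 1))))"

lemma wr_scaleC: "wr_reg scaleC = {6, 7}" "wr_arr scaleC = {0}" "\<not> reads scaleC" "\<not> writes scaleC" "wf scaleC"
  by (auto simp: scaleC_def)

lemma den_scaleC:
  assumes "x < rg s 2" "y < rg s 2"
  shows "ar (den scaleC s) 0 x y = ar s 0 x y * rg s 1"
proof -
  have "\<forall>x y. ar (den scaleC s) 0 x y =
      (if (x, y) \<in> {..<rg s 2} \<times> {..<rg s 2} then ar s 0 x y * rg s 1 else ar s 0 x y)"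
    unfolding scaleC_def
  proof (rule For2_rule[where I = "\<lambda>P t. \<forall>x y. ar t 0 x y =
      (if (x, y) \<in> P then ar s 0 x y * rg s 1 else ar s 0 x y)"])
    fix i j P t
    assume *: "(i, j) \<notin> P" "\<forall>x y. ar t 0 x y = (if (x, y) \<in> P then ar s 0 x y * rg s 1 else ar s 0 x y)"
      "same (For 6 (For 7 (Put 0 (Var 6) (Var 7) (Op Times (Arr 0 (Var 6) (Var 7)) (Var 1))))) s t"
      "rg t 6 = i" "rg t 7 = j"
    have "rg t 1 = rg s 1" using same_rg[OF *(3), of 1] by simp
    then show "\<forall>x y. ar (den (Put 0 (Var 6) (Var 7) (Op Times (Arr 0 (Var 6) (Var 7)) (Var 1))) t) 0 x y =
        (if (x, y) \<in> insert (i, j) P then ar s 0 x y * rg s 1 else ar s 0 x y)"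
      using * by auto
  qed auto
  then show ?thesis using assms by simp
qed

text \<open>With common denominator \<open>D\<close> in register 3 and next weight
  \<open>a / b\<close>, the old entries are multiplied by \<open>b\<close>, the new one is
  \<open>D * a\<close>, and \<open>D\<close> becomes \<open>D * b\<close>. All these products have a
  factor in register 0 or 1, as \<open>storable\<close> demands.\<close>

definition weightC :: cmd where
  "weightC = In 0 ;; In 1 ;; scaleC ;;
     Put 0 (Var 5) (Var 4) (Op Times (Var 3) (Var 0)) ;;
     Put 0 (Var 4) (Var 5) (Op Times (Var 3) (Var 0)) ;;
     Set 3 (Op Times (Var 3) (Var 1))"

lemma wr_weightC: "wr_reg weightC = {0, 1, 3, 6, 7}" "wr_arr weightC = {0}" "\<not> writes weightC" "wf weightC"
  by (auto simp: weightC_def wr_scaleC)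

lemma encode_weight_nonneg:
  assumes "0 \<le> q"
  shows "\<exists>a b. encode_weight q = [a, b] \<and> 0 < b \<and> q = of_nat a / of_nat b"
proof -
  obtain a b where ab: "quotient_of q = (a, b)" by (cases "quotient_of q")
  have b: "0 < b" using quotient_of_denom_pos[OF ab] .
  have q: "q = of_int a / of_int b" using quotient_of_div[OF ab] .
  have a: "0 \<le> a" using assms b unfolding q by (simp add: zero_le_divide_iff)
  have "q = of_nat (nat a) / of_nat (nat b)" using a b q by simp
  then show ?thesis using ab b by (auto simp: encode_weight_def)
qed

text \<open>\<open>Q\<close> describes the pairs whose weight has been read so far.\<close>

definition scaled :: "(nat \<Rightarrow> nat \<Rightarrow> bool) \<Rightarrow> (nat set \<Rightarrow> rat) \<Rightarrow> st \<Rightarrow> bool" where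
  "scaled Q w t \<longleftrightarrow> 0 < rg t 3 \<and> (\<forall>u<rg t 2. \<forall>v<rg t 2. u \<noteq> v \<and> Q u v \<longrightarrow>
     rat_of_nat (ar t 0 u v) = of_nat (rg t 3) * w {u, v})"

lemma den_weightC:
  assumes sc: "scaled Q w s" and i: "i < rg s 2" "j < rg s 2" "rg s 4 = j" "rg s 5 = i" "i \<noteq> j"
    and ip: "ip s = encode_weight (w {i, j}) @ xs" and w: "0 \<le> w {i, j}"
  shows "scaled (\<lambda>u v. Q u v \<or> {u, v} = {i, j}) w (den weightC s)" "ip (den weightC s) = xs"
proof -
  obtain a b where ab: "encode_weight (w {i, j}) = [a, b]" "0 < b" "w {i, j} = of_nat a / of_nat b"
    using encode_weight_nonneg[OF w] by blast
  define s1 where "s1 = s\<lparr>rg := (rg s)(0 := a, 1 := b), ip := xs\<rparr>"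
  have s1: "den (In 1) (den (In 0) s) = s1"
    using ip ab by (simp add: s1_def)
  define s2 where "s2 = den scaleC s1"
  have s2: "rg s2 r = rg s1 r" if "r \<notin> {6, 7}" for r using that by (simp add: s2_def rg_den wr_scaleC)
  have W2: "ar s2 0 x y = ar s 0 x y * b" if "x < rg s 2" "y < rg s 2" for x y
    using den_scaleC[of x s1 y] that by (simp add: s2_def s1_def)
  have d: "den weightC s = (let t = den (Put 0 (Var 4) (Var 5) (Op Times (Var 3) (Var 0)))
      (den (Put 0 (Var 5) (Var 4) (Op Times (Var 3) (Var 0))) s2) in
      t\<lparr>rg := (rg t)(3 := rg t 3 * rg t 1)\<rparr>)"
    unfolding weightC_def den.simps(5) s1 s2_def[symmetric] by (simp add: Let_def)
  have regs: "rg s2 0 = a" "rg s2 1 = b" "rg s2 3 = rg s 3" "rg s2 4 = j" "rg s2 5 = i" "rg s2 2 = rg s 2"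
    using i by (simp_all add: s2 s1_def)
  have 3: "rg (den weightC s) 3 = rg s 3 * b" "rg (den weightC s) 2 = rg s 2"
    by (simp_all add: d Let_def regs regs(2)[unfolded One_nat_def])
  have W: "ar (den weightC s) 0 x y = (if {x, y} = {i, j} then rg s 3 * a else ar s 0 x y * b)"
    if "x < rg s 2" "y < rg s 2" "x \<noteq> y" for x y
    using that W2 i by (auto simp: d Let_def regs doubleton_eq_iff)
  show "scaled (\<lambda>u v. Q u v \<or> {u, v} = {i, j}) w (den weightC s)"
    unfolding scaled_def 3
  proof (intro conjI allI impI)
    show "0 < rg s 3 * b" using sc ab by (simp add: scaled_def)
    fix u v assume uv: "u < rg s 2" "v < rg s 2" "u \<noteq> v \<and> (Q u v \<or> {u, v} = {i, j})"
    show "rat_of_nat (ar (den weightC s) 0 u v) = of_nat (rg s 3 * b) * w {u, v}"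
    proof (cases "{u, v} = {i, j}")
      case True
      have "rat_of_nat (rg s 3 * a) = of_nat (rg s 3 * b) * (of_nat a / of_nat b)" using ab(2) by simp
      then show ?thesis using W uv True ab(3) by simp
    next
      case False
      then have "rat_of_nat (ar s 0 u v) = of_nat (rg s 3) * w {u, v}"
        using sc uv by (auto simp: scaled_def)
      then show ?thesis using W uv False by simp
    qed
  qed
  show "ip (den weightC s) = xs"
    by (simp add: d Let_def s2_def ip_den wr_scaleC s1_def)
qed

definition weightsC :: cmd where
  "weightsC = Set 3 (Num 1) ;; For 4 (For 5 (If (ltE (Var 5) (Var 4)) weightC Nop))"

lemma wr_weightsC: "wr_reg weightsC = {0, 1, 3, 4, 5, 6, 7}" "wr_arr weightsC = {0}" "\<not> writes weightsC" "wf weightsC"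
  by (auto simp: weightsC_def wr_weightC)

lemma scaled_mono: "scaled Q w t \<Longrightarrow> (\<And>u v. u \<noteq> v \<Longrightarrow> Q' u v \<Longrightarrow> Q u v) \<Longrightarrow> scaled Q' w t"
  by (auto simp: scaled_def)

lemma scaled_reg: "scaled Q w (t\<lparr>rg := (rg t)(r := x)\<rparr>) = scaled Q w t" if "r \<noteq> 2" "r \<noteq> 3"
  using that by (simp add: scaled_def)

lemma den_weightsC:
  assumes w: "\<And>u v. u < n \<Longrightarrow> v < n \<Longrightarrow> u \<noteq> v \<Longrightarrow> 0 \<le> w {u, v}" and n: "rg s 2 = n"
    and ip: "ip s = concat (map (\<lambda>j. concat (map (\<lambda>i. encode_weight (w {i, j})) [0..<j])) [0..<n]) @ xs"
  shows "scaled (\<lambda>u v. True) w (den weightsC s)" "ip (den weightsC s) = xs"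
proof -
  let ?row = "\<lambda>j. concat (map (\<lambda>i. encode_weight (w {i, j})) [0..<j])"
  let ?rest = "\<lambda>j. concat (map ?row [j..<n]) @ xs"
  let ?Q = "\<lambda>j u v. u < j \<and> v < (j::nat)"
  let ?Q' = "\<lambda>i j u v. u < j \<and> v < (j::nat) \<or> u = j \<and> v < i \<or> v = j \<and> u < i"
  let ?I = "\<lambda>j t. scaled (?Q j) w t \<and> ip t = ?rest j"
  let ?c = "If (ltE (Var 5) (Var 4)) weightC Nop"
  define s1 where "s1 = den (Set 3 (Num 1)) s"
  have n1: "rg s1 2 = n" using n by (simp add: s1_def)
  have "?I (rg s1 2) (den (For 4 (For 5 ?c)) s1)"
  proof (rule For_rule[where I = ?I])
    show "?I 0 s1" using ip by (simp add: s1_def scaled_def)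
  next
    fix j t assume j: "j < rg s1 2" and I: "?I j t" and t: "same (For 4 (For 5 ?c)) s1 t" "rg t 4 = j"
    have n2: "rg t 2 = n" using same_rg[OF t(1), of 2] n1 by (simp add: wr_weightC)
    \<comment> \<open>Rounds with \<open>i \<ge> j\<close> are idle, so the invariant is frozen at
      \<open>min i j\<close>.\<close>
    let ?J = "\<lambda>i u. scaled (?Q' (min i j) j) w u \<and>
        ip u = concat (map (\<lambda>i. encode_weight (w {i, j})) [min i j..<j]) @ ?rest (Suc j)"
    have "?J (rg t 2) (den (For 5 ?c) t)"
    proof (rule For_rule[where I = ?J])
      have "[j..<n] = j # [Suc j..<n]" using j n1 by (simp add: upt_conv_Cons)
      then show "?J 0 t" using I by simp
    next
      fix i u assume i: "i < rg t 2" and J: "?J i u" and u: "same (For 5 ?c) t u" "rg u 5 = i"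
      have u4: "rg u 4 = j" "rg u 2 = n"
        using same_rg[OF u(1), of 4] same_rg[OF u(1), of 2] t n2 by (simp_all add: wr_weightC)
      show "?J (Suc i) (den ?c u)"
      proof (cases "i < j")
        case True
        have "[i..<j] = i # [Suc i..<j]" using True by (simp add: upt_conv_Cons)
        then have ipu: "ip u = encode_weight (w {i, j}) @
            (concat (map (\<lambda>i. encode_weight (w {i, j})) [Suc i..<j]) @ ?rest (Suc j))"
          using J True by simp
        have sc: "scaled (?Q' i j) w u" using J True by simp
        have ij: "i \<noteq> j" "0 \<le> w {i, j}" "i < rg u 2" "j < rg u 2"
          using True w[of i j] i j n1 n2 u4 by auto
        have "scaled (\<lambda>x y. ?Q' i j x y \<or> {x, y} = {i, j}) w (den weightC u)"
          "ip (den weightC u) = concat (map (\<lambda>i. encode_weight (w {i, j})) [Suc i..<j]) @ ?rest (Suc j)"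
          by (rule den_weightC[OF sc ij(3,4) u4(1) u(2) ij(1) ipu ij(2)])+
        moreover from this(1) have "scaled (?Q' (Suc i) j) w (den weightC u)"
          by (rule scaled_mono) (auto simp: less_Suc_eq)
        ultimately show ?thesis using True u4 u(2) by (simp add: min_def)
      next
        case False
        then have "min i j = j" "min (Suc i) j = j" by auto
        then show ?thesis using J u4 u(2) False by simp
      qed
    qed (auto simp: wr_weightC scaled_reg)
    then have "?J n (den (For 5 ?c) t)" using n2 by simp
    then have "scaled (?Q' j j) w (den (For 5 ?c) t)" "ip (den (For 5 ?c) t) = ?rest (Suc j)"
      using j n1 by (simp_all add: min_def)
    moreover from this(1) have "scaled (?Q (Suc j)) w (den (For 5 ?c) t)"
      by (rule scaled_mono) (auto simp: less_Suc_eq)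
    ultimately show "?I (Suc j) (den (For 5 ?c) t)" by simp
  qed (auto simp: wr_weightC scaled_reg)
  then have I: "?I n (den weightsC s)" unfolding weightsC_def den.simps(5) s1_def[symmetric] n1 .
  then show "ip (den weightsC s) = xs" by simp
  have "rg (den weightsC s) 2 = n" using n by (simp add: rg_den wr_weightsC)
  then show "scaled (\<lambda>u v. True) w (den weightsC s)" using I by (auto simp: scaled_def)
qed

text \<open>As every loop has \<open>n\<close> rounds, a list is read by comparing the counter with
  its length; this is complete for lists of length at most \<open>n\<close>.\<close>

definition termC :: cmd where
  "termC = In 0 ;; Set 9 (Var 0) ;;
     For 5 (If (ltE (Var 5) (Var 9)) (In 0 ;; P1 1 (Var 0) (Op Plus (Var 4) (Num 1))) Nop)"

definition termsC :: cmd where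
  "termsC = In 0 ;; Set 8 (Var 0) ;; For 4 (If (ltE (Var 4) (Var 8)) termC Nop)"

lemma wr_termC: "wr_reg termC = {0, 5, 9}" "wr_arr termC = {1}" "\<not> writes termC" "wf termC"
  by (auto simp: termC_def)

lemma wr_termsC: "wr_reg termsC = {0, 4, 5, 8, 9}" "wr_arr termsC = {1}" "\<not> writes termsC" "wf termsC"
  by (auto simp: termsC_def wr_termC)

lemma den_termC:
  assumes ip: "ip s = length xs # xs @ ys" and len: "length xs \<le> rg s 2"
  shows "rd (den termC s) 1 v = (if v \<in> set xs then Suc (rg s 4) else rd s 1 v)"
    "ip (den termC s) = ys"
proof -
  let ?c = "If (ltE (Var 5) (Var 9)) (In 0 ;; P1 1 (Var 0) (Op Plus (Var 4) (Num 1))) Nop"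
  define m where "m = length xs"
  define s1 where "s1 = den (Set 9 (Var 0)) (den (In 0) s)"
  have s1: "rg s1 9 = m" "rg s1 2 = rg s 2" "rg s1 4 = rg s 4" "ip s1 = xs @ ys" "ar s1 = ar s"
    using ip by (simp_all add: s1_def m_def)
  let ?I = "\<lambda>i t. ip t = drop i xs @ ys \<and>
     (\<forall>v. rd t 1 v = (if v \<in> set (take i xs) then Suc (rg s 4) else rd s 1 v))"
  have "?I (rg s1 2) (den (For 5 ?c) s1)"
  proof (rule For_rule[where I = ?I])
    fix i t assume i: "i < rg s1 2" and I: "?I i t" and t: "same (For 5 ?c) s1 t" "rg t 5 = i"
    have t': "rg t 9 = m" "rg t 4 = rg s 4"
      using same_rg[OF t(1), of 9] same_rg[OF t(1), of 4] s1 by simp_all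
    show "?I (Suc i) (den ?c t)"
    proof (cases "i < m")
      case True
      then have "ip t = xs ! i # drop (Suc i) xs @ ys" "take (Suc i) xs = take i xs @ [xs ! i]"
        using I by (simp_all add: m_def Cons_nth_drop_Suc[symmetric] take_Suc_conv_app_nth)
      then show ?thesis using I t' t True by auto
    next
      case False
      then show ?thesis using I t' t by (simp add: m_def)
    qed
  qed (use s1 in auto)
  then have "?I (rg s 2) (den termC s)" unfolding termC_def den.simps(5) s1_def[symmetric] s1 .
  then show "rd (den termC s) 1 v = (if v \<in> set xs then Suc (rg s 4) else rd s 1 v)"
    "ip (den termC s) = ys"
    using len by simp_all
qed

lemma den_termsC:
  assumes ip: "ip s = encode_lists (\<lambda>v. [v]) ts" and s0: "\<And>v. rd s 1 v = 0"
    and len: "length ts \<le> rg s 2" "\<And>t. t \<in> set ts \<Longrightarrow> length t \<le> rg s 2"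
    and disj: "\<And>i j v. i < length ts \<Longrightarrow> j < length ts \<Longrightarrow> v \<in> set (ts ! i) \<Longrightarrow> v \<in> set (ts ! j) \<Longrightarrow> i = j"
  shows "rd (den termsC s) 1 v = Suc k \<longleftrightarrow> k < length ts \<and> v \<in> set (ts ! k)"
proof -
  let ?c = "If (ltE (Var 4) (Var 8)) termC Nop"
  define m where "m = length ts"
  let ?enc = "\<lambda>xs. length xs # xs"
  define s1 where "s1 = den (Set 8 (Var 0)) (den (In 0) s)"
  have ip': "ip s = m # concat (map ?enc ts)"
    using ip by (simp add: encode_lists_def m_def)
  have s1: "rg s1 8 = m" "rg s1 2 = rg s 2" "ip s1 = concat (map ?enc ts)" "ar s1 = ar s"
    using ip' by (simp_all add: s1_def m_def)
  let ?I = "\<lambda>i t. ip t = concat (map ?enc (drop i ts)) \<and>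
     (\<forall>v k. rd t 1 v = Suc k \<longleftrightarrow> k < i \<and> k < m \<and> v \<in> set (ts ! k))"
  have "?I (rg s1 2) (den (For 4 ?c) s1)"
  proof (rule For_rule[where I = ?I])
    fix i t assume i: "i < rg s1 2" and I: "?I i t" and t: "same (For 4 ?c) s1 t" "rg t 4 = i"
    have t': "rg t 8 = m" "rg t 2 = rg s 2"
      using same_rg[OF t(1), of 8] same_rg[OF t(1), of 2] s1 by (simp_all add: wr_termC)
    show "?I (Suc i) (den ?c t)"
    proof (cases "i < m")
      case True
      have "ip t = length (ts ! i) # ts ! i @ concat (map ?enc (drop (Suc i) ts))"
        using I True by (simp add: m_def Cons_nth_drop_Suc[symmetric])
      moreover have "length (ts ! i) \<le> rg t 2" using len(2) True t' by (simp add: m_def)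
      ultimately have d: "\<And>v. rd (den termC t) 1 v = (if v \<in> set (ts ! i) then Suc i else rd t 1 v)"
        "ip (den termC t) = concat (map ?enc (drop (Suc i) ts))"
        using den_termC[of t "ts ! i"] t by auto
      have "rd (den termC t) 1 v = Suc k \<longleftrightarrow> k < Suc i \<and> k < m \<and> v \<in> set (ts ! k)" for v k
      proof (cases "v \<in> set (ts ! i)")
        case True
        then show ?thesis using d disj[of k i v] \<open>i < m\<close> by (auto simp: m_def)
      next
        case False
        then show ?thesis using d I by (auto simp: less_Suc_eq)
      qed
      then show ?thesis using d t' t True by simp
    next
      case False
      then show ?thesis using I t' t by (auto simp: m_def)
    qed
  qed (use s1 s0 in \<open>auto simp: wr_termC\<close>)
  then have "?I (rg s 2) (den termsC s)" unfolding termsC_def den.simps(5) s1_def[symmetric] s1 .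
  then show ?thesis using len(1) by (auto simp: m_def)
qed

subsection \<open>The primal-dual phase\<close>

definition stores_labelling :: "(nat \<Rightarrow> nat) \<Rightarrow> st \<Rightarrow> bool" where
  "stores_labelling L s \<longleftrightarrow> (\<forall>x<rg s 2. rd s 2 x = L x)"

lemma stores_labellingD: "stores_labelling L s \<Longrightarrow> x < rg s 2 \<Longrightarrow> rd s 2 x = L x"
  by (simp add: stores_labelling_def)

definition initC :: cmd where
  "initC = For 4 (P1 2 (Var 4) (Var 4))"

lemma wr_initC: "wr_reg initC = {4}" "wr_arr initC = {2}" "\<not> reads initC" "\<not> writes initC" "wf initC"
  by (auto simp: initC_def)

lemma den_initC: "stores_labelling id (den initC s)"
proof -
  have "\<forall>x<rg s 2. rd (den initC s) 2 x = x" unfolding initC_def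
  proof (rule For_rule[where I = "\<lambda>i t. \<forall>x<i. rd t 2 x = x"])
    fix i t assume "\<forall>x<i. rd t 2 x = x" "rg t 4 = i"
    then show "\<forall>x<Suc i. rd (den (P1 2 (Var 4) (Var 4)) t) 2 x = x" by (auto simp: less_Suc_eq)
  qed auto
  then show ?thesis by (simp add: stores_labelling_def rg_den wr_initC)
qed

text \<open>Both labels are saved before the loop, since the loop overwrites the label of the first
  end.\<close>

definition mergeC :: cmd where
  "mergeC = Set 22 (A1 2 (Var 20)) ;; Set 23 (A1 2 (Var 21)) ;;
     For 24 (If (eqE (A1 2 (Var 24)) (Var 22)) (P1 2 (Var 24) (Var 23)) Nop)"

lemma wr_mergeC: "wr_reg mergeC = {22, 23, 24}" "wr_arr mergeC = {2}" "\<not> reads mergeC" "\<not> writes mergeC" "wf mergeC"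
  by (auto simp: mergeC_def)

lemma den_mergeC:
  assumes L: "stores_labelling L s" and uv: "rg s 20 < rg s 2" "rg s 21 < rg s 2"
  shows "stores_labelling (merge_label L (rg s 20, rg s 21)) (den mergeC s)"
proof -
  let ?e = "(rg s 20, rg s 21)"
  let ?c = "If (eqE (A1 2 (Var 24)) (Var 22)) (P1 2 (Var 24) (Var 23)) Nop"
  define s1 where "s1 = den (Set 23 (A1 2 (Var 21))) (den (Set 22 (A1 2 (Var 20))) s)"
  have s1: "rg s1 2 = rg s 2" "rg s1 22 = L (rg s 20)" "rg s1 23 = L (rg s 21)" "ar s1 = ar s"
    using stores_labellingD[OF L] uv by (simp_all add: s1_def)
  let ?I = "\<lambda>i t. \<forall>x<rg s 2. rd t 2 x = (if x < i then merge_label L ?e x else L x)"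
  have "?I (rg s1 2) (den (For 24 ?c) s1)"
  proof (rule For_rule[where I = ?I])
    fix i t assume i: "i < rg s1 2" and I: "?I i t" and t: "same (For 24 ?c) s1 t" "rg t 24 = i"
    have "rg t 22 = L (rg s 20)" "rg t 23 = L (rg s 21)"
      using same_rg[OF t(1), of 22] same_rg[OF t(1), of 23] s1 by simp_all
    then show "?I (Suc i) (den ?c t)" using I t i s1 by (auto simp: merge_label_def less_Suc_eq)
  qed (use L s1 in \<open>auto simp: stores_labelling_def\<close>)
  then have "?I (rg s 2) (den mergeC s)" unfolding mergeC_def den.simps(5) s1_def[symmetric] s1 .
  then show ?thesis by (simp add: stores_labelling_def rg_den wr_mergeC)
qed

definition stores_terminals :: "nat set set \<Rightarrow> st \<Rightarrow> bool" where
  "stores_terminals \<T> s \<longleftrightarrow> (\<forall>u v. rd s 1 u \<noteq> 0 \<and> rd s 1 u = rd s 1 v \<longleftrightarrow> (\<exists>T\<in>\<T>. u \<in> T \<and> v \<in> T))"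

definition sepE :: hexp where
  "sepE = Op Times (A1 1 (Var 4)) (Op Times (eqE (A1 1 (Var 4)) (A1 1 (Var 5)))
     (neE (A1 2 (Var 4)) (A1 2 (Var 5))))"

lemma ev_sepE:
  assumes "stores_terminals \<T> t" "stores_labelling L t" "rg t 4 < rg t 2" "rg t 5 < rg t 2"
  shows "ev t sepE \<noteq> 0 \<longleftrightarrow> (\<exists>T\<in>\<T>. rg t 4 \<in> T \<and> rg t 5 \<in> T) \<and> L (rg t 4) \<noteq> L (rg t 5)"
proof -
  have "ev t sepE \<noteq> 0 \<longleftrightarrow> (rd t 1 (rg t 4) \<noteq> 0 \<and> rd t 1 (rg t 4) = rd t 1 (rg t 5)) \<and>
      rd t 2 (rg t 4) \<noteq> rd t 2 (rg t 5)"
    by (auto simp: sepE_def)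
  also have "\<dots> \<longleftrightarrow> (\<exists>T\<in>\<T>. rg t 4 \<in> T \<and> rg t 5 \<in> T) \<and> L (rg t 4) \<noteq> L (rg t 5)"
    using assms(1)[unfolded stores_terminals_def] stores_labellingD[OF assms(2)] assms(3,4) by presburger
  finally show ?thesis .
qed

lemma stores_terminals_cong: "ar t 1 = ar s 1 \<Longrightarrow> stores_terminals \<T> t = stores_terminals \<T> s"
  by (simp add: stores_terminals_def)

lemma stores_labelling_cong: "ar t 2 = ar s 2 \<Longrightarrow> rg t 2 = rg s 2 \<Longrightarrow> stores_labelling L t = stores_labelling L s"
  by (simp add: stores_labelling_def)

definition activeC :: cmd where
  "activeC = For 4 (P1 3 (Var 4) (Num 0)) ;; For 4 (For 5 (If sepE (P1 3 (A1 2 (Var 4)) (Num 1)) Nop))"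

lemma wr_activeC: "wr_reg activeC = {4, 5}" "wr_arr activeC = {3}" "\<not> reads activeC" "\<not> writes activeC" "wf activeC"
  by (auto simp: activeC_def)

lemma den_activeC:
  assumes stores_terminals: "stores_terminals \<T> s" and L: "stores_labelling L s" and T: "\<And>T. T \<in> \<T> \<Longrightarrow> T \<subseteq> {..<rg s 2}"
    and c: "c < rg s 2"
  shows "rd (den activeC s) 3 c = of_bool (active \<T> L c)"
proof -
  define s1 where "s1 = den (For 4 (P1 3 (Var 4) (Num 0))) s"
  have "\<forall>x<rg s 2. rd s1 3 x = 0" unfolding s1_def
  proof (rule For_rule[where I = "\<lambda>i t. \<forall>x<i. rd t 3 x = 0"])
    fix i t assume "\<forall>x<i. rd t 3 x = 0" "rg t 4 = i"
    then show "\<forall>x<Suc i. rd (den (P1 3 (Var 4) (Num 0)) t) 3 x = 0" by (auto simp: less_Suc_eq)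
  qed auto
  then have z: "\<And>x. x < rg s 2 \<Longrightarrow> rd s1 3 x = 0" by simp
  have s1: "rg s1 2 = rg s 2" "ar s1 1 = ar s 1" "ar s1 2 = ar s 2"
    using rg_den[of 2 "For 4 (P1 3 (Var 4) (Num 0))" s] ar_den[of 1 "For 4 (P1 3 (Var 4) (Num 0))" s]
      ar_den[of 2 "For 4 (P1 3 (Var 4) (Num 0))" s] by (simp_all add: s1_def del: den.simps)
  let ?c = "If sepE (P1 3 (A1 2 (Var 4)) (Num 1)) Nop"
  let ?Q = "\<lambda>c (u, v). (\<exists>T\<in>\<T>. u \<in> T \<and> v \<in> T) \<and> L u \<noteq> L v \<and> L u = c"
  let ?I = "\<lambda>P t. \<forall>c<rg s 2. rd t 3 c = of_bool (\<exists>x\<in>P. ?Q c x)"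
  have "?I ({..<rg s1 2} \<times> {..<rg s1 2}) (den (For 4 (For 5 ?c)) s1)"
  proof (rule For2_rule[where I = ?I])
    fix i j P t assume ij: "i < rg s1 2" "j < rg s1 2" and I: "?I P t"
      and t: "same (For 4 (For 5 ?c)) s1 t" and r: "rg t 4 = i" "rg t 5 = j"
    have t': "rg t 2 = rg s 2" "ar t 1 = ar s 1" "ar t 2 = ar s 2"
      using same_rg[OF t, of 2] same_ar[OF t, of 1] same_ar[OF t, of 2] s1 by simp_all
    have tt: "stores_terminals \<T> t" "stores_labelling L t" using stores_terminals L stores_terminals_cong[OF t'(2)] stores_labelling_cong[OF t'(3,1)] by simp_all
    have e: "ev t sepE \<noteq> 0 \<longleftrightarrow> (\<exists>T\<in>\<T>. i \<in> T \<and> j \<in> T) \<and> L i \<noteq> L j"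
      using ev_sepE[OF tt] r ij s1 t' by simp
    have Li: "rd t 2 i = L i" using stores_labellingD[OF tt(2)] ij s1 t' by simp
    show "?I (insert (i, j) P) (den ?c t)"
    proof (cases "ev t sepE = 0")
      case True
      then show ?thesis using I e by auto
    next
      case False
      then have "den ?c t = den (P1 3 (A1 2 (Var 4)) (Num 1)) t" by simp
      then show ?thesis using I e False r Li by (auto simp: fun_upd_def)
    qed
  qed (use z s1 in auto)
  then have "?I ({..<rg s 2} \<times> {..<rg s 2}) (den activeC s)"
    unfolding activeC_def den.simps(5) s1_def[symmetric] s1 .
  moreover have "(\<exists>x\<in>{..<rg s 2} \<times> {..<rg s 2}. ?Q c x) \<longleftrightarrow> active \<T> L c"
  proof
    assume "\<exists>x\<in>{..<rg s 2} \<times> {..<rg s 2}. ?Q c x"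
    then obtain u v T where "T \<in> \<T>" "u \<in> T" "v \<in> T" "L u \<noteq> L v" "L u = c" by blast
    then show "active \<T> L c" unfolding active_def by metis
  next
    assume "active \<T> L c"
    then obtain u v T where uv: "T \<in> \<T>" "u \<in> T" "v \<in> T" "L v \<noteq> c" "L u = c"
      unfolding active_def by blast
    then have "(u, v) \<in> {..<rg s 2} \<times> {..<rg s 2}" using T by blast
    moreover have "?Q c (u, v)" using uv by auto
    ultimately show "\<exists>x\<in>{..<rg s 2} \<times> {..<rg s 2}. ?Q c x" by blast
  qed
  ultimately show ?thesis using c by simp
qed

definition cntE :: hexp where
  "cntE = Op Times (neE (A1 2 (Var 4)) (A1 2 (Var 5)))
     (Op Plus (A1 3 (A1 2 (Var 4))) (A1 3 (A1 2 (Var 5))))"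

definition stores_active :: "nat set set \<Rightarrow> (nat \<Rightarrow> nat) \<Rightarrow> st \<Rightarrow> bool" where
  "stores_active \<T> L t \<longleftrightarrow> stores_labelling L t \<and> (\<forall>c<rg t 2. rd t 3 c = of_bool (active \<T> L c)) \<and> (\<forall>x<rg t 2. L x < rg t 2)"

lemma ev_cntE:
  assumes "stores_active \<T> L t" "rg t 4 < rg t 2" "rg t 5 < rg t 2"
  shows "ev t cntE = active_ends \<T> L (rg t 4) (rg t 5)"
  using assms by (simp add: stores_active_def stores_labelling_def cntE_def active_ends_def)

lemma stores_active_cong: "ar t 2 = ar s 2 \<Longrightarrow> ar t 3 = ar s 3 \<Longrightarrow> rg t 2 = rg s 2 \<Longrightarrow> stores_active \<T> L t = stores_active \<T> L s"
  by (simp add: stores_active_def stores_labelling_def)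

abbreviation WE :: hexp where "WE \<equiv> Arr 0 (Var 4) (Var 5)"

text \<open>The sum in the inner test is a disjunction: no candidate yet, or a smaller charge than
  the best one found.\<close>

definition bestC :: cmd where
  "bestC = If cntE (Set 16 (Op Div (Op Plus WE WE) cntE) ;;
     If (Op Plus (eqE (Var 12) (Num 0)) (ltE (Var 16) (Var 13)))
       (Set 12 (Num 1) ;; Set 13 (Var 16) ;; Set 20 (Var 4) ;; Set 21 (Var 5)) Nop) Nop"

definition findC :: cmd where
  "findC = Set 12 (Num 0) ;; For 4 (For 5 bestC)"

lemma wr_bestC: "wr_reg bestC = {12, 13, 16, 20, 21}" "wr_arr bestC = {}" "\<not> reads bestC" "\<not> writes bestC" "wf bestC"
  by (auto simp: bestC_def)

lemma wr_findC: "wr_reg findC = {4, 5, 12, 13, 16, 20, 21}" "wr_arr findC = {}" "\<not> reads findC" "\<not> writes findC" "wf findC"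
  by (auto simp: findC_def wr_bestC)

lemma den_bestC:
  assumes "stores_active \<T> L t" "rg t 4 < rg t 2" "rg t 5 < rg t 2"
  defines "c \<equiv> active_ends \<T> L (rg t 4) (rg t 5)"
  defines "key \<equiv> (ar t 0 (rg t 4) (rg t 5) + ar t 0 (rg t 4) (rg t 5)) div c"
  defines "t' \<equiv> den bestC t"
  shows "c \<noteq> 0 \<and> (rg t 12 = 0 \<or> key < rg t 13) \<Longrightarrow>
      rg t' 12 = 1 \<and> rg t' 13 = key \<and> rg t' 20 = rg t 4 \<and> rg t' 21 = rg t 5"
    and "\<not> (c \<noteq> 0 \<and> (rg t 12 = 0 \<or> key < rg t 13)) \<Longrightarrow>
      rg t' 12 = rg t 12 \<and> rg t' 13 = rg t 13 \<and> rg t' 20 = rg t 20 \<and> rg t' 21 = rg t 21"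
  unfolding t'_def bestC_def
  using ev_cntE[OF assms(1-3)] by (auto simp: c_def key_def)

lemma den_findC:
  assumes r: "stores_active \<T> L s"
  defines "c \<equiv> active_ends \<T> L" and "key \<equiv> \<lambda>u v. (ar s 0 u v + ar s 0 u v) div active_ends \<T> L u v"
  defines "t \<equiv> den findC s" and "n \<equiv> rg s 2"
  shows "rg t 12 = 0 \<and> (\<forall>u<n. \<forall>v<n. c u v = 0) \<or>
    rg t 12 = 1 \<and> rg t 20 < n \<and> rg t 21 < n \<and> c (rg t 20) (rg t 21) \<noteq> 0 \<and>
    rg t 13 = key (rg t 20) (rg t 21) \<and> (\<forall>u<n. \<forall>v<n. c u v \<noteq> 0 \<longrightarrow> rg t 13 \<le> key u v)"
proof -
  define s1 where "s1 = den (Set 12 (Num 0)) s"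
  have s1: "rg s1 2 = n" "ar s1 = ar s" "rg s1 12 = 0" by (simp_all add: s1_def n_def)
  let ?I = "\<lambda>P t. P \<subseteq> {..<n} \<times> {..<n} \<and> (rg t 12 = 0 \<and> (\<forall>(u, v)\<in>P. c u v = 0) \<or>
    rg t 12 = 1 \<and> (rg t 20, rg t 21) \<in> P \<and> c (rg t 20) (rg t 21) \<noteq> 0 \<and>
    rg t 13 = key (rg t 20) (rg t 21) \<and> (\<forall>(u, v)\<in>P. c u v \<noteq> 0 \<longrightarrow> rg t 13 \<le> key u v))"
  have "?I ({..<rg s1 2} \<times> {..<rg s1 2}) (den (For 4 (For 5 bestC)) s1)"
  proof (rule For2_rule[where I = ?I])
    fix i j P t assume ij: "i < rg s1 2" "j < rg s1 2" and I: "?I P t"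
      and t: "same (For 4 (For 5 bestC)) s1 t" and rr: "rg t 4 = i" "rg t 5 = j"
    have t': "rg t 2 = n" "ar t 0 = ar s 0" "ar t 2 = ar s 2" "ar t 3 = ar s 3"
      using same_rg[OF t, of 2] same_ar[OF t, of 0] same_ar[OF t, of 2] same_ar[OF t, of 3] s1
      by (simp_all add: wr_bestC)
    have rt: "stores_active \<T> L t" using r stores_active_cong[OF t'(3,4)] t' by (simp add: n_def)
    note b = den_bestC[OF rt, unfolded rr t' c_def[symmetric]]
    have lt: "i < n" "j < n" using ij s1 by auto
    have k: "(ar s 0 i j + ar s 0 i j) div c i j = key i j" by (simp add: key_def c_def)
    show "?I (insert (i, j) P) (den bestC t)"
    proof (cases "c i j \<noteq> 0 \<and> (rg t 12 = 0 \<or> key i j < rg t 13)")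
      case True
      then show ?thesis using b(1)[OF lt] I lt unfolding k by auto
    next
      case False
      then show ?thesis using b(2)[OF lt] I lt unfolding k by auto
    qed
  qed (use s1 in \<open>auto simp: wr_bestC\<close>)
  then have "?I ({..<n} \<times> {..<n}) t"
    unfolding t_def findC_def den.simps(5) s1_def[symmetric] s1 .
  then show ?thesis by auto
qed

text \<open>The product of two computed numbers occurs only as a subtrahend and thus cannot lengthen
  the stored value.\<close>

definition updateC :: cmd where
  "updateC = For 4 (For 5 (Put 0 (Var 4) (Var 5) (Op Minus (Op Plus WE WE) (Op Times (Var 13) cntE))))"

lemma wr_updateC: "wr_reg updateC = {4, 5}" "wr_arr updateC = {0}" "\<not> reads updateC" "\<not> writes updateC" "wf updateC"
  by (auto simp: updateC_def)

lemma den_updateC: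
  assumes r: "stores_active \<T> L s" and uv: "u < rg s 2" "v < rg s 2"
  shows "ar (den updateC s) 0 u v = ar s 0 u v + ar s 0 u v - rg s 13 * active_ends \<T> L u v"
proof -
  let ?c = "Put 0 (Var 4) (Var 5) (Op Minus (Op Plus WE WE) (Op Times (Var 13) cntE))"
  let ?I = "\<lambda>P t. \<forall>u v. ar t 0 u v =
      (if (u, v) \<in> P then ar s 0 u v + ar s 0 u v - rg s 13 * active_ends \<T> L u v else ar s 0 u v)"
  have "?I ({..<rg s 2} \<times> {..<rg s 2}) (den updateC s)"
    unfolding updateC_def
  proof (rule For2_rule[where I = ?I])
    fix i j P t assume ij: "i < rg s 2" "j < rg s 2" "(i, j) \<notin> P" and I: "?I P t"
      and t: "same (For 4 (For 5 ?c)) s t" and rr: "rg t 4 = i" "rg t 5 = j"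
    have t': "rg t 2 = rg s 2" "rg t 13 = rg s 13" "ar t 2 = ar s 2" "ar t 3 = ar s 3"
      using same_rg[OF t, of 2] same_rg[OF t, of 13] same_ar[OF t, of 2] same_ar[OF t, of 3] by simp_all
    have rt: "stores_active \<T> L t" using r stores_active_cong[OF t'(3,4,1)] by simp
    have e: "ev t cntE = active_ends \<T> L i j" using ev_cntE[OF rt] rr ij t' by simp
    have w: "ar t 0 i j = ar s 0 i j" using I ij by simp
    show "?I (insert (i, j) P) (den ?c t)"
      using I ij(3) by (auto simp: rr e w t')
  qed auto
  then show ?thesis using uv by simp
qed

definition edge_at :: "st \<Rightarrow> nat \<Rightarrow> nat \<times> nat" where
  "edge_at s i = (rd s 4 i, rd s 5 i)"

text \<open>The merging comes last, because the update has to charge the classes that exist before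
  the insertion.\<close>

definition stepC :: cmd where
  "stepC = activeC ;; findC ;;
     If (Var 12) (updateC ;; P1 4 (Var 11) (Var 20) ;; P1 5 (Var 11) (Var 21) ;; mergeC) Nop"

lemma wr_stepC: "wr_reg stepC = {4, 5, 12, 13, 16, 20, 21, 22, 23, 24}" "wr_arr stepC = {0, 2, 3, 4, 5}"
    "\<not> reads stepC" "\<not> writes stepC" "wf stepC"
  by (auto simp: stepC_def wr_activeC wr_findC wr_updateC wr_mergeC)

text \<open>Entries not yet written read \<open>(0, 0)\<close>, so an idle round records the dummy
  edge without doing anything.\<close>

definition grown :: "(nat set \<Rightarrow> rat) \<Rightarrow> nat set set \<Rightarrow> nat \<Rightarrow> st \<Rightarrow> bool" where
  "grown w \<T> m s \<longleftrightarrow> dual_inv (rg s 2) w \<T> m (edge_at s) (ar s 0) \<and>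
     stores_labelling (labelling id (edge_at s) UNIV m) s \<and> (\<forall>i\<ge>m. edge_at s i = (0, 0))"

lemma den_stepC:
  assumes g: "grown w \<T> m s" and stores_terminals: "stores_terminals \<T> s" and T: "\<And>T. T \<in> \<T> \<Longrightarrow> T \<subseteq> {..<rg s 2}"
    and m: "rg s 11 = m" "m < rg s 2"
  shows "grown w \<T> (Suc m) (den stepC s)"
proof -
  define n where "n = rg s 2"
  define L where "L = labelling id (edge_at s) UNIV m"
  have inv: "dual_inv n w \<T> m (edge_at s) (ar s 0)" and Ls: "stores_labelling L s" and zero: "\<And>i. i \<ge> m \<Longrightarrow> edge_at s i = (0, 0)"
    using g by (auto simp: grown_def n_def L_def)
  have "\<forall>i<m. fst (edge_at s i) < n \<and> snd (edge_at s i) < n" using inv unfolding dual_inv_def by blast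
  then have Ln: "L x < n" if "x < n" for x
    unfolding L_def by (intro labelling_less) (use that in auto)
  define s1 where "s1 = den activeC s"
  have s1: "rg s1 2 = n" "rg s1 11 = m" "ar s1 0 = ar s 0" "ar s1 1 = ar s 1" "ar s1 2 = ar s 2"
    "ar s1 4 = ar s 4" "ar s1 5 = ar s 5"
    using m by (simp_all add: s1_def n_def rg_den ar_den wr_activeC)
  have r1: "stores_active \<T> L s1" unfolding stores_active_def s1(1)
  proof (intro conjI allI impI)
    show "stores_labelling L s1" using Ls stores_labelling_cong[OF s1(5)] s1(1) by (simp add: n_def)
    show "rd s1 3 c = of_bool (active \<T> L c)" if "c < n" for c
      unfolding s1_def using den_activeC[OF stores_terminals Ls T] that by (simp add: n_def)
  qed (rule Ln)
  define s2 where "s2 = den findC s1"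
  have s2: "rg s2 2 = n" "rg s2 11 = m" "ar s2 = ar s1"
    using s1 by (simp_all add: s2_def rg_den wr_findC) (rule ext, simp add: ar_den wr_findC)
  have r2: "stores_active \<T> L s2" using r1 stores_active_cong[of s2 s1] s1 s2 by simp
  note f = den_findC[OF r1, folded s2_def, unfolded s1]
  have d: "den stepC s = (if rg s2 12 \<noteq> 0 then den mergeC (den (P1 5 (Var 11) (Var 21))
      (den (P1 4 (Var 11) (Var 20)) (den updateC s2))) else s2)"
    by (simp add: stepC_def s1_def s2_def)
  show ?thesis
  proof (cases "rg s2 12 = 0")
    case True
    then have d: "den stepC s = s2" by (simp add: d)
    have el: "edge_at s2 = edge_at s" using s1 s2 by (auto simp: edge_at_def fun_eq_iff)
    have none: "active_ends \<T> L u v = 0" if "u < n" "v < n" for u v using f True that by auto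
    have "dual_inv n w \<T> (Suc m) (edge_at s) (ar s 0)"
    proof (rule dual_inv_skip[OF inv])
      show "T \<subseteq> {..<n}" if "T \<in> \<T>" for T using T[OF that] by (simp add: n_def)
      show "edge_at s m = (0, 0)" using zero by simp
      show "0 < n" using m by (simp add: n_def)
    qed (use none in \<open>simp add: L_def\<close>)
    moreover have "labelling id (edge_at s) UNIV (Suc m) = L"
      using zero[of m] by (simp add: L_def merge_label_same)
    moreover have "stores_labelling L s2" using r2 by (simp add: stores_active_def)
    ultimately show ?thesis unfolding d grown_def el using s1 s2 zero by simp
  next
    case False
    define a b where "a = rg s2 20" and "b = rg s2 21"
    have ab: "a < n" "b < n" "active_ends \<T> L a b \<noteq> 0"
      and best: "rg s2 13 = (ar s 0 a b + ar s 0 a b) div active_ends \<T> L a b"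
        "\<And>u v. u < n \<Longrightarrow> v < n \<Longrightarrow> active_ends \<T> L u v \<noteq> 0 \<Longrightarrow>
           rg s2 13 \<le> (ar s 0 u v + ar s 0 u v) div active_ends \<T> L u v"
      using f False by (auto simp: a_def b_def)
    define s3 where "s3 = den updateC s2"
    have s3: "rg s3 2 = n" "rg s3 11 = m" "rg s3 20 = a" "rg s3 21 = b" "ar s3 2 = ar s 2"
      "ar s3 4 = ar s 4" "ar s3 5 = ar s 5"
      using s1 s2 by (simp_all add: s3_def rg_den ar_den wr_updateC a_def b_def)
    have W3: "ar s3 0 u v = ar s 0 u v + ar s 0 u v - rg s2 13 * active_ends \<T> L u v" if "u < n" "v < n" for u v
      using den_updateC[OF r2] that s1 s2 by (simp add: s3_def)
    define s4 where "s4 = den (P1 5 (Var 11) (Var 21)) (den (P1 4 (Var 11) (Var 20)) s3)"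
    have s4: "rg s4 2 = n" "rg s4 20 = a" "rg s4 21 = b" "ar s4 2 = ar s 2" "ar s4 0 = ar s3 0"
      using s3 by (simp_all add: s4_def)
    have el4: "edge_at s4 = (edge_at s)(m := (a, b))"
      using s3 by (auto simp: s4_def edge_at_def fun_eq_iff)
    define s5 where "s5 = den mergeC s4"
    have s5: "rg s5 2 = n" "ar s5 0 = ar s3 0" "edge_at s5 = (edge_at s)(m := (a, b))"
      using s4 el4 by (simp_all add: s5_def rg_den ar_den wr_mergeC edge_at_def fun_eq_iff)
    have lb4: "stores_labelling L s4" using Ls stores_labelling_cong[OF s4(4)] s4 by (simp add: n_def)
    have "stores_labelling (merge_label L (a, b)) s5"
      using den_mergeC[OF lb4] s4 ab by (simp add: s5_def)
    moreover have "labelling id ((edge_at s)(m := (a, b))) UNIV (Suc m) = merge_label L (a, b)"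
    proof -
      have "labelling id ((edge_at s)(m := (a, b))) UNIV m = L" unfolding L_def by (rule labelling_cong) auto
      then show ?thesis by simp
    qed
    moreover have "dual_inv n w \<T> (Suc m) ((edge_at s)(m := (a, b))) (ar s3 0)"
      by (rule dual_inv_step[OF inv, folded L_def, OF ab best(1) best(2) W3]) auto
    moreover have "den stepC s = s5" using False by (simp add: d s5_def s4_def s3_def)
    ultimately show ?thesis unfolding grown_def using s5 zero by (auto simp del: labelling.simps)
  qed
qed

definition growC :: cmd where
  "growC = initC ;; For 11 stepC"

lemma wr_growC: "wr_reg growC = {4, 5, 11, 12, 13, 16, 20, 21, 22, 23, 24}" "wr_arr growC = {0, 2, 3, 4, 5}"
    "\<not> reads growC" "\<not> writes growC" "wf growC"
  by (auto simp: growC_def wr_initC wr_stepC)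

lemma den_growC:
  assumes sc: "scaled (\<lambda>u v. True) w s" and stores_terminals: "stores_terminals \<T> s"
    and T: "\<And>T. T \<in> \<T> \<Longrightarrow> T \<subseteq> {..<rg s 2}" and z: "\<And>i. edge_at s i = (0, 0)"
  shows "grown w \<T> (rg s 2) (den growC s)"
proof -
  define s1 where "s1 = den initC s"
  have s1: "rg s1 2 = rg s 2" "ar s1 0 = ar s 0" "ar s1 1 = ar s 1" "edge_at s1 = edge_at s"
    by (simp_all add: s1_def rg_den ar_den wr_initC edge_at_def fun_eq_iff)
  have "grown w \<T> (rg s1 2) (den (For 11 stepC) s1)"
  proof (rule For_rule[where I = "grown w \<T>"])
    have "dual_inv (rg s 2) w \<T> 0 (edge_at s1) (ar s 0)"
      by (rule dual_inv_0[of _ _ "of_nat (rg s 3)"]) (use sc in \<open>auto simp: scaled_def\<close>)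
    then show "grown w \<T> 0 s1"
      using den_initC[of s] z by (simp add: grown_def s1 s1_def[symmetric])
  next
    show "grown w \<T> i (t\<lparr>rg := (rg t)(11 := x)\<rparr>)" if "grown w \<T> i t" for i t x
      using that by (simp add: grown_def edge_at_def[abs_def] stores_labelling_def)
  next
    fix i t assume i: "i < rg s1 2" "grown w \<T> i t" and t: "same (For 11 stepC) s1 t" "rg t 11 = i"
    have t': "rg t 2 = rg s 2" "ar t 1 = ar s 1"
      using same_rg[OF t(1), of 2] same_ar[OF t(1), of 1] s1 by (simp_all add: wr_stepC)
    show "grown w \<T> (Suc i) (den stepC t)"
      by (rule den_stepC[OF i(2)]) (use stores_terminals stores_terminals_cong[OF t'(2)] T t t' i s1 in auto)
  qed (auto simp: wr_stepC)
  then show ?thesis unfolding growC_def den.simps(5) s1_def[symmetric] s1 .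
qed

subsection \<open>Pruning\<close>

definition kept :: "st \<Rightarrow> nat set" where
  "kept s = {i. rd s 6 i \<noteq> 0}"

definition labelsC :: cmd where
  "labelsC = initC ;; For 25 (If (A1 6 (Var 25))
     (Set 20 (A1 4 (Var 25)) ;; Set 21 (A1 5 (Var 25)) ;; mergeC) Nop)"

lemma wr_labelsC: "wr_reg labelsC = {4, 20, 21, 22, 23, 24, 25}" "wr_arr labelsC = {2}"
    "\<not> reads labelsC" "\<not> writes labelsC" "wf labelsC"
  by (auto simp: labelsC_def wr_initC wr_mergeC)

lemma den_labelsC:
  assumes E: "\<And>i. i < rg s 2 \<Longrightarrow> fst (edge_at s i) < rg s 2 \<and> snd (edge_at s i) < rg s 2"
  shows "stores_labelling (labelling id (edge_at s) (kept s) (rg s 2)) (den labelsC s)"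
proof -
  let ?c = "If (A1 6 (Var 25)) (Set 20 (A1 4 (Var 25)) ;; Set 21 (A1 5 (Var 25)) ;; mergeC) Nop"
  define s1 where "s1 = den initC s"
  have s1: "rg s1 2 = rg s 2" "ar s1 4 = ar s 4" "ar s1 5 = ar s 5" "ar s1 6 = ar s 6"
    by (simp_all add: s1_def rg_den ar_den wr_initC)
  let ?I = "\<lambda>i t. stores_labelling (labelling id (edge_at s) (kept s) i) t"
  have "?I (rg s1 2) (den (For 25 ?c) s1)"
  proof (rule For_rule[where I = ?I])
    show "?I 0 s1" using den_initC[of s] by (simp add: s1_def)
  next
    fix i t assume i: "i < rg s1 2" and I: "?I i t" and t: "same (For 25 ?c) s1 t" "rg t 25 = i"
    have t': "rg t 2 = rg s 2" "ar t 4 = ar s 4" "ar t 5 = ar s 5" "ar t 6 = ar s 6"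
      using same_rg[OF t(1), of 2] same_ar[OF t(1), of 4] same_ar[OF t(1), of 5] same_ar[OF t(1), of 6] s1
      by (simp_all add: wr_mergeC)
    show "?I (Suc i) (den ?c t)"
    proof (cases "i \<in> kept s")
      case True
      define t1 where "t1 = den (Set 21 (A1 5 (Var 25))) (den (Set 20 (A1 4 (Var 25))) t)"
      have t1: "rg t1 20 = fst (edge_at s i)" "rg t1 21 = snd (edge_at s i)" "rg t1 2 = rg s 2" "ar t1 = ar t"
        using t t' by (simp_all add: t1_def edge_at_def)
      have "stores_labelling (labelling id (edge_at s) (kept s) i) t1" using I stores_labelling_cong[of t1 t] t1 t' by simp
      then have "stores_labelling (merge_label (labelling id (edge_at s) (kept s) i) (rg t1 20, rg t1 21)) (den mergeC t1)"
        by (rule den_mergeC) (use E i s1 t1 in auto)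
      moreover have "den ?c t = den mergeC t1" using True t t' by (simp add: kept_def t1_def)
      moreover have "labelling id (edge_at s) (kept s) (Suc i) =
          merge_label (labelling id (edge_at s) (kept s) i) (rg t1 20, rg t1 21)" using True by (simp add: t1)
      ultimately show ?thesis by (simp only:)
    next
      case False
      then have "den ?c t = t" using t t' by (simp add: kept_def)
      moreover have "labelling id (edge_at s) (kept s) (Suc i) = labelling id (edge_at s) (kept s) i" using False by simp
      ultimately show ?thesis using I by (simp only:)
    qed
  qed (auto simp: wr_mergeC stores_labelling_def)
  then show ?thesis unfolding labelsC_def den.simps(5) s1_def[symmetric] s1 .
qed

definition checkC :: cmd where
  "checkC = Set 12 (Num 0) ;; For 4 (For 5 (If sepE (Set 12 (Num 1)) Nop))"

lemma wr_checkC: "wr_reg checkC = {4, 5, 12}" "wr_arr checkC = {}" "\<not> reads checkC" "\<not> writes checkC" "wf checkC"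
  by (auto simp: checkC_def)

lemma den_checkC:
  assumes stores_terminals: "stores_terminals \<T> s" and L: "stores_labelling L s" and T: "\<And>T. T \<in> \<T> \<Longrightarrow> T \<subseteq> {..<rg s 2}"
  shows "rg (den checkC s) 12 \<noteq> 0 \<longleftrightarrow> \<not> feasible \<T> L"
proof -
  define s1 where "s1 = den (Set 12 (Num 0)) s"
  have s1: "rg s1 2 = rg s 2" "ar s1 = ar s" "rg s1 12 = 0" by (simp_all add: s1_def)
  let ?c = "If sepE (Set 12 (Num 1)) Nop"
  let ?Q = "\<lambda>(u, v). (\<exists>T\<in>\<T>. u \<in> T \<and> v \<in> T) \<and> L u \<noteq> L v"
  let ?I = "\<lambda>P t. rg t 12 \<noteq> 0 \<longleftrightarrow> (\<exists>x\<in>P. ?Q x)"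
  have "?I ({..<rg s1 2} \<times> {..<rg s1 2}) (den (For 4 (For 5 ?c)) s1)"
  proof (rule For2_rule[where I = ?I])
    fix i j P t assume ij: "i < rg s1 2" "j < rg s1 2" and I: "?I P t"
      and t: "same (For 4 (For 5 ?c)) s1 t" and r: "rg t 4 = i" "rg t 5 = j"
    have t': "rg t 2 = rg s 2" "ar t 1 = ar s 1" "ar t 2 = ar s 2"
      using same_rg[OF t, of 2] same_ar[OF t, of 1] same_ar[OF t, of 2] s1 by simp_all
    have tt: "stores_terminals \<T> t" "stores_labelling L t" using stores_terminals L stores_terminals_cong[OF t'(2)] stores_labelling_cong[OF t'(3,1)] by simp_all
    have e: "ev t sepE \<noteq> 0 \<longleftrightarrow> ?Q (i, j)"
      using ev_sepE[OF tt] r ij s1 t' by simp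
    have "rg (den ?c t) 12 \<noteq> 0 \<longleftrightarrow> ev t sepE \<noteq> 0 \<or> rg t 12 \<noteq> 0" by simp
    then show "?I (insert (i, j) P) (den ?c t)" unfolding e I bex_simps(5) .
  qed (use s1 in auto)
  then have "?I ({..<rg s 2} \<times> {..<rg s 2}) (den checkC s)"
    unfolding checkC_def den.simps(5) s1_def[symmetric] s1 .
  moreover have "(\<exists>x\<in>{..<rg s 2} \<times> {..<rg s 2}. ?Q x) \<longleftrightarrow> \<not> feasible \<T> L"
  proof
    assume "\<not> feasible \<T> L"
    then obtain T u v where uv: "T \<in> \<T>" "u \<in> T" "v \<in> T" "L u \<noteq> L v" unfolding feasible_def by blast
    then have "(u, v) \<in> {..<rg s 2} \<times> {..<rg s 2}" using T by blast
    moreover have "?Q (u, v)" using uv by auto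
    ultimately show "\<exists>x\<in>{..<rg s 2} \<times> {..<rg s 2}. ?Q x" by blast
  qed (auto simp: feasible_def)
  ultimately show ?thesis by simp
qed

lemma feasible_mono:
  assumes "feasible \<T> (labelling id E K m)" "K \<subseteq> K'"
  shows "feasible \<T> (labelling id E K' m)"
proof -
  have "labelling id E K' m u = labelling id E K' m v" if "labelling id E K m u = labelling id E K m v" for u v
    using that by (rule labelling_mono[rotated]) (use assms(2) in auto)
  then show ?thesis using assms(1) unfolding feasible_def by blast
qed

definition tryC :: cmd where
  "tryC = P1 6 (Var 11) (Num 0) ;; labelsC ;; checkC ;; If (Var 12) (P1 6 (Var 11) (Num 1)) Nop"

lemma wr_tryC: "wr_reg tryC = {4, 5, 12, 20, 21, 22, 23, 24, 25}" "wr_arr tryC = {2, 6}"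
    "\<not> reads tryC" "\<not> writes tryC" "wf tryC"
  by (auto simp: tryC_def wr_labelsC wr_checkC)

lemma den_tryC:
  assumes stores_terminals: "stores_terminals \<T> s" and T: "\<And>T. T \<in> \<T> \<Longrightarrow> T \<subseteq> {..<rg s 2}"
    and E: "\<And>i. i < rg s 2 \<Longrightarrow> fst (edge_at s i) < rg s 2 \<and> snd (edge_at s i) < rg s 2"
  shows "kept (den tryC s) =
    (if feasible \<T> (labelling id (edge_at s) (kept s - {rg s 11}) (rg s 2)) then kept s - {rg s 11}
     else insert (rg s 11) (kept s))"
proof -
  define s1 where "s1 = den (P1 6 (Var 11) (Num 0)) s"
  have k1: "kept s1 = kept s - {rg s 11}" by (auto simp: s1_def kept_def)
  have s1: "rg s1 = rg s" "ar s1 1 = ar s 1" "edge_at s1 = edge_at s"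
    by (simp_all add: s1_def edge_at_def fun_eq_iff)
  define s2 where "s2 = den labelsC s1"
  have s2: "rg s2 2 = rg s 2" "rg s2 11 = rg s 11" "ar s2 1 = ar s 1" "ar s2 6 = ar s1 6"
    using s1 by (simp_all add: s2_def rg_den ar_den wr_labelsC)
  have lb2: "stores_labelling (labelling id (edge_at s) (kept s - {rg s 11}) (rg s 2)) s2"
    using den_labelsC[of s1] E by (simp add: s2_def s1 k1)
  have tids2: "stores_terminals \<T> s2" using stores_terminals stores_terminals_cong[OF s2(3)] by simp
  define s3 where "s3 = den checkC s2"
  have s3: "rg s3 12 \<noteq> 0 \<longleftrightarrow> \<not> feasible \<T> (labelling id (edge_at s) (kept s - {rg s 11}) (rg s 2))"
    unfolding s3_def by (rule den_checkC[OF tids2 lb2]) (use T s2 in auto)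
  have s3': "rg s3 11 = rg s 11" "ar s3 6 = ar s1 6"
    using s2 by (simp_all add: s3_def rg_den ar_den wr_checkC)
  have k3: "kept s3 = kept s - {rg s 11}" using k1 s3' by (simp add: kept_def)
  have "den tryC s = (if rg s3 12 \<noteq> 0 then den (P1 6 (Var 11) (Num 1)) s3 else s3)"
    by (simp add: tryC_def s1_def s2_def s3_def)
  moreover have "kept (den (P1 6 (Var 11) (Num 1)) s3) = insert (rg s3 11) (kept s3)"
    by (auto simp: kept_def)
  ultimately show ?thesis using s3 k3 s3' by auto
qed

text \<open>The labels are recomputed at the end, since the last trial may have left those of a set
  that turned out to be infeasible.\<close>

definition pruneC :: cmd where
  "pruneC = For 11 (P1 6 (Var 11) (Num 1)) ;; For 11 tryC ;; labelsC"

lemma wr_pruneC: "wr_reg pruneC = {4, 5, 11, 12, 20, 21, 22, 23, 24, 25}" "wr_arr pruneC = {2, 6}"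
    "\<not> reads pruneC" "\<not> writes pruneC" "wf pruneC"
  by (auto simp: pruneC_def wr_labelsC wr_tryC)

text \<open>One pass yields a minimal set: feasibility is monotone, so an edge that could not be
  dropped when it was tried cannot be dropped from the smaller final set either.\<close>

lemma den_pruneC:
  assumes stores_terminals: "stores_terminals \<T> s" and T: "\<And>T. T \<in> \<T> \<Longrightarrow> T \<subseteq> {..<n}" and n: "rg s 2 = n"
    and E: "\<And>i. i < n \<Longrightarrow> fst (edge_at s i) < n \<and> snd (edge_at s i) < n"
    and feas: "feasible \<T> (labelling id (edge_at s) UNIV n)" and z: "\<And>i. rd s 6 i = 0"
  defines "K \<equiv> kept (den pruneC s)"
  shows "K \<subseteq> {..<n}" "feasible \<T> (labelling id (edge_at s) K n)"
    "\<And>i. i \<in> K \<Longrightarrow> \<not> feasible \<T> (labelling id (edge_at s) (K - {i}) n)"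
    "stores_labelling (labelling id (edge_at s) K n) (den pruneC s)"
proof -
  define s1 where "s1 = den (For 11 (P1 6 (Var 11) (Num 1))) s"
  have "kept s1 = {..<rg s 2}" unfolding s1_def
  proof (rule For_rule[where I = "\<lambda>i t. kept t = {..<i}"])
    fix i t assume "kept t = {..<i}" "rg t 11 = i"
    moreover have "kept (den (P1 6 (Var 11) (Num 1)) t) = insert (rg t 11) (kept t)" by (auto simp: kept_def)
    ultimately show "kept (den (P1 6 (Var 11) (Num 1)) t) = {..<Suc i}" by auto
  qed (use z in \<open>auto simp: kept_def\<close>)
  then have k1: "kept s1 = {..<n}" using n by simp
  have same1: "same (For 11 (P1 6 (Var 11) (Num 1))) s s1" unfolding s1_def by (rule same_den)
  have s1: "rg s1 2 = n" "ar s1 1 = ar s 1" "edge_at s1 = edge_at s"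
    using same_rg[OF same1, of 2] same_ar[OF same1, of 1] same_ar[OF same1, of 4] same_ar[OF same1, of 5] n
    by (simp_all add: edge_at_def fun_eq_iff)
  define E where "E = edge_at s"
  let ?F = "\<lambda>K. feasible \<T> (labelling id E K n)"
  let ?I = "\<lambda>e t. kept t \<subseteq> {..<n} \<and> ?F (kept t) \<and> (\<forall>i\<in>kept t. i < e \<longrightarrow> \<not> ?F (kept t - {i}))"
  define s2 where "s2 = den (For 11 tryC) s1"
  have "?I (rg s1 2) s2" unfolding s2_def
  proof (rule For_rule[where I = ?I])
    have "labelling id E UNIV n = labelling id E {..<n} n" by (rule labelling_cong) auto
    then show "?I 0 s1" using feas k1 by (simp add: E_def)
  next
    fix e t assume e: "e < rg s1 2" and I: "?I e t" and t: "same (For 11 tryC) s1 t" "rg t 11 = e"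
    have t': "rg t 2 = n" "ar t 1 = ar s 1" "edge_at t = E"
      using same_rg[OF t(1), of 2] same_ar[OF t(1), of 1] same_ar[OF t(1), of 4] same_ar[OF t(1), of 5] s1
      by (simp_all add: edge_at_def fun_eq_iff wr_tryC E_def)
    define K where "K = kept t"
    have "stores_terminals \<T> t" using stores_terminals stores_terminals_cong[OF t'(2)] by simp
    then have k: "kept (den tryC t) = (if ?F (K - {e}) then K - {e} else insert e K)"
      using den_tryC[of \<T> t] T E t' t by (simp add: E_def K_def)
    show "?I (Suc e) (den tryC t)"
    proof (cases "?F (K - {e})")
      case True
      have "\<not> ?F (K - {e} - {i})" if "i \<in> K - {e}" "i < Suc e" for i
      proof
        assume "?F (K - {e} - {i})"
        then have "?F (K - {i})" by (rule feasible_mono) auto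
        then show False using I that by (auto simp: K_def)
      qed
      then show ?thesis using k True I by (auto simp: K_def)
    next
      case False
      \<comment> \<open>\<open>K\<close> is feasible and \<open>K - {e}\<close> is not, so
        \<open>e\<close> was flagged, and setting its flag again restores \<open>K\<close>.\<close>
      then have "e \<in> K" using I unfolding K_def by (metis Diff_empty Diff_insert0)
      then have "insert e K = K" by (rule insert_absorb)
      then show ?thesis using k False I by (auto simp: K_def less_Suc_eq)
    qed
  qed (auto simp: wr_tryC kept_def)
  then have I: "?I n s2" using s1 by simp
  have d: "den pruneC s = den labelsC s2" by (simp add: pruneC_def s1_def s2_def)
  have K: "K = kept s2" by (simp add: K_def d kept_def ar_den wr_labelsC)
  have s2: "rg s2 2 = n" "edge_at s2 = E"
    using s1 by (simp_all add: s2_def rg_den ar_den wr_tryC edge_at_def fun_eq_iff E_def del: den.simps)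
  show "K \<subseteq> {..<n}" "feasible \<T> (labelling id (edge_at s) K n)" using I by (simp_all add: K E_def)
  show "\<not> feasible \<T> (labelling id (edge_at s) (K - {i}) n)" if "i \<in> K" for i
    using I that by (auto simp: K E_def)
  show "stores_labelling (labelling id (edge_at s) K n) (den pruneC s)"
    using den_labelsC[of s2] assms(4) s2 by (simp add: d K E_def)
qed

subsection \<open>Building and writing the cycles\<close>

definition tourC :: cmd where
  "tourC = For 4 (P1 7 (Var 4) (Var 4)) ;; For 25 (If (A1 6 (Var 25))
     (Set 20 (A1 4 (Var 25)) ;; Set 21 (A1 5 (Var 25)) ;; Set 22 (A1 7 (Var 20)) ;;
      P1 7 (Var 20) (A1 7 (Var 21)) ;; P1 7 (Var 21) (Var 22)) Nop)"

lemma wr_tourC: "wr_reg tourC = {4, 20, 21, 22, 25}" "wr_arr tourC = {7}" "\<not> reads tourC" "\<not> writes tourC" "wf tourC"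
  by (auto simp: tourC_def)

lemma den_tourC:
  assumes E: "\<And>i. i < rg s 2 \<Longrightarrow> fst (edge_at s i) < rg s 2 \<and> snd (edge_at s i) < rg s 2" and x: "x < rg s 2"
  shows "rd (den tourC s) 7 x = tour (edge_at s) (kept s) (rg s 2) x"
proof -
  let ?d = "For 4 (P1 7 (Var 4) (Var 4))"
  let ?c = "If (A1 6 (Var 25)) (Set 20 (A1 4 (Var 25)) ;; Set 21 (A1 5 (Var 25)) ;; Set 22 (A1 7 (Var 20)) ;;
      P1 7 (Var 20) (A1 7 (Var 21)) ;; P1 7 (Var 21) (Var 22)) Nop"
  define s1 where "s1 = den ?d s"
  have "\<forall>x<rg s 2. rd s1 7 x = x" unfolding s1_def
  proof (rule For_rule[where I = "\<lambda>i t. \<forall>x<i. rd t 7 x = x"])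
    fix i t assume "\<forall>x<i. rd t 7 x = x" "rg t 4 = i"
    then show "\<forall>x<Suc i. rd (den (P1 7 (Var 4) (Var 4)) t) 7 x = x" by (auto simp: less_Suc_eq)
  qed auto
  then have z: "\<And>x. x < rg s 2 \<Longrightarrow> rd s1 7 x = x" by simp
  have same1: "same ?d s s1" unfolding s1_def by (rule same_den)
  have s1: "rg s1 2 = rg s 2" "ar s1 4 = ar s 4" "ar s1 5 = ar s 5" "ar s1 6 = ar s 6"
    using same_rg[OF same1, of 2] same_ar[OF same1, of 4] same_ar[OF same1, of 5] same_ar[OF same1, of 6]
    by simp_all
  let ?I = "\<lambda>i t. \<forall>x<rg s 2. rd t 7 x = tour (edge_at s) (kept s) i x"
  have "?I (rg s1 2) (den (For 25 ?c) s1)"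
  proof (rule For_rule[where I = ?I])
    fix i t assume i: "i < rg s1 2" and I: "?I i t" and t: "same (For 25 ?c) s1 t" "rg t 25 = i"
    have t': "rg t 2 = rg s 2" "ar t 4 = ar s 4" "ar t 5 = ar s 5" "ar t 6 = ar s 6"
      using same_rg[OF t(1), of 2] same_ar[OF t(1), of 4] same_ar[OF t(1), of 5] same_ar[OF t(1), of 6] s1
      by simp_all
    have uv: "rd s 4 i < rg s 2" "rd s 5 i < rg s 2" using E[of i] i s1 by (auto simp: edge_at_def)
    show "?I (Suc i) (den ?c t)"
    proof (cases "i \<in> kept s")
      case True
      then show ?thesis using I t t' uv by (auto simp: kept_def edge_at_def)
    next
      case False
      then show ?thesis using I t t' by (simp add: kept_def)
    qed
  qed (use z s1 in auto)
  then have "?I (rg s 2) (den tourC s)" unfolding tourC_def den.simps(5) s1_def[symmetric] s1 .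
  then show ?thesis using x by simp
qed

abbreviation headE :: hexp where
  "headE \<equiv> Op Times (eqE (A1 2 (Var 4)) (Var 4)) (neE (A1 7 (Var 4)) (Var 4))"

text \<open>Two passes, because the length precedes the list in the encoding. The count also decides
  whether the edge leaving the representative gets copy 1.\<close>

definition cycleC :: cmd where
  "cycleC = Set 13 (Num 0) ;;
     For 5 (If (eqE (A1 2 (Var 5)) (Var 4)) (Set 13 (Op Plus (Var 13) (Num 1))) Nop) ;;
     Out (Var 13) ;;
     For 5 (If (eqE (A1 2 (Var 5)) (Var 4)) (Out (Var 5) ;; Out (A1 7 (Var 5)) ;;
       Out (Op Times (eqE (Var 13) (Num 2)) (eqE (Var 5) (Var 4)))) Nop)"

definition outputC :: cmd where
  "outputC = Set 12 (Num 0) ;; For 4 (If headE (Set 12 (Op Plus (Var 12) (Num 1))) Nop) ;;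
     Out (Var 12) ;; For 4 (If headE cycleC Nop)"

lemma wr_cycleC: "wr_reg cycleC = {5, 13}" "wr_arr cycleC = {}" "\<not> reads cycleC" "wf cycleC"
  by (auto simp: cycleC_def)

lemma wr_outputC: "wr_reg outputC = {4, 5, 12, 13}" "wr_arr outputC = {}" "\<not> reads outputC" "wf outputC"
  by (auto simp: outputC_def wr_cycleC)

lemma den_cycleC:
  assumes L: "\<And>x. x < rg s 2 \<Longrightarrow> rd s 2 x = L x" and f: "\<And>x. x < rg s 2 \<Longrightarrow> rd s 7 x = f x"
  defines "es \<equiv> cycle_list (rg s 2) L f (rg s 4)"
  shows "ot (den cycleC s) = ot s @ length es # concat (map (\<lambda>(u, v, k). [u, v, k]) es)"
proof -
  let ?n = "rg s 2" and ?v = "rg s 4"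
  let ?us = "\<lambda>i. filter (\<lambda>u. L u = ?v) [0..<i]"
  let ?c = "If (eqE (A1 2 (Var 5)) (Var 4)) (Set 13 (Op Plus (Var 13) (Num 1))) Nop"
  let ?d = "If (eqE (A1 2 (Var 5)) (Var 4)) (Out (Var 5) ;; Out (A1 7 (Var 5)) ;;
       Out (Op Times (eqE (Var 13) (Num 2)) (eqE (Var 5) (Var 4)))) Nop"
  define s1 where "s1 = den (Set 13 (Num 0)) s"
  have s1: "rg s1 2 = ?n" "rg s1 4 = ?v" "rg s1 13 = 0" "ar s1 = ar s" "ot s1 = ot s"
    by (simp_all add: s1_def)
  define s2 where "s2 = den (For 5 ?c) s1"
  have "rg s2 13 = length (?us (rg s1 2))" unfolding s2_def
  proof (rule For_rule[where I = "\<lambda>i t. rg t 13 = length (?us i)"])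
    fix i t assume i: "i < rg s1 2" and I: "rg t 13 = length (?us i)" and t: "same (For 5 ?c) s1 t" "rg t 5 = i"
    have t': "rg t 4 = ?v" "ar t 2 = ar s 2"
      using same_rg[OF t(1), of 4] same_ar[OF t(1), of 2] s1 by simp_all
    show "rg (den ?c t) 13 = length (?us (Suc i))"
      using I i t t' L[of i] s1 by simp
  qed (use s1 in auto)
  then have c13: "rg s2 13 = length (?us ?n)" using s1 by simp
  have same2: "same (For 5 ?c) s1 s2" unfolding s2_def by (rule same_den)
  have s2: "rg s2 2 = ?n" "rg s2 4 = ?v" "ar s2 2 = ar s 2" "ar s2 7 = ar s 7" "ot s2 = ot s"
    using same_rg[OF same2, of 2] same_rg[OF same2, of 4] same_ar[OF same2, of 2] same_ar[OF same2, of 7]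
      same_ot[OF same2] s1 by simp_all
  define s3 where "s3 = den (Out (Var 13)) s2"
  have s3: "rg s3 = rg s2" "ar s3 = ar s2" "ot s3 = ot s @ [length (?us ?n)]"
    using s2 c13 by (simp_all add: s3_def)
  let ?tr = "\<lambda>u. (u, f u, of_bool (length (?us ?n) = 2 \<and> u = ?v) :: nat)"
  let ?I = "\<lambda>i t. ot t = ot s3 @ concat (map (\<lambda>(u, v, k). [u, v, k]) (map ?tr (?us i)))"
  have "?I (rg s3 2) (den (For 5 ?d) s3)"
  proof (rule For_rule[where I = ?I])
    fix i t assume i: "i < rg s3 2" and I: "?I i t" and t: "same (For 5 ?d) s3 t" "rg t 5 = i"
    have t': "rg t 4 = ?v" "rg t 13 = length (?us ?n)" "ar t 2 = ar s 2" "ar t 7 = ar s 7"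
      using same_rg[OF t(1), of 4] same_rg[OF t(1), of 13] same_ar[OF t(1), of 2] same_ar[OF t(1), of 7]
        s3 s2 c13 by simp_all
    have Lf: "rd t 2 i = L i" "rd t 7 i = f i" using L[of i] f[of i] i s3 s2 t' by simp_all
    show "?I (Suc i) (den ?d t)"
      by (cases "L i = ?v") (use I t t'(1,2) Lf in simp_all)
  qed auto
  then have "?I ?n (den cycleC s)"
    unfolding cycleC_def den.simps(5) s1_def[symmetric] s2_def[symmetric] s3_def[symmetric] s3 s2 .
  then show ?thesis using s3 by (simp add: es_def cycle_list_def)
qed

lemma den_outputC:
  assumes L: "\<And>x. x < rg s 2 \<Longrightarrow> rd s 2 x = L x" and f: "\<And>x. x < rg s 2 \<Longrightarrow> rd s 7 x = f x"
  shows "ot (den outputC s) = ot s @ encode_lists (\<lambda>(u, v, k). [u, v, k]) (cycle_lists (rg s 2) L f)"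
proof -
  let ?n = "rg s 2"
  let ?vs = "\<lambda>i. filter (\<lambda>v. L v = v \<and> f v \<noteq> v) [0..<i]"
  let ?c = "If headE (Set 12 (Op Plus (Var 12) (Num 1))) Nop"
  let ?d = "If headE cycleC Nop"
  define s1 where "s1 = den (Set 12 (Num 0)) s"
  have s1: "rg s1 2 = ?n" "rg s1 12 = 0" "ar s1 = ar s" "ot s1 = ot s"
    by (simp_all add: s1_def)
  define s2 where "s2 = den (For 4 ?c) s1"
  have "rg s2 12 = length (?vs (rg s1 2))" unfolding s2_def
  proof (rule For_rule[where I = "\<lambda>i t. rg t 12 = length (?vs i)"])
    fix i t assume i: "i < rg s1 2" and I: "rg t 12 = length (?vs i)" and t: "same (For 4 ?c) s1 t" "rg t 4 = i"
    have t': "ar t 2 = ar s 2" "ar t 7 = ar s 7"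
      using same_ar[OF t(1), of 2] same_ar[OF t(1), of 7] s1 by simp_all
    show "rg (den ?c t) 12 = length (?vs (Suc i))"
      using I i t t' L[of i] f[of i] s1 by simp
  qed (use s1 in auto)
  then have c12: "rg s2 12 = length (?vs ?n)" using s1 by simp
  have same2: "same (For 4 ?c) s1 s2" unfolding s2_def by (rule same_den)
  have s2: "rg s2 2 = ?n" "ar s2 2 = ar s 2" "ar s2 7 = ar s 7" "ot s2 = ot s"
    using same_rg[OF same2, of 2] same_ar[OF same2, of 2] same_ar[OF same2, of 7]
      same_ot[OF same2] s1 by simp_all
  define s3 where "s3 = den (Out (Var 12)) s2"
  have s3: "rg s3 = rg s2" "ar s3 = ar s2" "ot s3 = ot s @ [length (?vs ?n)]"
    using s2 c12 by (simp_all add: s3_def)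
  let ?enc = "\<lambda>es. length es # concat (map (\<lambda>(u, v, k). [u, v, k :: nat]) es)"
  let ?I = "\<lambda>i t. ot t = ot s3 @ concat (map ?enc (map (cycle_list ?n L f) (?vs i)))"
  have "?I (rg s3 2) (den (For 4 ?d) s3)"
  proof (rule For_rule[where I = ?I])
    fix i t assume i: "i < rg s3 2" and I: "?I i t" and t: "same (For 4 ?d) s3 t" "rg t 4 = i"
    have t': "rg t 2 = ?n" "ar t 2 = ar s 2" "ar t 7 = ar s 7"
      using same_rg[OF t(1), of 2] same_ar[OF t(1), of 2] same_ar[OF t(1), of 7] s3 s2
      by (simp_all add: wr_cycleC)
    have Lf: "rd t 2 x = L x" "rd t 7 x = f x" if "x < ?n" for x using L f that t' by simp_all
    have e: "ot (den cycleC t) = ot t @ ?enc (cycle_list ?n L f i)"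
      using den_cycleC[of t L f] Lf t' t by simp
    have h: "ev t headE \<noteq> 0 \<longleftrightarrow> L i = i \<and> f i \<noteq> i" using Lf[of i] i s3 s2 t by simp
    show "?I (Suc i) (den ?d t)"
    proof (cases "ev t headE = 0")
      case True
      then have "den ?d t = t" by simp
      moreover have "?vs (Suc i) = ?vs i" using True h by simp
      ultimately show ?thesis using I by (simp only:)
    next
      case False
      then have "den ?d t = den cycleC t" by simp
      moreover have "?vs (Suc i) = ?vs i @ [i]" using False h by simp
      ultimately show ?thesis using I e by (simp del: ev.simps)
    qed
  qed (auto simp: wr_cycleC)
  then have "?I ?n (den outputC s)"
    unfolding outputC_def den.simps(5) s1_def[symmetric] s2_def[symmetric] s3_def[symmetric] s3 s2 .
  then show ?thesis using s3 by (simp add: encode_lists_def cycle_lists_def o_def)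
qed

subsection \<open>The approximation algorithm\<close>

definition steinerC :: cmd where
  "steinerC = weightsC ;; termsC ;; growC ;; pruneC ;; tourC ;; outputC"

lemma wf_steinerC: "wf steinerC" "2 \<notin> wr_reg steinerC"
  by (auto simp: steinerC_def wr_weightsC wr_termsC wr_growC wr_pruneC wr_tourC wr_outputC)

lemma opt_nonneg:
  assumes "steiner_instance V w \<T>"
  shows "0 \<le> opt V w \<T>"
proof -
  obtain \<C> where C: "disjoint_cycles V \<T> \<C>" "weight w \<C> = opt V w \<T>"
    using opt_attained(1)[OF assms] by blast
  have "0 \<le> w (ends e)" if "C \<in> \<C>" "e \<in> edges C" for C e
  proof -
    have "e \<in> medges V \<T>" using that C(1) unfolding disjoint_cycles_def cycle_def subgraph_def by blast
    then show ?thesis using assms by (auto simp: medges_def steiner_instance_def)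
  qed
  then have "0 \<le> weight w \<C>" unfolding weight_def by (intro sum_nonneg) auto
  then show ?thesis using C by simp
qed

text \<open>The reading loops make only \<open>n\<close> rounds. There are at most \<open>n\<close>
  terminal sets, as they are disjoint and nonempty, and a list without repetition has at most
  \<open>n\<close> entries.\<close>

lemma encode_bounds:
  assumes inst: "steiner_instance {..<n} w (set (map set ts))" and d: "distinct (map set ts)"
    and dt: "\<forall>t\<in>set ts. distinct t"
  shows "length ts \<le> n" "\<And>t. t \<in> set ts \<Longrightarrow> length t \<le> n"
    "\<And>i j v. i < length ts \<Longrightarrow> j < length ts \<Longrightarrow> v \<in> set (ts ! i) \<Longrightarrow> v \<in> set (ts ! j) \<Longrightarrow> i = j"
proof -
  have sub: "set t \<subseteq> {..<n}" "2 \<le> card (set t)" if "t \<in> set ts" for t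
    using inst that by (auto simp: steiner_instance_def)
  have disj: "pairwise disjnt (set (map set ts))" using inst by (simp add: steiner_instance_def)
  show len: "length t \<le> n" if "t \<in> set ts" for t
    using card_mono[OF _ sub(1)[OF that]] distinct_card[of t] dt that by simp
  show "i = j" if "i < length ts" "j < length ts" "v \<in> set (ts ! i)" "v \<in> set (ts ! j)" for i j v
  proof (rule ccontr)
    assume "i \<noteq> j"
    then have "set (ts ! i) \<noteq> set (ts ! j)" using d that by (simp add: distinct_conv_nth)
    then have "disjnt (set (ts ! i)) (set (ts ! j))"
      using disj that by (auto simp: pairwise_def)
    then show False using that by (auto simp: disjnt_def)
  qed
  have "length ts = card (set (map set ts))" using distinct_card[OF d] by simp
  also have "\<dots> \<le> (\<Sum>T\<in>set (map set ts). card T)"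
    using sub(2) sum_mono[of "set (map set ts)" "\<lambda>_. 1" card] by force
  also have "\<dots> = card (\<Union>(set (map set ts)))"
    using disj by (intro card_Union_disjoint[symmetric]) auto
  also have "\<dots> \<le> card {..<n}" using sub(1) by (intro card_mono) auto
  finally show "length ts \<le> n" by simp
qed

lemma stores_terminalsI:
  assumes "\<And>v k. rd s 1 v = Suc k \<longleftrightarrow> k < length ts \<and> v \<in> set (ts ! k)"
  shows "stores_terminals (set (map set ts)) s"
  unfolding stores_terminals_def
proof (intro allI iffI)
  fix u v assume "rd s 1 u \<noteq> 0 \<and> rd s 1 u = rd s 1 v"
  then obtain k where "rd s 1 u = Suc k" "rd s 1 v = Suc k" by (metis not0_implies_Suc)
  then have "k < length ts" "u \<in> set (ts ! k)" "v \<in> set (ts ! k)" using assms by auto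
  then show "\<exists>T\<in>set (map set ts). u \<in> T \<and> v \<in> T" by (auto intro!: bexI[of _ "ts ! k"])
next
  fix u v assume "\<exists>T\<in>set (map set ts). u \<in> T \<and> v \<in> T"
  then obtain t where "t \<in> set ts" "u \<in> set t" "v \<in> set t" by auto
  then obtain k where "k < length ts" "u \<in> set (ts ! k)" "v \<in> set (ts ! k)"
    by (metis in_set_conv_nth)
  then have "rd s 1 u = Suc k" "rd s 1 v = Suc k" using assms by auto
  then show "rd s 1 u \<noteq> 0 \<and> rd s 1 u = rd s 1 v" by simp
qed

lemma steinerC_correct:
  assumes inst: "metric_instance {..<n} w \<T>" and enc: "encodes_instance n w \<T> (n # xs)"
  defines "ys \<equiv> ot (den steinerC \<lparr>rg = (\<lambda>_. 0)(0 := n, 2 := n), ar = (\<lambda>_ _ _. 0), ip = xs, ot = []\<rparr>)"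
  shows "\<exists>\<C>. encodes_cycles \<C> ys \<and> disjoint_cycles {..<n} \<T> \<C> \<and> cycles_respect \<T> \<C> \<and>
    weight w \<C> \<le> 3 * opt {..<n} w \<T>"
proof -
  have st: "steiner_instance {..<n} w \<T>" using inst by (simp add: metric_instance_def)
  obtain ts where ts: "\<T> = set (map set ts)" "distinct (map set ts)" "\<forall>t\<in>set ts. distinct t"
    and xs: "xs = concat (map (\<lambda>j. concat (map (\<lambda>i. encode_weight (w {i, j})) [0..<j])) [0..<n])
             @ encode_lists (\<lambda>v. [v]) ts"
    using enc unfolding encodes_instance_def by auto
  have w: "0 \<le> w {u, v}" if "u < n" "v < n" "u \<noteq> v" for u v
    using st that by (simp add: steiner_instance_def)
  have T: "T \<subseteq> {..<n}" if "T \<in> \<T>" for T using st that by (auto simp: steiner_instance_def)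
  note bd = encode_bounds[OF st[unfolded ts(1)] ts(2,3)]
  define s0 where "s0 = \<lparr>rg = (\<lambda>_. 0)(0 := n, 2 := n), ar = (\<lambda>_ _ _. 0), ip = xs, ot = []\<rparr>"
  define s1 where "s1 = den weightsC s0"
  define s2 where "s2 = den termsC s1"
  define s3 where "s3 = den growC s2"
  define s4 where "s4 = den pruneC s3"
  define s5 where "s5 = den tourC s4"
  have s0: "rg s0 2 = n" "ip s0 = xs" "ot s0 = []" "\<And>k. ar s0 k = (\<lambda>_ _. 0)" by (simp_all add: s0_def)
  have s1: "rg s1 2 = n" "ot s1 = []" "\<And>k. k \<noteq> 0 \<Longrightarrow> ar s1 k = (\<lambda>_ _. 0)"
    using s0 by (simp_all add: s1_def rg_den ar_den ot_den wr_weightsC)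
  have sc1: "scaled (\<lambda>u v. True) w s1" "ip s1 = encode_lists (\<lambda>v. [v]) ts"
    unfolding s1_def by (rule den_weightsC; use w s0 xs in simp)+
  have s2: "rg s2 2 = n" "rg s2 3 = rg s1 3" "ar s2 0 = ar s1 0" "ot s2 = []"
    "\<And>k. k \<notin> {0, 1} \<Longrightarrow> ar s2 k = (\<lambda>_ _. 0)"
    using s1 by (simp_all add: s2_def rg_den ar_den ot_den wr_termsC)
  have sc2: "scaled (\<lambda>u v. True) w s2" using sc1 s1 s2 by (simp add: scaled_def)
  have tids2: "stores_terminals \<T> s2" unfolding ts(1)
  proof (rule stores_terminalsI)
    show "rd s2 1 v = Suc k \<longleftrightarrow> k < length ts \<and> v \<in> set (ts ! k)" for v k
      unfolding s2_def by (rule den_termsC) (use sc1 s1 bd in auto)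
  qed
  have g3: "grown w \<T> n s3"
    using den_growC[OF sc2 tids2] T s2 by (simp add: s3_def edge_at_def)
  have s3: "rg s3 2 = n" "ot s3 = []" "ar s3 1 = ar s2 1" "ar s3 6 = (\<lambda>_ _. 0)"
    using s2 by (simp_all add: s3_def rg_den ar_den ot_den wr_growC)
  define E where "E = edge_at s3"
  have inv: "dual_inv n w \<T> n E (ar s3 0)" using g3 s3 by (simp add: grown_def E_def)
  have E: "fst (E i) < n \<and> snd (E i) < n" if "i < n" for i
    using inv that unfolding dual_inv_def by blast
  have forest: "fst (E i) = snd (E i) \<or> labelling id E UNIV i (fst (E i)) \<noteq> labelling id E UNIV i (snd (E i))"
    if "i < n" for i
    using inv that unfolding dual_inv_def by blast
  have tids3: "stores_terminals \<T> s3" using tids2 stores_terminals_cong[OF s3(3)] by simp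
  define K where "K = kept s4"
  have K: "K \<subseteq> {..<n}" "feasible \<T> (labelling id E K n)"
    "\<And>i. i \<in> K \<Longrightarrow> \<not> feasible \<T> (labelling id E (K - {i}) n)" and L4: "stores_labelling (labelling id E K n) s4"
    using den_pruneC[OF tids3 T s3(1)] E dual_inv_feasible[OF inv st] s3
    by (simp_all add: K_def s4_def E_def)
  have s4: "rg s4 2 = n" "ot s4 = []" "edge_at s4 = E"
    using s3 by (simp_all add: s4_def rg_den ar_den ot_den wr_pruneC E_def edge_at_def fun_eq_iff)
  have s5: "rg s5 2 = n" "ot s5 = []" "ar s5 2 = ar s4 2"
    using s4 by (simp_all add: s5_def rg_den ar_den ot_den wr_tourC)
  have L5: "rd s5 2 x = labelling id E K n x" if "x < rg s5 2" for x
    using stores_labellingD[OF L4] that s4 s5 by simp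
  have f5: "rd s5 7 x = tour E K n x" if "x < rg s5 2" for x
    using den_tourC[of s4 x] E that s4 s5 by (simp add: s5_def K_def)
  have ys: "ys = encode_lists (\<lambda>(u, v, k). [u, v, k]) (cycle_lists n (labelling id E K n) (tour E K n))"
    using den_outputC[of s5, OF L5 f5] s5
    by (simp add: ys_def steinerC_def s0_def[symmetric] s1_def[symmetric] s2_def[symmetric]
        s3_def[symmetric] s4_def[symmetric] s5_def[symmetric])
  define \<C> where "\<C> = set (map subgraph_of (cycle_lists n (labelling id E K n) (tour E K n)))"
  note sol = tour_solution[OF inst E forest K, folded \<C>_def ys]
  have "weight w \<C> \<le> 2 * (\<Sum>i\<in>K. w {fst (E i), snd (E i)})" by (rule sol(4))
  also have "\<dots> \<le> 2 * opt {..<n} w \<T>"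
    using dual_inv_final[OF inv st K] by simp
  also have "\<dots> \<le> 3 * opt {..<n} w \<T>" using opt_nonneg[OF st] by simp
  finally show ?thesis using sol(1,2,3) by blast
qed

text \<open>The number \<open>n\<close> itself is written in binary, but the last row of weights
  alone consists of \<open>2 * (n - 1)\<close> numbers, so \<open>n\<close> rounds are
  affordable.\<close>

lemma encodes_instance_size:
  assumes "encodes_instance n w \<T> xs"
  shows "\<exists>ys. xs = n # ys" "n \<le> input_size xs"
proof -
  let ?row = "\<lambda>j. concat (map (\<lambda>i. encode_weight (w {i, j})) [0..<j])"
  obtain zs where xs: "xs = n # concat (map ?row [0..<n]) @ zs"
    using assms unfolding encodes_instance_def by blast
  then show "\<exists>ys. xs = n # ys" by blast
  have "length (concat (map (\<lambda>i. encode_weight (g i)) [0..<j])) = 2 * j" for g j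
    by (induction j) (auto simp: encode_weight_def split: prod.splits)
  then have row: "length (?row j) = 2 * j" for j .
  have "n \<le> length xs"
  proof (cases n)
    case (Suc m)
    then have "length xs \<ge> 1 + length (?row m)" unfolding xs by simp
    then show ?thesis using Suc unfolding row by simp
  qed simp
  also have "\<dots> \<le> input_size xs"
    by (induction xs) (auto simp: input_size_def len_def)
  finally show "n \<le> input_size xs" .
qed

theorem theorem1:
  shows "\<exists>(A :: prog) (p :: nat poly).
    \<forall>(n :: nat) (w :: nat set \<Rightarrow> rat) (\<T> :: nat set set) (xs :: nat list).
      metric_instance {..<n} w \<T> \<and> encodes_instance n w \<T> xs \<longrightarrow>
      (\<exists>(t :: nat) (ys :: nat list) (\<C> :: nat subgraph set).
         runs A xs t ys \<and> t \<le> poly p (input_size xs) \<and>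
         encodes_cycles \<C> ys \<and>
         disjoint_cycles {..<n} \<T> \<C> \<and> cycles_respect \<T> \<C> \<and>
         weight w \<C> \<le> 3 * opt {..<n} w \<T>)"
proof -
  let ?A = "compile (In 0 ;; Set 2 (Var 0) ;; steinerC)"
  let ?out = "\<lambda>n ys. ot (den steinerC
      \<lparr>rg = (\<lambda>_. 0)(0 := n, 2 := n), ar = (\<lambda>_ _ _. 0), ip = ys, ot = []\<rparr>)"
  obtain p where p: "\<And>n ys. n \<le> input_size (n # ys) \<Longrightarrow>
      \<exists>t. runs ?A (n # ys) t (?out n ys) \<and> t \<le> poly p (input_size (n # ys))"
    using compile_poly_time[OF wf_steinerC] by blast
  show ?thesis
  proof (intro exI[of _ ?A] exI[of _ p] allI impI, elim conjE)
    fix n w \<T> xs assume inst: "metric_instance {..<n} w \<T>" and enc: "encodes_instance n w \<T> xs"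
    obtain ys where xs: "xs = n # ys" using encodes_instance_size(1)[OF enc] by blast
    show "\<exists>t ys \<C>. runs ?A xs t ys \<and> t \<le> poly p (input_size xs) \<and> encodes_cycles \<C> ys \<and>
         disjoint_cycles {..<n} \<T> \<C> \<and> cycles_respect \<T> \<C> \<and> weight w \<C> \<le> 3 * opt {..<n} w \<T>"
      using p[of n ys] steinerC_correct[OF inst enc[unfolded xs]] encodes_instance_size(2)[OF enc]
      unfolding xs by blast
  qed
qed

end
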